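(* Let $X$ be a topological rack and let $\mathfrak{A}=(\mathcal{A},\eta,\tau)$ be an $X$-module. Then the set $Ext(X,\mathfrak{A})$ of equivalence classes of central $\mathfrak{A}$-extensions of $X$ is an abelian group under Baer sum $[(E,p)]+[(F,q)]:=[(E\sqcup_X F,p)]$, where the inverse of the class of $(E,p)$ is the class of the opposite extension $(E^\circ,p^\circ)$, and the zero element is the class of the trivial central $\mathfrak{A}$-extension $(\mathfrak{A}\ltimes X,\tilde\pi)$.
   Context: **Racks.** A rack is a set $X$ with a binary operation $\triangleleft:X\times X\to X$ such that (i) for all $x,y\in X$ there is a unique $z\in X$ with $y=z\triangleleft x$; (ii) $(x\triangleleft y)\triangleleft z=(x\triangleleft z)\triangleleft(y\triangleleft z)$ for all $x,y,z\in X$. A quandle is a rack with $x\triangleleft x=x$ for all $x$. A topological rack is a rack which is a topological space such that $\triangleleft:X\times X\to X$ is continuous. A (topological) rack homomorphism is a continuous map $f$ with $f(x\triangleleft y)=f(x)\triangleleft f(y)$. **Modules.** A group bundle over a topological space $X$ is a topological space $\mathcal{A}$ with a surjective open continuous map $\pi:\mathcal{A}\to X$ such that each fibre $\mathcal{A}_x=\pi^{-1}(x)$ is a topological group. A rack group bundle over a topological rack $X$ is a pair $(\mathcal{A},\eta)$ where $\mathcal{A}$ is a group bundle over $X$ and $\eta$ is a family of isomorphisms (of topological groups) $\eta_{x,y}:\mathcal{A}_x\to\mathcal{A}_{x\triangleleft y}$ with $\eta_{x\triangleleft y,z}\eta_{x,y}=\eta_{x\triangleleft z,y\triangleleft z}\eta_{x,z}$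 for all $x,y,z\in X$. An $X$-module is a triple $\mathfrak{A}=(\mathcal{A},\eta,\tau)$ where $(\mathcal{A},\eta)$ is a rack group bundle over $X$ and $\tau$ is a family of topological group morphisms $\tau_{x,y}:\mathcal{A}_y\to\mathcal{A}_{x\triangleleft y}$ such that for all $x,y,z$: (1) $\mathcal{A}_x$ is abelian; (2) $\eta_{x\triangleleft y,z}\tau_{x,y}=\tau_{x\triangleleft z,y\triangleleft z}\eta_{y,z}$; (3) $\tau_{x\triangleleft y,z}=\eta_{x\triangleleft z,y\triangleleft z}\tau_{x,z}+\tau_{x\triangleleft z,y\triangleleft z}\tau_{y,z}$; and, if $X$ is a quandle, (4) $\tau_{x,x}+\eta_{x,x}=\mathrm{id}_{\mathcal{A}_x}$. **Central extensions.** A central $\mathfrak{A}$-extension $(E,p)$ of $X$ consists of a topological rack $E$; a surjective rack homomorphism $p:E\to X$ with continuous local sections; and a continuous $\mathcal{A}$-principal action on $E$, i.e. a continuous map $E\times_X\mathcal{A}\to E$, $(e,a)\mapsto e\cdot a$, where $E\times_X\mathcal{A}=\{(e,a)\in E\times\mathcal{A}: p(e)=\pi(a)\}$, which restricts to an action of the group $\mathcal{A}_x$ on the fibre $E_x=p^{-1}(x)$ for each $x\in X$, and such that for all $x\in X$ and $e,e'\in E_x$ there is a unique $a(e,e')\in\mathcal{A}_x$ with $e'=e\cdot a(e,e')$. These must satisfy: (1) $(e\cdot a)\triangleleft f=(e\triangleleft f)\cdot\eta_{x,y}(a)$ for all $(e,a)\in E\times_X\mathcal{A}$, $f\in E$ with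 $p(e)=x$, $p(f)=y$; (2) $e\triangleleft(f\cdot b)=(e\triangleleft f)\cdot\tau_{x,y}(b)$ for all $e\in E$, $(f,b)\in E\times_X\mathcal{A}$ with $p(e)=x$, $p(f)=y$. **Equivalence.** A morphism $\varphi:(E,p)\to(F,q)$ of central $\mathfrak{A}$-extensions of $X$ is a topological rack homomorphism $\varphi:E\to F$ with $q(\varphi(e))=p(e)$ for all $e\in E$ and $\varphi(e\cdot a)=\varphi(e)\cdot a$ for all $(e,a)\in E\times_X\mathcal{A}$. Two central $\mathfrak{A}$-extensions are equivalent if there is a morphism between them which is an isomorphism of topological racks whose inverse is also a morphism of central $\mathfrak{A}$-extensions. $Ext(X,\mathfrak{A})$ is the set of equivalence classes. **Trivial extension.** $\mathfrak{A}\ltimes X=\{(a,x)\in\mathcal{A}\times X: a\in\mathcal{A}_x\}$ with the subspace topology from $\mathcal{A}\times X$, the operation $(a,x)\triangleleft(b,y)=(\eta_{x,y}(a)+\tau_{x,y}(b),x\triangleleft y)$, projection $\tilde\pi(a,x)=x$, and action $(a,x)\cdot b=(a+b,x)$ for $b\in\mathcal{A}_x$. **Baer sum.** For central $\mathfrak{A}$-extensions $(E,p)$, $(F,q)$ of $X$, let $E\times_XF=\{(e,f)\in E\times F: p(e)=q(f)\}$ and let $E\sqcup_XF$ be its topological quotient by the equivalence relation $(e\cdot a,f)\sim(e,f\cdot a)$; write $[e,f]$ for the class of $(e,f)$. It carries the operation $[e_1,f_1]\triangleleft[e_2,f_2]=[e_1\triangleleft e_2,f_1\triangleleft f_2]$,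 the action $[e,f]\cdot a=[e\cdot a,f]=[e,f\cdot a]$, and the projection $p([e,f])=p(e)=q(f)$. **Opposite.** $(E^\circ,p^\circ)$ is the central $\mathfrak{A}$-extension where $E^\circ=E$ as a topological rack (write $e^\circ$ for $e$ viewed in $E^\circ$), $p^\circ(e^\circ)=p(e)$, and $e^\circ\cdot a=(e\cdot a^{-1})^\circ$, with $a^{-1}$ the inverse of $a$ in the abelian group $\mathcal{A}_{p(e)}$.
   Formalization: Added, as the claim fails otherwise: addition and inverse are continuous on the whole group bundle, the families η and τ are jointly continuous in base point and fibre element, and a principal action must have a continuous map (e,e') ↦ a(e,e'). *)

theory Defs
  imports "HOL-Analysis.Abstract_Topology" "HOL-Analysis.Product_Topology" "HOL-Algebra.Group"
begin

text \<open>The underlying set of a topological rack is the \<^const>\<open>topspace\<close> of its topology;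
  the operation is only meaningful on that set.\<close>

record 'x top_rack =
  rtop :: "'x topology"
  rop :: "'x \<Rightarrow> 'x \<Rightarrow> 'x" (infixl "\<triangleleft>\<index>" 70)

abbreviation rset :: "('x, 'm) top_rack_scheme \<Rightarrow> 'x set" where
  "rset X \<equiv> topspace (rtop X)"

definition rack :: "('x, 'm) top_rack_scheme \<Rightarrow> bool" where
  "rack X \<longleftrightarrow>
     (\<forall>x\<in>rset X. \<forall>y\<in>rset X. x \<triangleleft>\<^bsub>X\<^esub> y \<in> rset X) \<and>
     (\<forall>x\<in>rset X. \<forall>y\<in>rset X. \<exists>!z. z \<in> rset X \<and> y = z \<triangleleft>\<^bsub>X\<^esub> x) \<and>
     (\<forall>x\<in>rset X. \<forall>y\<in>rset X. \<forall>z\<in>rset X.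
        (x \<triangleleft>\<^bsub>X\<^esub> y) \<triangleleft>\<^bsub>X\<^esub> z = (x \<triangleleft>\<^bsub>X\<^esub> z) \<triangleleft>\<^bsub>X\<^esub> (y \<triangleleft>\<^bsub>X\<^esub> z))"

definition quandle :: "('x, 'm) top_rack_scheme \<Rightarrow> bool" where
  "quandle X \<longleftrightarrow> rack X \<and> (\<forall>x\<in>rset X. x \<triangleleft>\<^bsub>X\<^esub> x = x)"

definition topological_rack :: "('x, 'm) top_rack_scheme \<Rightarrow> bool" where
  "topological_rack X \<longleftrightarrow>
     rack X \<and> continuous_map (prod_topology (rtop X) (rtop X)) (rtop X) (\<lambda>(x, y). x \<triangleleft>\<^bsub>X\<^esub> y)"

definition rack_hom ::
  "('x, 'm) top_rack_scheme \<Rightarrow> ('y, 'n) top_rack_scheme \<Rightarrow> ('x \<Rightarrow> 'y) \<Rightarrow> bool" where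
  "rack_hom X Y f \<longleftrightarrow>
     continuous_map (rtop X) (rtop Y) f \<and>
     (\<forall>x\<in>rset X. \<forall>y\<in>rset X. f (x \<triangleleft>\<^bsub>X\<^esub> y) = f x \<triangleleft>\<^bsub>Y\<^esub> f y)"

definition fibre_product :: "'e topology \<Rightarrow> ('e \<Rightarrow> 'x) \<Rightarrow> 'f topology \<Rightarrow> ('f \<Rightarrow> 'x) \<Rightarrow> ('e \<times> 'f) topology" where
  "fibre_product S p T q = subtopology (prod_topology S T) {(e, f). p e = q f}"

definition topological_group :: "'a topology \<Rightarrow> 'a monoid \<Rightarrow> bool" where
  "topological_group T G \<longleftrightarrow>
     group G \<and> topspace T = carrier G \<and>
     continuous_map (prod_topology T T) T (\<lambda>(a, b). a \<otimes>\<^bsub>G\<^esub> b) \<and>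
     continuous_map T T (\<lambda>a. inv\<^bsub>G\<^esub> a)"

text \<open>\<open>fibre A x\<close> is the group on the fibre over \<open>x\<close>.  The fibres are written multiplicatively
  throughout, also when they are abelian.\<close>

record ('x, 'a) group_bundle =
  total :: "'a topology"
  bproj :: "'a \<Rightarrow> 'x"
  fibre :: "'x \<Rightarrow> 'a monoid"

definition fibre_top :: "('x, 'a, 'm) group_bundle_scheme \<Rightarrow> 'x \<Rightarrow> 'a topology" where
  "fibre_top A x = subtopology (total A) {a. bproj A a = x}"

text \<open>The last two conjuncts say that the group operations of the fibres fit together to
  continuous maps on \<open>A \<times>\<^sub>X A\<close> and on \<open>A\<close>.  This is the usual meaning of a bundle of topological
  groups and does not follow from every single fibre being a topological group; without it
  the action of the bundle on the trivial extension need not be continuous.\<close>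

definition group_bundle :: "'x topology \<Rightarrow> ('x, 'a, 'm) group_bundle_scheme \<Rightarrow> bool" where
  "group_bundle T A \<longleftrightarrow>
     continuous_map (total A) T (bproj A) \<and>
     open_map (total A) T (bproj A) \<and>
     bproj A ` topspace (total A) = topspace T \<and>
     (\<forall>x\<in>topspace T. topological_group (fibre_top A x) (fibre A x)) \<and>
     continuous_map (fibre_product (total A) (bproj A) (total A) (bproj A))
       (total A) (\<lambda>(a, b). a \<otimes>\<^bsub>fibre A (bproj A a)\<^esub> b) \<and>
     continuous_map (total A) (total A) (\<lambda>a. inv\<^bsub>fibre A (bproj A a)\<^esub> a)"

record ('x, 'a) rack_module = "('x, 'a) group_bundle" +
  eta :: "'x \<Rightarrow> 'x \<Rightarrow> 'a \<Rightarrow> 'a"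
  tau :: "'x \<Rightarrow> 'x \<Rightarrow> 'a \<Rightarrow> 'a"

text \<open>As for the group operations, the families \<open>\<eta>\<close> and \<open>\<tau>\<close> are required to be continuous as
  families: \<open>(a, y) \<mapsto> \<eta>\<^bsub>\<pi>(a),y\<^esub>(a)\<close> on \<open>A \<times> X\<close>, and \<open>(x, b) \<mapsto> \<tau>\<^bsub>x,\<pi>(b)\<^esub>(b)\<close> on \<open>X \<times> A\<close>.
  Given a continuous group bundle this is precisely what makes the operation of the trivial
  extension continuous.\<close>

definition rack_group_bundle ::
  "('x, 'n) top_rack_scheme \<Rightarrow> ('x, 'a, 'm) rack_module_scheme \<Rightarrow> bool" where
  "rack_group_bundle X A \<longleftrightarrow>
     group_bundle (rtop X) A \<and>
     (\<forall>x\<in>rset X. \<forall>y\<in>rset X.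
        eta A x y \<in> iso (fibre A x) (fibre A (x \<triangleleft>\<^bsub>X\<^esub> y)) \<and>
        homeomorphic_map (fibre_top A x) (fibre_top A (x \<triangleleft>\<^bsub>X\<^esub> y)) (eta A x y)) \<and>
     (\<forall>x\<in>rset X. \<forall>y\<in>rset X. \<forall>z\<in>rset X. \<forall>a\<in>carrier (fibre A x).
        eta A (x \<triangleleft>\<^bsub>X\<^esub> y) z (eta A x y a) = eta A (x \<triangleleft>\<^bsub>X\<^esub> z) (y \<triangleleft>\<^bsub>X\<^esub> z) (eta A x z a)) \<and>
     continuous_map (prod_topology (total A) (rtop X)) (total A) (\<lambda>(a, y). eta A (bproj A a) y a)"

definition rack_module ::
  "('x, 'n) top_rack_scheme \<Rightarrow> ('x, 'a, 'm) rack_module_scheme \<Rightarrow> bool" where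
  "rack_module X A \<longleftrightarrow>
     rack_group_bundle X A \<and>
     (\<forall>x\<in>rset X. \<forall>y\<in>rset X.
        tau A x y \<in> hom (fibre A y) (fibre A (x \<triangleleft>\<^bsub>X\<^esub> y)) \<and>
        continuous_map (fibre_top A y) (fibre_top A (x \<triangleleft>\<^bsub>X\<^esub> y)) (tau A x y)) \<and>
     continuous_map (prod_topology (rtop X) (total A)) (total A) (\<lambda>(x, b). tau A x (bproj A b) b) \<and>
     (\<forall>x\<in>rset X. comm_group (fibre A x)) \<and>
     (\<forall>x\<in>rset X. \<forall>y\<in>rset X. \<forall>z\<in>rset X. \<forall>b\<in>carrier (fibre A y).
        eta A (x \<triangleleft>\<^bsub>X\<^esub> y) z (tau A x y b) = tau A (x \<triangleleft>\<^bsub>X\<^esub> z) (y \<triangleleft>\<^bsub>X\<^esub> z) (eta A y z b)) \<and>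
     (\<forall>x\<in>rset X. \<forall>y\<in>rset X. \<forall>z\<in>rset X. \<forall>c\<in>carrier (fibre A z).
        tau A (x \<triangleleft>\<^bsub>X\<^esub> y) z c =
          eta A (x \<triangleleft>\<^bsub>X\<^esub> z) (y \<triangleleft>\<^bsub>X\<^esub> z) (tau A x z c)
            \<otimes>\<^bsub>fibre A ((x \<triangleleft>\<^bsub>X\<^esub> y) \<triangleleft>\<^bsub>X\<^esub> z)\<^esub>
          tau A (x \<triangleleft>\<^bsub>X\<^esub> z) (y \<triangleleft>\<^bsub>X\<^esub> z) (tau A y z c)) \<and>
     (quandle X \<longrightarrow>
        (\<forall>x\<in>rset X. \<forall>a\<in>carrier (fibre A x). tau A x x a \<otimes>\<^bsub>fibre A x\<^esub> eta A x x a = a))"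

record ('e, 'x, 'a) extension = "'e top_rack" +
  eproj :: "'e \<Rightarrow> 'x"
  act :: "'e \<Rightarrow> 'a \<Rightarrow> 'e" (infixl "\<cdot>\<index>" 75)

definition continuous_local_sections :: "'e topology \<Rightarrow> 'x topology \<Rightarrow> ('e \<Rightarrow> 'x) \<Rightarrow> bool" where
  "continuous_local_sections S T p \<longleftrightarrow>
     (\<forall>x\<in>topspace T. \<exists>U s. openin T U \<and> x \<in> U \<and>
        continuous_map (subtopology T U) S s \<and> (\<forall>u\<in>U. p (s u) = u))"

text \<open>The element \<open>a(e, e')\<close>; well-defined for an action that is simply transitive on fibres.\<close>

definition translation ::
  "('x, 'a, 'm) rack_module_scheme \<Rightarrow> ('e, 'x, 'a, 'k) extension_scheme \<Rightarrow> 'e \<Rightarrow> 'e \<Rightarrow> 'a" where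
  "translation A E e e' = (THE a. a \<in> carrier (fibre A (eproj E e)) \<and> e' = e \<cdot>\<^bsub>E\<^esub> a)"

text \<open>As usual for principal bundles, a continuous principal action is one for which the
  translation function \<open>(e, e') \<mapsto> a(e, e')\<close> on \<open>E \<times>\<^sub>X E\<close> is continuous as well.  Without this, the
  discrete reals acting on the topological reals by addition would be allowed (over a
  one-point rack), and the class of that extension has no inverse.\<close>

definition principal_action ::
  "('x, 'n) top_rack_scheme \<Rightarrow> ('x, 'a, 'm) rack_module_scheme \<Rightarrow> ('e, 'x, 'a, 'k) extension_scheme \<Rightarrow> bool"
where
  "principal_action X A E \<longleftrightarrow>
     continuous_map (fibre_product (rtop E) (eproj E) (total A) (bproj A)) (rtop E) (\<lambda>(e, a). e \<cdot>\<^bsub>E\<^esub> a) \<and>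
     (\<forall>e\<in>rset E. e \<cdot>\<^bsub>E\<^esub> \<one>\<^bsub>fibre A (eproj E e)\<^esub> = e \<and>
        (\<forall>a\<in>carrier (fibre A (eproj E e)).
           eproj E (e \<cdot>\<^bsub>E\<^esub> a) = eproj E e \<and>
           (\<forall>b\<in>carrier (fibre A (eproj E e)).
              e \<cdot>\<^bsub>E\<^esub> (a \<otimes>\<^bsub>fibre A (eproj E e)\<^esub> b) = (e \<cdot>\<^bsub>E\<^esub> a) \<cdot>\<^bsub>E\<^esub> b))) \<and>
     (\<forall>x\<in>rset X. \<forall>e\<in>rset E. \<forall>e'\<in>rset E. eproj E e = x \<and> eproj E e' = x \<longrightarrow>
        (\<exists>!a. a \<in> carrier (fibre A x) \<and> e' = e \<cdot>\<^bsub>E\<^esub> a)) \<and>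
     continuous_map (fibre_product (rtop E) (eproj E) (rtop E) (eproj E)) (total A)
       (\<lambda>(e, e'). translation A E e e')"

definition central_extension ::
  "('x, 'n) top_rack_scheme \<Rightarrow> ('x, 'a, 'm) rack_module_scheme \<Rightarrow> ('e, 'x, 'a, 'k) extension_scheme \<Rightarrow> bool"
where
  "central_extension X A E \<longleftrightarrow>
     topological_rack E \<and>
     rack_hom E X (eproj E) \<and>
     eproj E ` rset E = rset X \<and>
     continuous_local_sections (rtop E) (rtop X) (eproj E) \<and>
     principal_action X A E \<and>
     (\<forall>e\<in>rset E. \<forall>f\<in>rset E. \<forall>a\<in>carrier (fibre A (eproj E e)).
        (e \<cdot>\<^bsub>E\<^esub> a) \<triangleleft>\<^bsub>E\<^esub> f = (e \<triangleleft>\<^bsub>E\<^esub> f) \<cdot>\<^bsub>E\<^esub> (eta A (eproj E e) (eproj E f) a)) \<and>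
     (\<forall>e\<in>rset E. \<forall>f\<in>rset E. \<forall>b\<in>carrier (fibre A (eproj E f)).
        e \<triangleleft>\<^bsub>E\<^esub> (f \<cdot>\<^bsub>E\<^esub> b) = (e \<triangleleft>\<^bsub>E\<^esub> f) \<cdot>\<^bsub>E\<^esub> (tau A (eproj E e) (eproj E f) b))"

definition ext_morphism ::
  "('x, 'a, 'm) rack_module_scheme \<Rightarrow> ('e, 'x, 'a) extension \<Rightarrow> ('f, 'x, 'a) extension \<Rightarrow> ('e \<Rightarrow> 'f) \<Rightarrow> bool"
where
  "ext_morphism A E F \<phi> \<longleftrightarrow>
     rack_hom E F \<phi> \<and>
     (\<forall>e\<in>rset E. eproj F (\<phi> e) = eproj E e) \<and>
     (\<forall>e\<in>rset E. \<forall>a\<in>carrier (fibre A (eproj E e)). \<phi> (e \<cdot>\<^bsub>E\<^esub> a) = \<phi> e \<cdot>\<^bsub>F\<^esub> a)"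

definition ext_equivalent ::
  "('x, 'a, 'm) rack_module_scheme \<Rightarrow> ('e, 'x, 'a) extension \<Rightarrow> ('f, 'x, 'a) extension \<Rightarrow> bool" where
  "ext_equivalent A E F \<longleftrightarrow>
     (\<exists>\<phi> \<psi>. ext_morphism A E F \<phi> \<and> ext_morphism A F E \<psi> \<and> homeomorphic_maps (rtop E) (rtop F) \<phi> \<psi>)"

definition trivial_ext ::
  "('x, 'n) top_rack_scheme \<Rightarrow> ('x, 'a, 'm) rack_module_scheme \<Rightarrow> ('a \<times> 'x, 'x, 'a) extension" where
  "trivial_ext X A =
     \<lparr>rtop = subtopology (prod_topology (total A) (rtop X)) {(a, x). a \<in> carrier (fibre A x)},
      rop = (\<lambda>(a, x) (b, y). (eta A x y a \<otimes>\<^bsub>fibre A (x \<triangleleft>\<^bsub>X\<^esub> y)\<^esub> tau A x y b, x \<triangleleft>\<^bsub>X\<^esub> y)),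
      eproj = snd,
      act = (\<lambda>(a, x) b. (a \<otimes>\<^bsub>fibre A x\<^esub> b, x))\<rparr>"

definition opposite ::
  "('x, 'a, 'm) rack_module_scheme \<Rightarrow> ('e, 'x, 'a) extension \<Rightarrow> ('e, 'x, 'a) extension" where
  "opposite A E = E\<lparr>act := \<lambda>e a. e \<cdot>\<^bsub>E\<^esub> (inv\<^bsub>fibre A (eproj E e)\<^esub> a)\<rparr>"

definition quotient_topology :: "'a topology \<Rightarrow> ('a \<times> 'a) set \<Rightarrow> 'a set topology" where
  "quotient_topology T r =
     topology (\<lambda>V. V \<subseteq> topspace T // r \<and> openin T {x \<in> topspace T. r `` {x} \<in> V})"

lemma openin_quotient_topology:
  "openin (quotient_topology T r) V \<longleftrightarrow>
     V \<subseteq> topspace T // r \<and> openin T {x \<in> topspace T. r `` {x} \<in> V}"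
proof -
  let ?P = "\<lambda>V. V \<subseteq> topspace T // r \<and> openin T {x \<in> topspace T. r `` {x} \<in> V}"
  have "istopology ?P"
    unfolding istopology_def
  proof (intro conjI allI impI)
    fix S U assume "?P S" "?P U"
    moreover have "{x \<in> topspace T. r `` {x} \<in> S \<inter> U}
        = {x \<in> topspace T. r `` {x} \<in> S} \<inter> {x \<in> topspace T. r `` {x} \<in> U}" by blast
    ultimately show "S \<inter> U \<subseteq> topspace T // r" "openin T {x \<in> topspace T. r `` {x} \<in> S \<inter> U}"
      by auto
  next
    fix K assume K: "\<forall>V\<in>K. ?P V"
    have "{x \<in> topspace T. r `` {x} \<in> \<Union>K} = (\<Union>V\<in>K. {x \<in> topspace T. r `` {x} \<in> V})" by blast
    with K show "\<Union>K \<subseteq> topspace T // r" "openin T {x \<in> topspace T. r `` {x} \<in> \<Union>K}"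
      by auto
  qed
  then show ?thesis
    unfolding quotient_topology_def by (subst topology_inverse') simp_all
qed

lemma topspace_quotient_topology: "topspace (quotient_topology T r) = topspace T // r"
proof -
  have "{x \<in> topspace T. r `` {x} \<in> topspace T // r} = topspace T"
    by (auto intro: quotientI)
  then have "openin (quotient_topology T r) (topspace T // r)"
    by (simp add: openin_quotient_topology)
  moreover have "topspace (quotient_topology T r) \<subseteq> topspace T // r"
    using openin_quotient_topology openin_topspace by metis
  ultimately show ?thesis
    using openin_subset by blast
qed

text \<open>The relation \<open>(e \<cdot> a, f) \<sim> (e, f \<cdot> a)\<close> on \<open>E \<times>\<^sub>X F\<close>; it already is an equivalence relation
  when \<open>E\<close> and \<open>F\<close> are central extensions, so no closure is taken.\<close>

definition baer_rel ::
  "('x, 'a, 'm) rack_module_scheme \<Rightarrow> ('e, 'x, 'a) extension \<Rightarrow> ('f, 'x, 'a) extension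
    \<Rightarrow> (('e \<times> 'f) \<times> ('e \<times> 'f)) set" where
  "baer_rel A E F =
     {((e \<cdot>\<^bsub>E\<^esub> a, f), (e, f \<cdot>\<^bsub>F\<^esub> a)) | e f a.
        e \<in> rset E \<and> f \<in> rset F \<and> eproj E e = eproj F f \<and> a \<in> carrier (fibre A (eproj E e))}"

text \<open>The unions below run over all representatives of the classes; for central extensions
  every representative contributes the same class.\<close>

definition baer_sum ::
  "('x, 'a, 'm) rack_module_scheme \<Rightarrow> ('e, 'x, 'a) extension \<Rightarrow> ('f, 'x, 'a) extension
    \<Rightarrow> (('e \<times> 'f) set, 'x, 'a) extension" where
  "baer_sum A E F =
     \<lparr>rtop = quotient_topology (fibre_product (rtop E) (eproj E) (rtop F) (eproj F)) (baer_rel A E F),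
      rop = (\<lambda>P Q. \<Union>(e1, f1)\<in>P. \<Union>(e2, f2)\<in>Q. baer_rel A E F `` {(e1 \<triangleleft>\<^bsub>E\<^esub> e2, f1 \<triangleleft>\<^bsub>F\<^esub> f2)}),
      eproj = (\<lambda>P. the_elem ((\<lambda>(e, f). eproj E e) ` P)),
      act = (\<lambda>P a. \<Union>(e, f)\<in>P. baer_rel A E F `` {(e \<cdot>\<^bsub>E\<^esub> a, f)})\<rparr>"

text \<open>A set of equivalence classes needs a type in which the representatives live.
  \<open>Ext X A\<close> consists of the classes of extensions whose points have type \<open>'u\<close>.  Since every
  fibre of an extension is a torsor under the corresponding fibre of \<open>A\<close>, every extension is
  equivalent to one over \<open>'u\<close> as soon as the set \<open>A\<close> embeds into \<open>'u\<close>.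
  \<open>ext_class X A E\<close> is the element of \<open>Ext X A\<close> given by an extension \<open>E\<close> with points
  of any type.\<close>

definition ext_rel ::
  "('x, 'n) top_rack_scheme \<Rightarrow> ('x, 'a, 'm) rack_module_scheme \<Rightarrow>
     (('u, 'x, 'a) extension \<times> ('u, 'x, 'a) extension) set" where
  "ext_rel X A =
     {(E, F). central_extension X A E \<and> central_extension X A F \<and> ext_equivalent A E F}"

definition Ext ::
  "('x, 'n) top_rack_scheme \<Rightarrow> ('x, 'a, 'm) rack_module_scheme \<Rightarrow> ('u, 'x, 'a) extension set set" where
  "Ext X A = {E. central_extension X A E} // ext_rel X A"

definition ext_class ::
  "('x, 'n) top_rack_scheme \<Rightarrow> ('x, 'a, 'm) rack_module_scheme \<Rightarrow> ('e, 'x, 'a) extension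
    \<Rightarrow> ('u, 'x, 'a) extension set" where
  "ext_class X A E = {G. central_extension X A G \<and> ext_equivalent A E G}"

definition Ext_group ::
  "('x, 'n) top_rack_scheme \<Rightarrow> ('x, 'a, 'm) rack_module_scheme \<Rightarrow> ('u, 'x, 'a) extension set monoid" where
  "Ext_group X A =
     \<lparr>carrier = Ext X A,
      mult = (\<lambda>C D. \<Union>E\<in>C. \<Union>F\<in>D. ext_class X A (baer_sum A E F)),
      one = ext_class X A (trivial_ext X A)\<rparr>"

end

theory Submission
  imports Defs "HOL-Analysis.Abstract_Topology_2"
begin

text \<open>The group laws are isomorphisms \<open>[e, f] \<mapsto> \<beta>(e, f)\<close> of extensions, given by the formulas
  \<open>[e, f] \<mapsto> [f, e]\<close> for commutativity, \<open>[[e, f], g] \<mapsto> [e, [f, g]]\<close> for associativity,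
  \<open>[(a, x), e] \<mapsto> e \<cdot> a\<close> for the unit and \<open>[e\<degree>, f] \<mapsto> (a(e, f), x)\<close> for the inverse, where \<open>a(e, f)\<close>
  is the element of the fibre over \<open>x\<close> with \<open>f = e \<cdot> a(e, f)\<close>.  Three observations keep the
  verifications short.

  First, every equivariant rack-compatible map over \<open>X\<close> between central extensions is bijective,
  because its source and target are fibrewise torsors under the same groups.  Such a map is
  determined by its values on a local section \<open>s\<close> of the source, so it is continuous as soon as
  \<open>\<phi> \<circ> s\<close> is.  Its inverse is equivariant as well and takes the local section \<open>\<phi> \<circ> s\<close> of the target
  to \<open>s\<close>, so it is continuous for the same reason (\<open>ext_equivalentI\<close>).  For maps out of a Baer sum
  this becomes a statement about bi-equivariant functions \<open>\<beta>(e, f)\<close> (\<open>baer_equivalentI\<close>), and all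
  group laws are instances of it.

  Second, the map \<open>(e, f) \<mapsto> [e, f]\<close> onto a Baer sum is open, since \<open>A \<rightarrow> X\<close> is
  (\<open>open_map_cl\<close>).  Fibre products of open surjections are again open surjections, so the
  operation, the action and the translation function of the Baer sum are continuous because their
  formulas on representatives are (\<open>central_baer_sum\<close>).

  Third, the division axiom of a rack holds for an extension as soon as it holds for \<open>X\<close>:
  \<open>\<eta>\<close> is bijective, and this corrects a first guess over the right base point by a unique
  element of the fibre (\<open>central_extensionI\<close>).

  Finally, an extension \<open>E\<close> is in bijection with \<open>A\<close>: choose a point in each fibre of \<open>E\<close>.  Hence an
  extension on any type has an isomorphic copy on the type \<open>'u\<close> (\<open>transport\<close>), and
  the laws up to equivalence become equations between classes.\<close>

section \<open>Continuous maps and fibre products\<close>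

lemma topspace_fibre_product:
  "topspace (fibre_product S p T q) = {(e, f). e \<in> topspace S \<and> f \<in> topspace T \<and> p e = q f}"
  by (auto simp: fibre_product_def)

lemma continuous_map_into_fibre_product:
  "continuous_map Z (fibre_product S p T q) (\<lambda>z. (f z, g z)) \<longleftrightarrow>
     continuous_map Z S f \<and> continuous_map Z T g \<and> (\<forall>z\<in>topspace Z. p (f z) = q (g z))"
  unfolding fibre_product_def continuous_map_in_subtopology continuous_map_paired
  by (auto simp: image_subset_iff)

lemma continuous_map_from_fibre_product:
  "continuous_map (fibre_product S p T q) S fst" "continuous_map (fibre_product S p T q) T snd"
  unfolding fibre_product_def
  by (simp_all add: continuous_map_from_subtopology continuous_map_fst continuous_map_snd)

lemma continuous_map_compose_fibre_product:
  assumes h: "continuous_map (fibre_product S p T q) U (\<lambda>(x, y). h x y)"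
    and f: "continuous_map Z S f" and g: "continuous_map Z T g"
    and eq: "\<And>z. z \<in> topspace Z \<Longrightarrow> p (f z) = q (g z)"
  shows "continuous_map Z U (\<lambda>z. h (f z) (g z))"
proof -
  have "continuous_map Z (fibre_product S p T q) (\<lambda>z. (f z, g z))"
    using f g eq by (simp add: continuous_map_into_fibre_product)
  from continuous_map_compose[OF this h] show ?thesis
    by (simp add: o_def)
qed

lemma continuous_map_compose_prod:
  assumes h: "continuous_map (prod_topology S T) U (\<lambda>(x, y). h x y)"
    and f: "continuous_map Z S f" and g: "continuous_map Z T g"
  shows "continuous_map Z U (\<lambda>z. h (f z) (g z))"
proof -
  have "continuous_map Z (prod_topology S T) (\<lambda>z. (f z, g z))"
    using f g by (simp add: continuous_map_paired)
  from continuous_map_compose[OF this h] show ?thesis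
    by (simp add: o_def)
qed

lemma continuous_map_locally:
  assumes "\<And>x. x \<in> topspace S \<Longrightarrow>
      \<exists>W. openin S W \<and> x \<in> W \<and> continuous_map (subtopology S W) T f"
  shows "continuous_map S T f"
proof -
  let ?I = "{W. openin S W \<and> continuous_map (subtopology S W) T f}"
  show ?thesis
  proof (rule pasting_lemma[where I = ?I and T = "\<lambda>W. W" and f = "\<lambda>_. f"])
    fix x assume "x \<in> topspace S"
    with assms show "\<exists>j. j \<in> ?I \<and> x \<in> j \<and> f x = f x" by blast
  qed auto
qed

lemma open_map_fibre_product:
  assumes q1: "open_map S S' q1" and q2: "open_map T T' q2"
    and p: "\<And>u. u \<in> topspace S \<Longrightarrow> p u = p' (q1 u)"
    and r: "\<And>v. v \<in> topspace T \<Longrightarrow> r v = r' (q2 v)"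
  shows "open_map (fibre_product S p T r) (fibre_product S' p' T' r') (\<lambda>(u, v). (q1 u, q2 v))"
proof -
  have *: "open_map (prod_topology S T) (prod_topology S' T') (\<lambda>(u, v). (q1 u, q2 v))"
    unfolding open_map_def
  proof (intro allI impI)
    fix W assume W: "openin (prod_topology S T) W"
    show "openin (prod_topology S' T') ((\<lambda>(u, v). (q1 u, q2 v)) ` W)"
      unfolding openin_prod_topology_alt
    proof (intro allI impI)
      fix u' v' assume "(u', v') \<in> (\<lambda>(u, v). (q1 u, q2 v)) ` W"
      then obtain u v where uv: "(u, v) \<in> W" "u' = q1 u" "v' = q2 v" by auto
      obtain U V where UV: "openin S U" "openin T V" "u \<in> U" "v \<in> V" "U \<times> V \<subseteq> W"
        using W[unfolded openin_prod_topology_alt, rule_format, OF uv(1)] by auto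
      have "q1 ` U \<times> q2 ` V \<subseteq> (\<lambda>(u, v). (q1 u, q2 v)) ` W"
        using UV(5) by force
      moreover have "openin S' (q1 ` U)" "openin T' (q2 ` V)"
        using q1 q2 UV unfolding open_map_def by auto
      ultimately show "\<exists>U V. openin S' U \<and> openin T' V \<and> u' \<in> U \<and> v' \<in> V
          \<and> U \<times> V \<subseteq> (\<lambda>(u, v). (q1 u, q2 v)) ` W"
        using uv UV by blast
    qed
  qed
  let ?W = "{x \<in> topspace (prod_topology S T). (case x of (u, v) \<Rightarrow> (q1 u, q2 v)) \<in> {(e, f). p' e = r' f}}"
  have "topspace (prod_topology S T) \<inter> {(e, f). p e = r f} = topspace (prod_topology S T) \<inter> ?W"
    by (auto simp: p r)
  then have "subtopology (prod_topology S T) (topspace (prod_topology S T) \<inter> {(e, f). p e = r f})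
      = subtopology (prod_topology S T) (topspace (prod_topology S T) \<inter> ?W)"
    by (rule arg_cong)
  then have eq: "fibre_product S p T r = subtopology (prod_topology S T) ?W"
    unfolding fibre_product_def subtopology_restrict .
  show ?thesis
    unfolding eq unfolding fibre_product_def by (rule open_map_restriction[OF * refl])
qed

text \<open>Products and restrictions of general quotient maps fail to be quotient maps.  For open
  surjections there is no such problem, so a map on a fibre product of quotients by open maps may be
  tested for continuity on representatives.\<close>

lemma continuous_map_descend_fibre_product:
  assumes q1: "open_map S S' q1" "continuous_map S S' q1" "q1 ` topspace S = topspace S'"
    and q2: "open_map T T' q2" "continuous_map T T' q2" "q2 ` topspace T = topspace T'"
    and p: "\<And>u. u \<in> topspace S \<Longrightarrow> p u = p' (q1 u)"
    and r: "\<And>v. v \<in> topspace T \<Longrightarrow> r v = r' (q2 v)"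
    and h: "continuous_map (fibre_product S p T r) Z (\<lambda>(u, v). h (q1 u) (q2 v))"
  shows "continuous_map (fibre_product S' p' T' r') Z (\<lambda>(x, y). h x y)"
proof -
  let ?q = "\<lambda>(u, v). (q1 u, q2 v)"
  have "continuous_map (fibre_product S p T r) (fibre_product S' p' T' r') (\<lambda>z. (q1 (fst z), q2 (snd z)))"
    unfolding continuous_map_into_fibre_product
    using continuous_map_compose[OF continuous_map_from_fibre_product(1) q1(2)]
      continuous_map_compose[OF continuous_map_from_fibre_product(2) q2(2)] p r
    by (auto simp: topspace_fibre_product o_def)
  then have "continuous_map (fibre_product S p T r) (fibre_product S' p' T' r') ?q"
    by (simp add: case_prod_unfold)
  moreover have "?q ` topspace (fibre_product S p T r) = topspace (fibre_product S' p' T' r')"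
  proof
    show "?q ` topspace (fibre_product S p T r) \<subseteq> topspace (fibre_product S' p' T' r')"
      using q1(3) q2(3) p r by (auto simp: topspace_fibre_product)
    show "topspace (fibre_product S' p' T' r') \<subseteq> ?q ` topspace (fibre_product S p T r)"
    proof clarify
      fix x y assume xy: "(x, y) \<in> topspace (fibre_product S' p' T' r')"
      then have "x \<in> q1 ` topspace S" "y \<in> q2 ` topspace T"
        using q1(3) q2(3) by (auto simp: topspace_fibre_product)
      then obtain u v where uv: "u \<in> topspace S" "x = q1 u" "v \<in> topspace T" "y = q2 v"
        by blast
      then have "(u, v) \<in> topspace (fibre_product S p T r)"
        using xy p r by (auto simp: topspace_fibre_product)
      then show "(x, y) \<in> ?q ` topspace (fibre_product S p T r)"
        using uv by force
    qed
  qed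
  ultimately have "quotient_map (fibre_product S p T r) (fibre_product S' p' T' r') ?q"
    by (intro continuous_open_imp_quotient_map open_map_fibre_product q1(1) q2(1) p r)
  then show ?thesis
    by (rule continuous_compose_quotient_map) (use h in \<open>simp add: o_def case_prod_unfold\<close>)
qed

text \<open>A pullback of an open map is open: near \<open>(e, a)\<close>, the points \<open>e'\<close> with \<open>p e'\<close> in the open set
  \<open>r ` V\<close> have a partner in \<open>V\<close>.\<close>

lemma open_map_fibre_product_fst:
  assumes r: "open_map T B r" "continuous_map S B p"
  shows "open_map (fibre_product S p T r) S fst"
  unfolding open_map_def
proof (intro allI impI)
  fix W assume W: "openin (fibre_product S p T r) W"
  then obtain W' where W': "openin (prod_topology S T) W'" "W = W' \<inter> {(e, f). p e = r f}"
    unfolding fibre_product_def openin_subtopology by auto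
  show "openin S (fst ` W)"
  proof (rule iffD2[OF openin_subopen], rule ballI)
    fix e assume "e \<in> fst ` W"
    then obtain a where ea: "(e, a) \<in> W'" "p e = r a" using W'(2) by auto
    obtain U V where UV: "openin S U" "openin T V" "e \<in> U" "a \<in> V" "U \<times> V \<subseteq> W'"
      using W'(1)[unfolded openin_prod_topology_alt, rule_format, OF ea(1)] by auto
    let ?N = "U \<inter> {e \<in> topspace S. p e \<in> r ` V}"
    have "openin B (r ` V)" using r(1) UV(2) unfolding open_map_def by blast
    then have "openin S ?N"
      using UV(1) openin_continuous_map_preimage[OF r(2)] by blast
    moreover have "e \<in> ?N"
      using UV ea openin_subset by blast
    moreover have "?N \<subseteq> fst ` W"
      using UV(5) unfolding W'(2) by force
    ultimately show "\<exists>N. openin S N \<and> e \<in> N \<and> N \<subseteq> fst ` W" by blast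
  qed
qed

section \<open>Modules over a rack\<close>

locale module_over_rack =
  fixes X :: "'x top_rack" and A :: "('x, 'a) rack_module"
  assumes topological_rack: "topological_rack X" and rack_module: "rack_module X A"
begin

abbreviation fib :: "'x \<Rightarrow> 'a set" where
  "fib x \<equiv> carrier (fibre A x)"

lemma base_closed [simp]: "x \<in> rset X \<Longrightarrow> y \<in> rset X \<Longrightarrow> x \<triangleleft>\<^bsub>X\<^esub> y \<in> rset X"
  using topological_rack unfolding topological_rack_def rack_def by blast

lemma base_distrib:
  "x \<in> rset X \<Longrightarrow> y \<in> rset X \<Longrightarrow> z \<in> rset X \<Longrightarrow>
     (x \<triangleleft>\<^bsub>X\<^esub> y) \<triangleleft>\<^bsub>X\<^esub> z = (x \<triangleleft>\<^bsub>X\<^esub> z) \<triangleleft>\<^bsub>X\<^esub> (y \<triangleleft>\<^bsub>X\<^esub> z)"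
  using topological_rack unfolding topological_rack_def rack_def by blast

lemma base_division: "x \<in> rset X \<Longrightarrow> y \<in> rset X \<Longrightarrow> \<exists>!z. z \<in> rset X \<and> y = z \<triangleleft>\<^bsub>X\<^esub> x"
  by (rule topological_rack[unfolded topological_rack_def rack_def,
        THEN conjunct1, THEN conjunct2, THEN conjunct1, rule_format])

lemma continuous_base_op:
  "continuous_map (prod_topology (rtop X) (rtop X)) (rtop X) (\<lambda>(x, y). x \<triangleleft>\<^bsub>X\<^esub> y)"
  using topological_rack by (auto simp: topological_rack_def)

lemma group_bundle: "group_bundle (rtop X) A"
  using rack_module by (auto simp: rack_module_def rack_group_bundle_def)

lemma fib_comm_group: "x \<in> rset X \<Longrightarrow> comm_group (fibre A x)"
  using rack_module by (auto simp: rack_module_def)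

lemma fib_group: "x \<in> rset X \<Longrightarrow> group (fibre A x)"
  using fib_comm_group comm_group.axioms(2) by blast

lemma fib_iff: "x \<in> rset X \<Longrightarrow> a \<in> fib x \<longleftrightarrow> a \<in> topspace (total A) \<and> bproj A a = x"
  using group_bundle unfolding group_bundle_def topological_group_def fibre_top_def
  by (fastforce dest: bspec)

lemma fib_mem:
  assumes "x \<in> rset X" "a \<in> fib x"
  shows "a \<in> topspace (total A)" "bproj A a = x"
  using assms fib_iff by auto

lemma bproj_closed: "a \<in> topspace (total A) \<Longrightarrow> bproj A a \<in> rset X"
  using group_bundle unfolding group_bundle_def by auto

lemma fib_bproj: "a \<in> topspace (total A) \<Longrightarrow> a \<in> fib (bproj A a)"
  using bproj_closed fib_iff by auto

lemma fib_one_closed [simp]: "x \<in> rset X \<Longrightarrow> \<one>\<^bsub>fibre A x\<^esub> \<in> fib x"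
  by (simp add: fib_group group.is_monoid)

lemma fib_mult_closed [simp]:
  "x \<in> rset X \<Longrightarrow> a \<in> fib x \<Longrightarrow> b \<in> fib x \<Longrightarrow> a \<otimes>\<^bsub>fibre A x\<^esub> b \<in> fib x"
  by (simp add: fib_group group.is_monoid monoid.m_closed)

lemma fib_inv_closed [simp]:
  "x \<in> rset X \<Longrightarrow> a \<in> fib x \<Longrightarrow> inv\<^bsub>fibre A x\<^esub> a \<in> fib x"
  by (simp add: fib_group)

lemma fib_comm: "x \<in> rset X \<Longrightarrow> a \<in> fib x \<Longrightarrow> b \<in> fib x \<Longrightarrow>
    a \<otimes>\<^bsub>fibre A x\<^esub> b = b \<otimes>\<^bsub>fibre A x\<^esub> a"
  using fib_comm_group comm_monoid.m_comm comm_group.axioms(1) by metis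

lemma fib_assoc: "x \<in> rset X \<Longrightarrow> a \<in> fib x \<Longrightarrow> b \<in> fib x \<Longrightarrow> c \<in> fib x \<Longrightarrow>
    (a \<otimes>\<^bsub>fibre A x\<^esub> b) \<otimes>\<^bsub>fibre A x\<^esub> c = a \<otimes>\<^bsub>fibre A x\<^esub> (b \<otimes>\<^bsub>fibre A x\<^esub> c)"
  using fib_group group.is_monoid monoid.m_assoc by metis

lemma fib_lcomm: "x \<in> rset X \<Longrightarrow> a \<in> fib x \<Longrightarrow> b \<in> fib x \<Longrightarrow> c \<in> fib x \<Longrightarrow>
    a \<otimes>\<^bsub>fibre A x\<^esub> (b \<otimes>\<^bsub>fibre A x\<^esub> c) = b \<otimes>\<^bsub>fibre A x\<^esub> (a \<otimes>\<^bsub>fibre A x\<^esub> c)"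
  by (metis fib_assoc fib_comm)

lemmas fib_ac = fib_assoc fib_comm fib_lcomm

lemma fib_one [simp]:
  "x \<in> rset X \<Longrightarrow> a \<in> fib x \<Longrightarrow> a \<otimes>\<^bsub>fibre A x\<^esub> \<one>\<^bsub>fibre A x\<^esub> = a"
  "x \<in> rset X \<Longrightarrow> a \<in> fib x \<Longrightarrow> \<one>\<^bsub>fibre A x\<^esub> \<otimes>\<^bsub>fibre A x\<^esub> a = a"
  by (simp_all add: fib_group group.is_monoid)

lemma fib_inv [simp]:
  "x \<in> rset X \<Longrightarrow> a \<in> fib x \<Longrightarrow> a \<otimes>\<^bsub>fibre A x\<^esub> inv\<^bsub>fibre A x\<^esub> a = \<one>\<^bsub>fibre A x\<^esub>"
  "x \<in> rset X \<Longrightarrow> a \<in> fib x \<Longrightarrow> inv\<^bsub>fibre A x\<^esub> a \<otimes>\<^bsub>fibre A x\<^esub> a = \<one>\<^bsub>fibre A x\<^esub>"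
  by (simp_all add: fib_group group.r_inv group.l_inv)

lemma fib_inv_cancel [simp]:
  "x \<in> rset X \<Longrightarrow> a \<in> fib x \<Longrightarrow> b \<in> fib x \<Longrightarrow>
     a \<otimes>\<^bsub>fibre A x\<^esub> (inv\<^bsub>fibre A x\<^esub> a \<otimes>\<^bsub>fibre A x\<^esub> b) = b"
  "x \<in> rset X \<Longrightarrow> a \<in> fib x \<Longrightarrow> b \<in> fib x \<Longrightarrow>
     inv\<^bsub>fibre A x\<^esub> a \<otimes>\<^bsub>fibre A x\<^esub> (a \<otimes>\<^bsub>fibre A x\<^esub> b) = b"
  by (simp_all add: fib_assoc[symmetric])

lemma eta_iso: "x \<in> rset X \<Longrightarrow> y \<in> rset X \<Longrightarrow> eta A x y \<in> iso (fibre A x) (fibre A (x \<triangleleft>\<^bsub>X\<^esub> y))"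
  using rack_module by (auto simp: rack_module_def rack_group_bundle_def)

lemma tau_hom: "x \<in> rset X \<Longrightarrow> y \<in> rset X \<Longrightarrow> tau A x y \<in> hom (fibre A y) (fibre A (x \<triangleleft>\<^bsub>X\<^esub> y))"
  using rack_module by (auto simp: rack_module_def)

lemma eta_group_hom:
  "x \<in> rset X \<Longrightarrow> y \<in> rset X \<Longrightarrow> group_hom (fibre A x) (fibre A (x \<triangleleft>\<^bsub>X\<^esub> y)) (eta A x y)"
  using eta_iso by (simp add: group_hom_def group_hom_axioms_def fib_group iso_def)

lemma tau_group_hom:
  "x \<in> rset X \<Longrightarrow> y \<in> rset X \<Longrightarrow> group_hom (fibre A y) (fibre A (x \<triangleleft>\<^bsub>X\<^esub> y)) (tau A x y)"
  using tau_hom by (simp add: group_hom_def group_hom_axioms_def fib_group)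

lemma eta_closed [simp]:
  "x \<in> rset X \<Longrightarrow> y \<in> rset X \<Longrightarrow> a \<in> fib x \<Longrightarrow> eta A x y a \<in> fib (x \<triangleleft>\<^bsub>X\<^esub> y)"
  using eta_group_hom group_hom.hom_closed by metis

lemma tau_closed [simp]:
  "x \<in> rset X \<Longrightarrow> y \<in> rset X \<Longrightarrow> b \<in> fib y \<Longrightarrow> tau A x y b \<in> fib (x \<triangleleft>\<^bsub>X\<^esub> y)"
  using tau_group_hom group_hom.hom_closed by metis

lemma eta_mult:
  "x \<in> rset X \<Longrightarrow> y \<in> rset X \<Longrightarrow> a \<in> fib x \<Longrightarrow> b \<in> fib x \<Longrightarrow>
     eta A x y (a \<otimes>\<^bsub>fibre A x\<^esub> b) = eta A x y a \<otimes>\<^bsub>fibre A (x \<triangleleft>\<^bsub>X\<^esub> y)\<^esub> eta A x y b"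
  using eta_group_hom group_hom.hom_mult by metis

lemma tau_mult:
  "x \<in> rset X \<Longrightarrow> y \<in> rset X \<Longrightarrow> a \<in> fib y \<Longrightarrow> b \<in> fib y \<Longrightarrow>
     tau A x y (a \<otimes>\<^bsub>fibre A y\<^esub> b) = tau A x y a \<otimes>\<^bsub>fibre A (x \<triangleleft>\<^bsub>X\<^esub> y)\<^esub> tau A x y b"
  using tau_group_hom group_hom.hom_mult by metis

lemma eta_inv:
  "x \<in> rset X \<Longrightarrow> y \<in> rset X \<Longrightarrow> a \<in> fib x \<Longrightarrow>
     eta A x y (inv\<^bsub>fibre A x\<^esub> a) = inv\<^bsub>fibre A (x \<triangleleft>\<^bsub>X\<^esub> y)\<^esub> eta A x y a"
  using eta_group_hom group_hom.hom_inv by metis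

lemma tau_inv:
  "x \<in> rset X \<Longrightarrow> y \<in> rset X \<Longrightarrow> a \<in> fib y \<Longrightarrow>
     tau A x y (inv\<^bsub>fibre A y\<^esub> a) = inv\<^bsub>fibre A (x \<triangleleft>\<^bsub>X\<^esub> y)\<^esub> tau A x y a"
  using tau_group_hom group_hom.hom_inv by metis

lemma eta_bij: "x \<in> rset X \<Longrightarrow> y \<in> rset X \<Longrightarrow> bij_betw (eta A x y) (fib x) (fib (x \<triangleleft>\<^bsub>X\<^esub> y))"
  using eta_iso by (auto simp: iso_def)

lemma eta_eta:
  "x \<in> rset X \<Longrightarrow> y \<in> rset X \<Longrightarrow> z \<in> rset X \<Longrightarrow> a \<in> fib x \<Longrightarrow>
     eta A (x \<triangleleft>\<^bsub>X\<^esub> y) z (eta A x y a) = eta A (x \<triangleleft>\<^bsub>X\<^esub> z) (y \<triangleleft>\<^bsub>X\<^esub> z) (eta A x z a)"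
  using rack_module unfolding rack_module_def rack_group_bundle_def by blast

lemma eta_tau:
  "x \<in> rset X \<Longrightarrow> y \<in> rset X \<Longrightarrow> z \<in> rset X \<Longrightarrow> b \<in> fib y \<Longrightarrow>
     eta A (x \<triangleleft>\<^bsub>X\<^esub> y) z (tau A x y b) = tau A (x \<triangleleft>\<^bsub>X\<^esub> z) (y \<triangleleft>\<^bsub>X\<^esub> z) (eta A y z b)"
  using rack_module unfolding rack_module_def by blast

lemma tau_tau:
  "x \<in> rset X \<Longrightarrow> y \<in> rset X \<Longrightarrow> z \<in> rset X \<Longrightarrow> c \<in> fib z \<Longrightarrow>
     tau A (x \<triangleleft>\<^bsub>X\<^esub> y) z c = eta A (x \<triangleleft>\<^bsub>X\<^esub> z) (y \<triangleleft>\<^bsub>X\<^esub> z) (tau A x z c)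
       \<otimes>\<^bsub>fibre A ((x \<triangleleft>\<^bsub>X\<^esub> y) \<triangleleft>\<^bsub>X\<^esub> z)\<^esub> tau A (x \<triangleleft>\<^bsub>X\<^esub> z) (y \<triangleleft>\<^bsub>X\<^esub> z) (tau A y z c)"
  using rack_module unfolding rack_module_def by blast

lemma bproj_fib_ops [simp]:
  "x \<in> rset X \<Longrightarrow> bproj A \<one>\<^bsub>fibre A x\<^esub> = x"
  "x \<in> rset X \<Longrightarrow> a \<in> fib x \<Longrightarrow> b \<in> fib x \<Longrightarrow> bproj A (a \<otimes>\<^bsub>fibre A x\<^esub> b) = x"
  "x \<in> rset X \<Longrightarrow> a \<in> fib x \<Longrightarrow> bproj A (inv\<^bsub>fibre A x\<^esub> a) = x"
  "x \<in> rset X \<Longrightarrow> y \<in> rset X \<Longrightarrow> a \<in> fib x \<Longrightarrow> bproj A (eta A x y a) = x \<triangleleft>\<^bsub>X\<^esub> y"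
  "x \<in> rset X \<Longrightarrow> y \<in> rset X \<Longrightarrow> b \<in> fib y \<Longrightarrow> bproj A (tau A x y b) = x \<triangleleft>\<^bsub>X\<^esub> y"
  by (rule fib_mem(2); simp)+

lemma continuous_bproj: "continuous_map (total A) (rtop X) (bproj A)"
  and open_bproj: "open_map (total A) (rtop X) (bproj A)"
  and bproj_image: "bproj A ` topspace (total A) = rset X"
  using group_bundle by (auto simp: group_bundle_def)

text \<open>The rules below take the base point of a fibre as a separate function \<open>k\<close>, since in the
  applications it comes from an extension and agrees with \<open>bproj A\<close> only on \<open>topspace Z\<close>.\<close>

lemma continuous_fib_mult:
  assumes "continuous_map Z (total A) f" "continuous_map Z (total A) g"
    and "\<And>z. z \<in> topspace Z \<Longrightarrow> bproj A (f z) = k z"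
    and "\<And>z. z \<in> topspace Z \<Longrightarrow> bproj A (g z) = k z"
  shows "continuous_map Z (total A) (\<lambda>z. f z \<otimes>\<^bsub>fibre A (k z)\<^esub> g z)"
proof -
  have h: "continuous_map (fibre_product (total A) (bproj A) (total A) (bproj A))
      (total A) (\<lambda>(a, b). a \<otimes>\<^bsub>fibre A (bproj A a)\<^esub> b)"
    using group_bundle by (simp add: group_bundle_def)
  show ?thesis
    by (rule continuous_map_eq[OF continuous_map_compose_fibre_product[OF h assms(1,2)]])
      (simp_all add: assms)
qed

lemma continuous_fib_inv:
  assumes "continuous_map Z (total A) f"
    and "\<And>z. z \<in> topspace Z \<Longrightarrow> bproj A (f z) = k z"
  shows "continuous_map Z (total A) (\<lambda>z. inv\<^bsub>fibre A (k z)\<^esub> f z)"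
proof -
  have h: "continuous_map (total A) (total A) (\<lambda>a. inv\<^bsub>fibre A (bproj A a)\<^esub> a)"
    using group_bundle by (simp add: group_bundle_def)
  show ?thesis
    by (rule continuous_map_eq[OF continuous_map_compose[OF assms(1) h]])
      (simp_all add: assms)
qed

lemma continuous_eta:
  assumes "continuous_map Z (total A) f" "continuous_map Z (rtop X) y"
    and "\<And>z. z \<in> topspace Z \<Longrightarrow> bproj A (f z) = k z"
  shows "continuous_map Z (total A) (\<lambda>z. eta A (k z) (y z) (f z))"
proof -
  have h: "continuous_map (prod_topology (total A) (rtop X)) (total A) (\<lambda>(a, y). eta A (bproj A a) y a)"
    using rack_module by (simp add: rack_module_def rack_group_bundle_def)
  show ?thesis
    by (rule continuous_map_eq[OF continuous_map_compose_prod[OF h assms(1,2)]])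
      (simp_all add: assms)
qed

lemma continuous_tau:
  assumes "continuous_map Z (rtop X) x" "continuous_map Z (total A) f"
    and "\<And>z. z \<in> topspace Z \<Longrightarrow> bproj A (f z) = k z"
  shows "continuous_map Z (total A) (\<lambda>z. tau A (x z) (k z) (f z))"
proof -
  have h: "continuous_map (prod_topology (rtop X) (total A)) (total A) (\<lambda>(x, b). tau A x (bproj A b) b)"
    using rack_module by (simp add: rack_module_def)
  show ?thesis
    by (rule continuous_map_eq[OF continuous_map_compose_prod[OF h assms(1,2)]])
      (simp_all add: assms)
qed

text \<open>A bundle of groups need not have local sections through every point, but the zero section is
  always continuous: its composite with the quotient map \<open>bproj A\<close> is \<open>a \<mapsto> a \<otimes> inv a\<close>.\<close>

lemma continuous_zero_section: "continuous_map (rtop X) (total A) (\<lambda>x. \<one>\<^bsub>fibre A x\<^esub>)"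
proof -
  have q: "quotient_map (total A) (rtop X) (bproj A)"
    using continuous_bproj open_bproj bproj_image by (rule continuous_open_imp_quotient_map)
  have id: "continuous_map (total A) (total A) (\<lambda>a. a)"
    by simp
  have "continuous_map (total A) (total A)
      (\<lambda>a. a \<otimes>\<^bsub>fibre A (bproj A a)\<^esub> inv\<^bsub>fibre A (bproj A a)\<^esub> a)"
    by (intro continuous_fib_mult continuous_fib_inv id)
      (use bproj_closed fib_bproj fib_inv_closed fib_mem(2) in \<open>blast+\<close>)
  then have "continuous_map (total A) (total A) ((\<lambda>x. \<one>\<^bsub>fibre A x\<^esub>) \<circ> bproj A)"
    by (rule continuous_map_eq) (simp add: bproj_closed fib_bproj)
  then show ?thesis
    by (rule continuous_compose_quotient_map[OF q])
qed

end

section \<open>Central extensions\<close>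

locale central_ext = module_over_rack X A
  for X :: "'x top_rack" and A :: "('x, 'a) rack_module" +
  fixes E :: "('e, 'x, 'a) extension"
  assumes central: "central_extension X A E"
begin

lemma topological_rack_ext: "topological_rack E"
  and local_sections: "continuous_local_sections (rtop E) (rtop X) (eproj E)"
  and proj_image: "eproj E ` rset E = rset X"
  and continuous_proj: "continuous_map (rtop E) (rtop X) (eproj E)"
  and proj_op [simp]: "\<And>e f. e \<in> rset E \<Longrightarrow> f \<in> rset E \<Longrightarrow> eproj E (e \<triangleleft>\<^bsub>E\<^esub> f) = eproj E e \<triangleleft>\<^bsub>X\<^esub> eproj E f"
  and principal: "principal_action X A E"
  using central unfolding central_extension_def rack_hom_def by blast+

lemma op_closed [simp]: "e \<in> rset E \<Longrightarrow> f \<in> rset E \<Longrightarrow> e \<triangleleft>\<^bsub>E\<^esub> f \<in> rset E"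
  using topological_rack_ext unfolding topological_rack_def rack_def by blast

lemma op_distrib: "e \<in> rset E \<Longrightarrow> f \<in> rset E \<Longrightarrow> g \<in> rset E \<Longrightarrow>
    (e \<triangleleft>\<^bsub>E\<^esub> f) \<triangleleft>\<^bsub>E\<^esub> g = (e \<triangleleft>\<^bsub>E\<^esub> g) \<triangleleft>\<^bsub>E\<^esub> (f \<triangleleft>\<^bsub>E\<^esub> g)"
  using topological_rack_ext unfolding topological_rack_def rack_def by blast

lemma proj_closed [simp]: "e \<in> rset E \<Longrightarrow> eproj E e \<in> rset X"
  using proj_image by auto

lemma op_act_left:
  "e \<in> rset E \<Longrightarrow> f \<in> rset E \<Longrightarrow> a \<in> fib (eproj E e) \<Longrightarrow>
     (e \<cdot>\<^bsub>E\<^esub> a) \<triangleleft>\<^bsub>E\<^esub> f = (e \<triangleleft>\<^bsub>E\<^esub> f) \<cdot>\<^bsub>E\<^esub> eta A (eproj E e) (eproj E f) a"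
  using central unfolding central_extension_def by blast

lemma op_act_right:
  "e \<in> rset E \<Longrightarrow> f \<in> rset E \<Longrightarrow> b \<in> fib (eproj E f) \<Longrightarrow>
     e \<triangleleft>\<^bsub>E\<^esub> (f \<cdot>\<^bsub>E\<^esub> b) = (e \<triangleleft>\<^bsub>E\<^esub> f) \<cdot>\<^bsub>E\<^esub> tau A (eproj E e) (eproj E f) b"
  using central unfolding central_extension_def by blast

lemma act_one: "e \<in> rset E \<Longrightarrow> e \<cdot>\<^bsub>E\<^esub> \<one>\<^bsub>fibre A (eproj E e)\<^esub> = e"
  using principal[unfolded principal_action_def, THEN conjunct2, THEN conjunct1] by blast

lemma act_one' [simp]: "e \<in> rset E \<Longrightarrow> x = eproj E e \<Longrightarrow> e \<cdot>\<^bsub>E\<^esub> \<one>\<^bsub>fibre A x\<^esub> = e"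
  using act_one by simp

lemma act_proj [simp]:
  "e \<in> rset E \<Longrightarrow> a \<in> fib (eproj E e) \<Longrightarrow> eproj E (e \<cdot>\<^bsub>E\<^esub> a) = eproj E e"
  using principal[unfolded principal_action_def, THEN conjunct2, THEN conjunct1] by blast

lemma act_act:
  "e \<in> rset E \<Longrightarrow> a \<in> fib (eproj E e) \<Longrightarrow> b \<in> fib (eproj E e) \<Longrightarrow>
     (e \<cdot>\<^bsub>E\<^esub> a) \<cdot>\<^bsub>E\<^esub> b = e \<cdot>\<^bsub>E\<^esub> (a \<otimes>\<^bsub>fibre A (eproj E e)\<^esub> b)"
  using principal[unfolded principal_action_def, THEN conjunct2, THEN conjunct1] by simp

lemma continuous_act:
  assumes "continuous_map Z (rtop E) f" "continuous_map Z (total A) g"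
    and "\<And>z. z \<in> topspace Z \<Longrightarrow> eproj E (f z) = bproj A (g z)"
  shows "continuous_map Z (rtop E) (\<lambda>z. f z \<cdot>\<^bsub>E\<^esub> g z)"
  by (rule continuous_map_compose_fibre_product[OF principal[unfolded principal_action_def, THEN conjunct1] assms])

lemma continuous_translation:
  assumes "continuous_map Z (rtop E) f" "continuous_map Z (rtop E) g"
    and "\<And>z. z \<in> topspace Z \<Longrightarrow> eproj E (f z) = eproj E (g z)"
  shows "continuous_map Z (total A) (\<lambda>z. translation A E (f z) (g z))"
  by (rule continuous_map_compose_fibre_product[OF principal[unfolded principal_action_def,
        THEN conjunct2, THEN conjunct2, THEN conjunct2] assms])

lemma continuous_op:
  assumes "continuous_map Z (rtop E) f" "continuous_map Z (rtop E) g"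
  shows "continuous_map Z (rtop E) (\<lambda>z. f z \<triangleleft>\<^bsub>E\<^esub> g z)"
  by (rule continuous_map_compose_prod[OF topological_rack_ext[unfolded topological_rack_def, THEN conjunct2] assms])

lemma act_closed [simp]:
  assumes "e \<in> rset E" "a \<in> fib (eproj E e)"
  shows "e \<cdot>\<^bsub>E\<^esub> a \<in> rset E"
proof -
  have "continuous_map (fibre_product (rtop E) (eproj E) (total A) (bproj A)) (rtop E) (\<lambda>(e, a). e \<cdot>\<^bsub>E\<^esub> a)"
    by (rule principal[unfolded principal_action_def, THEN conjunct1])
  moreover have "(e, a) \<in> topspace (fibre_product (rtop E) (eproj E) (total A) (bproj A))"
    using assms fib_mem[OF proj_closed[OF assms(1)]] by (auto simp: topspace_fibre_product)
  ultimately show ?thesis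
    using continuous_map_image_subset_topspace by fastforce
qed

lemma translation_unique:
  assumes "e \<in> rset E" "e' \<in> rset E" "eproj E e = eproj E e'"
  shows "\<exists>!a. a \<in> fib (eproj E e) \<and> e' = e \<cdot>\<^bsub>E\<^esub> a"
  using principal[unfolded principal_action_def, THEN conjunct2, THEN conjunct2, THEN conjunct1,
      rule_format, OF proj_closed[OF assms(1)] assms(1,2)] assms(3) by simp

lemma translation_closed:
    "e \<in> rset E \<Longrightarrow> e' \<in> rset E \<Longrightarrow> eproj E e = eproj E e' \<Longrightarrow> translation A E e e' \<in> fib (eproj E e)"
  and act_translation [simp]:
    "e \<in> rset E \<Longrightarrow> e' \<in> rset E \<Longrightarrow> eproj E e = eproj E e' \<Longrightarrow> e \<cdot>\<^bsub>E\<^esub> translation A E e e' = e'"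
  using theI'[OF translation_unique] unfolding translation_def by auto

lemma translation_closed' [simp]:
  "e \<in> rset E \<Longrightarrow> e' \<in> rset E \<Longrightarrow> eproj E e = eproj E e' \<Longrightarrow> x = eproj E e \<Longrightarrow>
     translation A E e e' \<in> fib x"
  using translation_closed by simp

lemma bproj_translation [simp]:
  "e \<in> rset E \<Longrightarrow> e' \<in> rset E \<Longrightarrow> eproj E e = eproj E e' \<Longrightarrow>
     bproj A (translation A E e e') = eproj E e"
  using fib_mem(2)[OF proj_closed translation_closed] by simp

lemma translation_act [simp]:
  assumes "e \<in> rset E" "a \<in> fib (eproj E e)"
  shows "translation A E e (e \<cdot>\<^bsub>E\<^esub> a) = a"
  unfolding translation_def
  by (rule the1_equality[OF translation_unique]) (use assms in auto)

lemma translation_self [simp]: "e \<in> rset E \<Longrightarrow> translation A E e e = \<one>\<^bsub>fibre A (eproj E e)\<^esub>"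
  using translation_act[of e "\<one>\<^bsub>fibre A (eproj E e)\<^esub>"] by simp

lemma act_cancel:
  "e \<in> rset E \<Longrightarrow> a \<in> fib (eproj E e) \<Longrightarrow> b \<in> fib (eproj E e) \<Longrightarrow> e \<cdot>\<^bsub>E\<^esub> a = e \<cdot>\<^bsub>E\<^esub> b \<Longrightarrow> a = b"
  by (metis translation_act)

lemma local_section:
  assumes "x \<in> rset X"
  obtains U s where "openin (rtop X) U" "x \<in> U" "continuous_map (subtopology (rtop X) U) (rtop E) s"
    "\<And>u. u \<in> U \<Longrightarrow> eproj E (s u) = u"
  using local_sections assms unfolding continuous_local_sections_def by metis

end

context module_over_rack
begin

text \<open>The introduction rule for central extensions.  The function \<open>t\<close> is the translation function in
  explicit form, so that its continuity can be read off from a formula.  The closure properties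
  follow from continuity, surjectivity of the projection from the sections, and the division
  axiom from the division axiom of \<open>X\<close> and the bijectivity of \<open>eta\<close>.\<close>

lemma central_extensionI:
  fixes E :: "('e, 'x, 'a) extension"
  assumes op: "continuous_map (prod_topology (rtop E) (rtop E)) (rtop E) (\<lambda>(e, f). e \<triangleleft>\<^bsub>E\<^esub> f)"
    and distrib: "\<And>e f g. e \<in> rset E \<Longrightarrow> f \<in> rset E \<Longrightarrow> g \<in> rset E \<Longrightarrow>
        (e \<triangleleft>\<^bsub>E\<^esub> f) \<triangleleft>\<^bsub>E\<^esub> g = (e \<triangleleft>\<^bsub>E\<^esub> g) \<triangleleft>\<^bsub>E\<^esub> (f \<triangleleft>\<^bsub>E\<^esub> g)"
    and proj: "continuous_map (rtop E) (rtop X) (eproj E)"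
    and proj_op: "\<And>e f. e \<in> rset E \<Longrightarrow> f \<in> rset E \<Longrightarrow> eproj E (e \<triangleleft>\<^bsub>E\<^esub> f) = eproj E e \<triangleleft>\<^bsub>X\<^esub> eproj E f"
    and sections: "continuous_local_sections (rtop E) (rtop X) (eproj E)"
    and act: "continuous_map (fibre_product (rtop E) (eproj E) (total A) (bproj A)) (rtop E) (\<lambda>(e, a). e \<cdot>\<^bsub>E\<^esub> a)"
    and act_one: "\<And>e. e \<in> rset E \<Longrightarrow> e \<cdot>\<^bsub>E\<^esub> \<one>\<^bsub>fibre A (eproj E e)\<^esub> = e"
    and act_proj: "\<And>e a. e \<in> rset E \<Longrightarrow> a \<in> fib (eproj E e) \<Longrightarrow> eproj E (e \<cdot>\<^bsub>E\<^esub> a) = eproj E e"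
    and act_act: "\<And>e a b. e \<in> rset E \<Longrightarrow> a \<in> fib (eproj E e) \<Longrightarrow> b \<in> fib (eproj E e) \<Longrightarrow>
        e \<cdot>\<^bsub>E\<^esub> (a \<otimes>\<^bsub>fibre A (eproj E e)\<^esub> b) = (e \<cdot>\<^bsub>E\<^esub> a) \<cdot>\<^bsub>E\<^esub> b"
    and t_closed: "\<And>e e'. e \<in> rset E \<Longrightarrow> e' \<in> rset E \<Longrightarrow> eproj E e = eproj E e' \<Longrightarrow> t e e' \<in> fib (eproj E e)"
    and act_t: "\<And>e e'. e \<in> rset E \<Longrightarrow> e' \<in> rset E \<Longrightarrow> eproj E e = eproj E e' \<Longrightarrow> e \<cdot>\<^bsub>E\<^esub> t e e' = e'"
    and t_act: "\<And>e a. e \<in> rset E \<Longrightarrow> a \<in> fib (eproj E e) \<Longrightarrow> t e (e \<cdot>\<^bsub>E\<^esub> a) = a"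
    and cont_t: "continuous_map (fibre_product (rtop E) (eproj E) (rtop E) (eproj E)) (total A) (\<lambda>(e, e'). t e e')"
    and left: "\<And>e f a. e \<in> rset E \<Longrightarrow> f \<in> rset E \<Longrightarrow> a \<in> fib (eproj E e) \<Longrightarrow>
        (e \<cdot>\<^bsub>E\<^esub> a) \<triangleleft>\<^bsub>E\<^esub> f = (e \<triangleleft>\<^bsub>E\<^esub> f) \<cdot>\<^bsub>E\<^esub> eta A (eproj E e) (eproj E f) a"
    and right: "\<And>e f b. e \<in> rset E \<Longrightarrow> f \<in> rset E \<Longrightarrow> b \<in> fib (eproj E f) \<Longrightarrow>
        e \<triangleleft>\<^bsub>E\<^esub> (f \<cdot>\<^bsub>E\<^esub> b) = (e \<triangleleft>\<^bsub>E\<^esub> f) \<cdot>\<^bsub>E\<^esub> tau A (eproj E e) (eproj E f) b"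
  shows "central_extension X A E"
proof -
  have proj_closed: "eproj E e \<in> rset X" if "e \<in> rset E" for e
    using continuous_map_image_subset_topspace[OF proj] that by auto
  have op_closed: "e \<triangleleft>\<^bsub>E\<^esub> f \<in> rset E" if "e \<in> rset E" "f \<in> rset E" for e f
    using subsetD[OF continuous_map_image_subset_topspace[OF op] imageI, of "(e, f)"] that by simp
  have act_closed: "e \<cdot>\<^bsub>E\<^esub> a \<in> rset E" if "e \<in> rset E" "a \<in> fib (eproj E e)" for e a
    using subsetD[OF continuous_map_image_subset_topspace[OF act] imageI, of "(e, a)"]
      that fib_mem[OF proj_closed[OF that(1)] that(2)]
    by (simp add: topspace_fibre_product)
  have surj: "\<exists>e\<in>rset E. eproj E e = x" if x: "x \<in> rset X" for x
  proof -
    obtain U s where U: "openin (rtop X) U" "x \<in> U" "continuous_map (subtopology (rtop X) U) (rtop E) s"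
      "\<forall>u\<in>U. eproj E (s u) = u"
      using sections[unfolded continuous_local_sections_def, rule_format, OF x] by auto
    have "s x \<in> rset E"
      using continuous_map_image_subset_topspace[OF U(3)] U(2) x by auto
    then show ?thesis using U(2,4) by blast
  qed
  have t_unique: "a = t e e'" if "e \<in> rset E" "a \<in> fib (eproj E e)" "e' = e \<cdot>\<^bsub>E\<^esub> a" for e e' a
    using t_act that by simp
  have trans: "\<exists>!a. a \<in> fib (eproj E e) \<and> e' = e \<cdot>\<^bsub>E\<^esub> a"
    if "e \<in> rset E" "e' \<in> rset E" "eproj E e = eproj E e'" for e e'
    using t_closed act_t t_unique that by metis
  have trans': "\<forall>x\<in>rset X. \<forall>e\<in>rset E. \<forall>e'\<in>rset E. eproj E e = x \<and> eproj E e' = x \<longrightarrow>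
      (\<exists>!a. a \<in> fib x \<and> e' = e \<cdot>\<^bsub>E\<^esub> a)"
    using trans by metis
  have translation: "translation A E e e' = t e e'"
    if "e \<in> rset E" "e' \<in> rset E" "eproj E e = eproj E e'" for e e'
    unfolding translation_def
    by (rule the1_equality[OF trans[OF that]]) (use t_closed act_t that in auto)
  have div: "\<exists>!z. z \<in> rset E \<and> y = z \<triangleleft>\<^bsub>E\<^esub> f" if f: "f \<in> rset E" and y: "y \<in> rset E" for f y
  proof -
    let ?q = "eproj E f"
    note base = base_division[OF proj_closed[OF f] proj_closed[OF y]]
    obtain x where x: "x \<in> rset X" "eproj E y = x \<triangleleft>\<^bsub>X\<^esub> ?q"
      using ex1_implies_ex[OF base] by blast
    have x_unique: "x' = x" if "x' \<in> rset X" "eproj E y = x' \<triangleleft>\<^bsub>X\<^esub> ?q" for x'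
      using base that x by blast
    obtain z0 where z0: "z0 \<in> rset E" "eproj E z0 = x" using surj x(1) by blast
    \<comment> \<open>A candidate over the right base point misses \<open>y\<close> by an element of the fibre, and \<open>eta\<close>
      being bijective means that exactly one translate of it hits \<open>y\<close>.\<close>
    let ?b = "t (z0 \<triangleleft>\<^bsub>E\<^esub> f) y"
    have z0f: "z0 \<triangleleft>\<^bsub>E\<^esub> f \<in> rset E" "eproj E (z0 \<triangleleft>\<^bsub>E\<^esub> f) = x \<triangleleft>\<^bsub>X\<^esub> ?q"
      using z0 f by (simp_all add: op_closed proj_op)
    have b: "?b \<in> fib (x \<triangleleft>\<^bsub>X\<^esub> ?q)"
      using t_closed[OF z0f(1) y] z0f(2) x(2) by simp
    have bij: "bij_betw (eta A x ?q) (fib x) (fib (x \<triangleleft>\<^bsub>X\<^esub> ?q))"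
      using eta_bij x(1) proj_closed[OF f] by blast
    then obtain a where a: "a \<in> fib x" "eta A x ?q a = ?b"
      using b unfolding bij_betw_def by force
    show ?thesis
    proof (rule ex1I)
      show "z0 \<cdot>\<^bsub>E\<^esub> a \<in> rset E \<and> y = (z0 \<cdot>\<^bsub>E\<^esub> a) \<triangleleft>\<^bsub>E\<^esub> f"
        using left[OF z0(1) f] act_t[OF z0f(1) y] z0f x(2) a z0 act_closed by simp
    next
      fix z assume z: "z \<in> rset E \<and> y = z \<triangleleft>\<^bsub>E\<^esub> f"
      then have pz: "eproj E z = x"
        using x_unique[of "eproj E z"] proj_closed proj_op f by simp
      let ?c = "t z0 z"
      have c: "?c \<in> fib x" "z0 \<cdot>\<^bsub>E\<^esub> ?c = z"
        using t_closed[OF z0(1), of z] act_t[OF z0(1), of z] z pz z0(2) by auto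
      then have "y = (z0 \<triangleleft>\<^bsub>E\<^esub> f) \<cdot>\<^bsub>E\<^esub> eta A x ?q ?c"
        using z left[OF z0(1) f, of ?c] z0(2) by simp
      then have "eta A x ?q ?c = ?b"
        using t_unique[OF z0f(1)] z0f(2) eta_closed[OF x(1) proj_closed[OF f] c(1)] by simp
      then have "?c = a"
        using bij c(1) a unfolding bij_betw_def inj_on_def by simp
      then show "z = z0 \<cdot>\<^bsub>E\<^esub> a" using c(2) by simp
    qed
  qed
  have "rack E"
    unfolding rack_def by (intro conjI ballI op_closed div distrib)
  moreover have "rack_hom E X (eproj E)"
    unfolding rack_hom_def using proj proj_op by blast
  moreover have "eproj E ` rset E = rset X"
    using surj proj_closed by (auto simp: image_iff)
  moreover have "continuous_map (fibre_product (rtop E) (eproj E) (rtop E) (eproj E)) (total A)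
      (\<lambda>(e, e'). translation A E e e')"
    by (rule continuous_map_eq[OF cont_t]) (auto simp: topspace_fibre_product translation)
  then have "principal_action X A E"
    unfolding principal_action_def
    using act act_one act_proj act_act trans' by (intro conjI) simp_all
  ultimately show ?thesis
    unfolding central_extension_def topological_rack_def
    using op sections left right by blast
qed

section \<open>Equivalence of extensions\<close>

text \<open>On the domain of a local section \<open>s\<close> an equivariant map is \<open>\<phi> e = \<phi> (s x) \<cdot> translation (s x) e\<close>
  with \<open>x = eproj E e\<close>.  So it is determined, also as regards continuity, by its values on \<open>s\<close>.\<close>

lemma equivariant_continuous:
  fixes E :: "('e, 'x, 'a) extension" and F :: "('f, 'x, 'a) extension"
  assumes E: "central_extension X A E" and F: "central_extension X A F"
    and proj: "\<And>e. e \<in> rset E \<Longrightarrow> eproj F (\<phi> e) = eproj E e"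
    and act: "\<And>e a. e \<in> rset E \<Longrightarrow> a \<in> fib (eproj E e) \<Longrightarrow> \<phi> (e \<cdot>\<^bsub>E\<^esub> a) = \<phi> e \<cdot>\<^bsub>F\<^esub> a"
    and sec: "\<And>x. x \<in> rset X \<Longrightarrow> \<exists>U s. openin (rtop X) U \<and> x \<in> U \<and>
        continuous_map (subtopology (rtop X) U) (rtop E) s \<and> (\<forall>u\<in>U. eproj E (s u) = u) \<and>
        continuous_map (subtopology (rtop X) U) (rtop F) (\<lambda>u. \<phi> (s u))"
  shows "continuous_map (rtop E) (rtop F) \<phi>"
proof (rule continuous_map_locally)
  interpret E: central_ext X A E by unfold_locales (rule E)
  interpret F: central_ext X A F by unfold_locales (rule F)
  fix e assume e: "e \<in> rset E"
  obtain U s where U: "openin (rtop X) U" "eproj E e \<in> U"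
    and s: "continuous_map (subtopology (rtop X) U) (rtop E) s"
    and ps: "\<And>u. u \<in> U \<Longrightarrow> eproj E (s u) = u"
    and phi_s: "continuous_map (subtopology (rtop X) U) (rtop F) (\<lambda>u. \<phi> (s u))"
    using sec[OF E.proj_closed[OF e]] by metis
  let ?W = "{e \<in> rset E. eproj E e \<in> U}"
  let ?S = "subtopology (rtop E) ?W"
  have UX: "U \<subseteq> rset X" using U(1) openin_subset by blast
  have sE: "s u \<in> rset E" if "u \<in> U" for u
    using continuous_map_image_subset_topspace[OF s] UX that by auto
  have p: "continuous_map ?S (subtopology (rtop X) U) (eproj E)"
    using continuous_map_from_subtopology[OF E.continuous_proj]
    by (auto simp: continuous_map_in_subtopology)
  have id: "continuous_map ?S (rtop E) (\<lambda>e. e)"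
    using continuous_map_from_subtopology[OF continuous_map_id] by (simp add: id_def)
  have sp: "continuous_map ?S (rtop E) (\<lambda>e. s (eproj E e))"
    using continuous_map_compose[OF p s] by (simp add: o_def)
  have phi_sp: "continuous_map ?S (rtop F) (\<lambda>e. \<phi> (s (eproj E e)))"
    using continuous_map_compose[OF p phi_s] by (simp add: o_def)
  have t: "translation A E (s (eproj E e)) e \<in> fib (eproj E e)" if "e \<in> ?W" for e
    using E.translation_closed[of "s (eproj E e)" e] that sE ps by simp
  have "continuous_map ?S (rtop F) (\<lambda>e. \<phi> (s (eproj E e)) \<cdot>\<^bsub>F\<^esub> translation A E (s (eproj E e)) e)"
    by (intro F.continuous_act E.continuous_translation phi_sp sp id)
      (use t fib_mem(2)[OF E.proj_closed] ps sE proj in auto)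
  then have "continuous_map ?S (rtop F) \<phi>"
  proof (rule continuous_map_eq)
    fix e assume "e \<in> topspace ?S"
    then have e: "e \<in> ?W" by simp
    then have "\<phi> (s (eproj E e) \<cdot>\<^bsub>E\<^esub> translation A E (s (eproj E e)) e)
        = \<phi> (s (eproj E e)) \<cdot>\<^bsub>F\<^esub> translation A E (s (eproj E e)) e"
      by (intro act) (use e t[OF e] sE ps in auto)
    then show "\<phi> (s (eproj E e)) \<cdot>\<^bsub>F\<^esub> translation A E (s (eproj E e)) e = \<phi> e"
      using e sE ps by simp
  qed
  moreover have "openin (rtop E) ?W"
    using openin_continuous_map_preimage[OF E.continuous_proj U(1)] .
  ultimately show "\<exists>W. openin (rtop E) W \<and> e \<in> W \<and> continuous_map (subtopology (rtop E) W) (rtop F) \<phi>"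
    using e U(2) by blast
qed

text \<open>Both directions are continuous by the previous lemma: if \<open>s\<close> is a local section of \<open>E\<close>, then
  \<open>\<phi> \<circ> s\<close> is one of \<open>F\<close>, and the inverse of \<open>\<phi>\<close> takes it back to \<open>s\<close>.\<close>

lemma ext_equivalentI:
  fixes E :: "('e, 'x, 'a) extension" and F :: "('f, 'x, 'a) extension"
  assumes E: "central_extension X A E" and F: "central_extension X A F"
    and closed: "\<And>e. e \<in> rset E \<Longrightarrow> \<phi> e \<in> rset F"
    and proj: "\<And>e. e \<in> rset E \<Longrightarrow> eproj F (\<phi> e) = eproj E e"
    and act: "\<And>e a. e \<in> rset E \<Longrightarrow> a \<in> fib (eproj E e) \<Longrightarrow> \<phi> (e \<cdot>\<^bsub>E\<^esub> a) = \<phi> e \<cdot>\<^bsub>F\<^esub> a"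
    and op: "\<And>e e'. e \<in> rset E \<Longrightarrow> e' \<in> rset E \<Longrightarrow> \<phi> (e \<triangleleft>\<^bsub>E\<^esub> e') = \<phi> e \<triangleleft>\<^bsub>F\<^esub> \<phi> e'"
    and sec: "\<And>x. x \<in> rset X \<Longrightarrow> \<exists>U s. openin (rtop X) U \<and> x \<in> U \<and>
        continuous_map (subtopology (rtop X) U) (rtop E) s \<and> (\<forall>u\<in>U. eproj E (s u) = u) \<and>
        continuous_map (subtopology (rtop X) U) (rtop F) (\<lambda>u. \<phi> (s u))"
  shows "ext_equivalent A E F"
proof -
  interpret E: central_ext X A E by unfold_locales (rule E)
  interpret F: central_ext X A F by unfold_locales (rule F)
  have inj: "inj_on \<phi> (rset E)"
  proof (rule inj_onI)
    fix e e' assume e: "e \<in> rset E" "e' \<in> rset E" "\<phi> e = \<phi> e'"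
    then have pe: "eproj E e = eproj E e'" using proj by metis
    let ?a = "translation A E e e'"
    have a: "?a \<in> fib (eproj E e)" "e \<cdot>\<^bsub>E\<^esub> ?a = e'"
      using E.translation_closed[OF e(1,2) pe] E.act_translation[OF e(1,2) pe] by simp_all
    then have "\<phi> e \<cdot>\<^bsub>F\<^esub> ?a = \<phi> e \<cdot>\<^bsub>F\<^esub> \<one>\<^bsub>fibre A (eproj E e)\<^esub>"
      using act[OF e(1) a(1)] e(3) F.act_one[OF closed[OF e(1)]] proj[OF e(1)] by simp
    then have "?a = \<one>\<^bsub>fibre A (eproj E e)\<^esub>"
      using F.act_cancel[OF closed[OF e(1)]] a(1) proj[OF e(1)] e(1) by simp
    then show "e = e'" using a(2) e(1) by simp
  qed
  define \<psi> where "\<psi> = inv_into (rset E) \<phi>"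
  have psi_phi: "\<psi> (\<phi> e) = e" if "e \<in> rset E" for e
    unfolding \<psi>_def using inj that by simp
  have surj: "f \<in> \<phi> ` rset E" if f: "f \<in> rset F" for f
  proof -
    obtain e where e: "e \<in> rset E" "eproj E e = eproj F f"
      using E.proj_image F.proj_closed[OF f] by (metis imageE)
    let ?b = "translation A F (\<phi> e) f"
    have b: "?b \<in> fib (eproj E e)" "\<phi> e \<cdot>\<^bsub>F\<^esub> ?b = f"
      using F.translation_closed[OF closed[OF e(1)] f] F.act_translation[OF closed[OF e(1)] f]
        proj[OF e(1)] e(2) by simp_all
    then have "\<phi> (e \<cdot>\<^bsub>E\<^esub> ?b) = f" "e \<cdot>\<^bsub>E\<^esub> ?b \<in> rset E"
      using act e(1) by simp_all
    then show ?thesis by (metis imageI)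
  qed
  have psi_closed: "\<psi> f \<in> rset E" and phi_psi: "\<phi> (\<psi> f) = f" if "f \<in> rset F" for f
    unfolding \<psi>_def using surj[OF that] by (simp_all add: inv_into_into f_inv_into_f)
  have psi_proj: "eproj E (\<psi> f) = eproj F f" if "f \<in> rset F" for f
    using proj[OF psi_closed[OF that]] phi_psi[OF that] by simp
  have psi_act: "\<psi> (f \<cdot>\<^bsub>F\<^esub> a) = \<psi> f \<cdot>\<^bsub>E\<^esub> a" if "f \<in> rset F" "a \<in> fib (eproj F f)" for f a
    using act[OF psi_closed[OF that(1)], of a] psi_phi[of "\<psi> f \<cdot>\<^bsub>E\<^esub> a"] psi_closed[OF that(1)]
      phi_psi[OF that(1)] psi_proj[OF that(1)] that(2) by simp
  have psi_op: "\<psi> (f \<triangleleft>\<^bsub>F\<^esub> f') = \<psi> f \<triangleleft>\<^bsub>E\<^esub> \<psi> f'" if "f \<in> rset F" "f' \<in> rset F" for f f'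
    using op[OF psi_closed[OF that(1)] psi_closed[OF that(2)]] psi_phi[of "\<psi> f \<triangleleft>\<^bsub>E\<^esub> \<psi> f'"]
      phi_psi[OF that(1)] phi_psi[OF that(2)] psi_closed[OF that(1)] psi_closed[OF that(2)] by simp
  have cont_phi: "continuous_map (rtop E) (rtop F) \<phi>"
    using E F proj act sec by (rule equivariant_continuous)
  have cont_psi: "continuous_map (rtop F) (rtop E) \<psi>"
    using F E psi_proj psi_act
  proof (rule equivariant_continuous)
    fix x assume "x \<in> rset X"
    then obtain U s where U: "openin (rtop X) U" "x \<in> U"
      and s: "continuous_map (subtopology (rtop X) U) (rtop E) s" "\<And>u. u \<in> U \<Longrightarrow> eproj E (s u) = u"
        "continuous_map (subtopology (rtop X) U) (rtop F) (\<lambda>u. \<phi> (s u))"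
      using sec by metis
    have sE: "s u \<in> rset E" if "u \<in> U" for u
      using continuous_map_image_subset_topspace[OF s(1)] U(1) openin_subset that by fastforce
    have "continuous_map (subtopology (rtop X) U) (rtop E) (\<lambda>u. \<psi> (\<phi> (s u)))"
      by (rule continuous_map_eq[OF s(1)]) (simp add: psi_phi sE)
    then show "\<exists>U s. openin (rtop X) U \<and> x \<in> U \<and>
        continuous_map (subtopology (rtop X) U) (rtop F) s \<and> (\<forall>u\<in>U. eproj F (s u) = u) \<and>
        continuous_map (subtopology (rtop X) U) (rtop E) (\<lambda>u. \<psi> (s u))"
      using U s sE proj by (intro exI[of _ U] exI[of _ "\<lambda>u. \<phi> (s u)"]) simp
  qed
  have "ext_morphism A E F \<phi>" "ext_morphism A F E \<psi>"
    unfolding ext_morphism_def rack_hom_def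
    using cont_phi op proj act cont_psi psi_op psi_proj psi_act by simp_all
  moreover have "homeomorphic_maps (rtop E) (rtop F) \<phi> \<psi>"
    unfolding homeomorphic_maps_def using cont_phi cont_psi psi_phi phi_psi by simp
  ultimately show ?thesis unfolding ext_equivalent_def by blast
qed

lemma ext_equivalent_sym: "ext_equivalent A E F \<Longrightarrow> ext_equivalent A F E"
  unfolding ext_equivalent_def using homeomorphic_maps_sym by blast

lemma ext_morphism_compose:
  assumes "ext_morphism A E F \<phi>" "ext_morphism A F G \<psi>"
  shows "ext_morphism A E G (\<psi> \<circ> \<phi>)"
proof -
  have "\<phi> e \<in> rset F" if "e \<in> rset E" for e
    using assms(1) that continuous_map_image_subset_topspace
    unfolding ext_morphism_def rack_hom_def by fastforce
  then show ?thesis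
    using assms unfolding ext_morphism_def rack_hom_def
    by (auto intro: continuous_map_compose)
qed

lemma ext_equivalent_trans:
  assumes "ext_equivalent A E F" "ext_equivalent A F G"
  shows "ext_equivalent A E G"
  using assms unfolding ext_equivalent_def
  by (meson ext_morphism_compose homeomorphic_maps_compose)

end

section \<open>The Baer sum is a central extension\<close>

locale central_ext_pair =
  module_over_rack X A + E: central_ext X A E + F: central_ext X A F
  for X :: "'x top_rack" and A :: "('x, 'a) rack_module"
    and E :: "('e, 'x, 'a) extension" and F :: "('f, 'x, 'a) extension"
begin

abbreviation W :: "('e \<times> 'f) topology" where
  "W \<equiv> fibre_product (rtop E) (eproj E) (rtop F) (eproj F)"

abbreviation B :: "(('e \<times> 'f) set, 'x, 'a) extension" where
  "B \<equiv> baer_sum A E F"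

text \<open>The point \<open>[e, f]\<close> of the Baer sum.\<close>

definition cl :: "'e \<Rightarrow> 'f \<Rightarrow> ('e \<times> 'f) set" where
  "cl e f = baer_rel A E F `` {(e, f)}"

lemma baer_relI:
  "e \<in> rset E \<Longrightarrow> f \<in> rset F \<Longrightarrow> eproj E e = eproj F f \<Longrightarrow> a \<in> fib (eproj E e) \<Longrightarrow>
     ((e \<cdot>\<^bsub>E\<^esub> a, f), (e, f \<cdot>\<^bsub>F\<^esub> a)) \<in> baer_rel A E F"
  unfolding baer_rel_def by blast

text \<open>The relation is the orbit relation of the antidiagonal action \<open>(e, f) \<mapsto> (e \<cdot> a\<^sup>-\<^sup>1, f \<cdot> a)\<close>.\<close>

lemma baer_rel_iff:
  assumes "e \<in> rset E" "f \<in> rset F" "eproj E e = eproj F f"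
  shows "((e, f), (e', f')) \<in> baer_rel A E F \<longleftrightarrow>
    (\<exists>a\<in>fib (eproj E e). e' = e \<cdot>\<^bsub>E\<^esub> inv\<^bsub>fibre A (eproj E e)\<^esub> a \<and> f' = f \<cdot>\<^bsub>F\<^esub> a)"
proof
  assume "((e, f), (e', f')) \<in> baer_rel A E F"
  then obtain a where a: "e = e' \<cdot>\<^bsub>E\<^esub> a" "f' = f \<cdot>\<^bsub>F\<^esub> a" "e' \<in> rset E" "a \<in> fib (eproj E e')"
    unfolding baer_rel_def by auto
  then have "e \<cdot>\<^bsub>E\<^esub> inv\<^bsub>fibre A (eproj E e)\<^esub> a = e'" "a \<in> fib (eproj E e)"
    by (simp_all add: E.act_act)
  with a(2) show "\<exists>a\<in>fib (eproj E e). e' = e \<cdot>\<^bsub>E\<^esub> inv\<^bsub>fibre A (eproj E e)\<^esub> a \<and> f' = f \<cdot>\<^bsub>F\<^esub> a"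
    by blast
next
  assume "\<exists>a\<in>fib (eproj E e). e' = e \<cdot>\<^bsub>E\<^esub> inv\<^bsub>fibre A (eproj E e)\<^esub> a \<and> f' = f \<cdot>\<^bsub>F\<^esub> a"
  then obtain a where a: "a \<in> fib (eproj E e)" "e' = e \<cdot>\<^bsub>E\<^esub> inv\<^bsub>fibre A (eproj E e)\<^esub> a" "f' = f \<cdot>\<^bsub>F\<^esub> a"
    by blast
  then have e': "e' \<cdot>\<^bsub>E\<^esub> a = e" "e' \<in> rset E" "eproj E e' = eproj E e"
    using assms(1) by (simp_all add: E.act_act)
  have "((e' \<cdot>\<^bsub>E\<^esub> a, f), (e', f \<cdot>\<^bsub>F\<^esub> a)) \<in> baer_rel A E F"
    by (rule baer_relI) (use e'(2,3) a(1) assms(2,3) in simp_all)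
  then show "((e, f), (e', f')) \<in> baer_rel A E F"
    by (simp only: e'(1) a(3))
qed

lemma baer_rel_equiv: "equiv (topspace W) (baer_rel A E F)"
proof (rule equivI)
  show "baer_rel A E F \<subseteq> topspace W \<times> topspace W"
    by (auto simp: baer_rel_def topspace_fibre_product)
  show "refl_on (topspace W) (baer_rel A E F)"
  proof (rule refl_onI)
    fix w assume "w \<in> topspace W"
    then obtain e f where w: "w = (e, f)" "e \<in> rset E" "f \<in> rset F" "eproj E e = eproj F f"
      by (auto simp: topspace_fibre_product)
    then have "((e \<cdot>\<^bsub>E\<^esub> \<one>\<^bsub>fibre A (eproj E e)\<^esub>, f), (e, f \<cdot>\<^bsub>F\<^esub> \<one>\<^bsub>fibre A (eproj E e)\<^esub>)) \<in> baer_rel A E F"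
      by (intro baer_relI) simp_all
    then show "(w, w) \<in> baer_rel A E F"
      by (simp only: w(1) E.act_one[OF w(2)] F.act_one[OF w(3), folded w(4)])
  qed
  show "sym (baer_rel A E F)"
  proof (rule symI)
    fix v w assume "(v, w) \<in> baer_rel A E F"
    then obtain e f a where vw: "v = (e \<cdot>\<^bsub>E\<^esub> a, f)" "w = (e, f \<cdot>\<^bsub>F\<^esub> a)" "e \<in> rset E" "f \<in> rset F"
      "eproj E e = eproj F f" "a \<in> fib (eproj E e)"
      unfolding baer_rel_def by auto
    let ?b = "inv\<^bsub>fibre A (eproj E e)\<^esub> a"
    have "(((e \<cdot>\<^bsub>E\<^esub> a) \<cdot>\<^bsub>E\<^esub> ?b, f \<cdot>\<^bsub>F\<^esub> a), (e \<cdot>\<^bsub>E\<^esub> a, (f \<cdot>\<^bsub>F\<^esub> a) \<cdot>\<^bsub>F\<^esub> ?b)) \<in> baer_rel A E F"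
      using vw(3-6) by (intro baer_relI) simp_all
    moreover have "(e \<cdot>\<^bsub>E\<^esub> a) \<cdot>\<^bsub>E\<^esub> ?b = e" "(f \<cdot>\<^bsub>F\<^esub> a) \<cdot>\<^bsub>F\<^esub> ?b = f"
      using vw(3-6) by (simp_all add: E.act_act F.act_act)
    ultimately show "(w, v) \<in> baer_rel A E F"
      using vw by simp
  qed
  show "trans (baer_rel A E F)"
  proof (rule transI)
    fix u v w assume uv: "(u, v) \<in> baer_rel A E F" and vw: "(v, w) \<in> baer_rel A E F"
    obtain e f where u: "u = (e, f)" "e \<in> rset E" "f \<in> rset F" "eproj E e = eproj F f"
      using uv unfolding baer_rel_def by auto
    then obtain a where a: "a \<in> fib (eproj E e)" "v = (e \<cdot>\<^bsub>E\<^esub> inv\<^bsub>fibre A (eproj E e)\<^esub> a, f \<cdot>\<^bsub>F\<^esub> a)"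
      using uv baer_rel_iff[OF u(2-4)] by (metis surj_pair)
    let ?x = "eproj E e"
    have v: "e \<cdot>\<^bsub>E\<^esub> inv\<^bsub>fibre A ?x\<^esub> a \<in> rset E" "f \<cdot>\<^bsub>F\<^esub> a \<in> rset F"
      "eproj E (e \<cdot>\<^bsub>E\<^esub> inv\<^bsub>fibre A ?x\<^esub> a) = eproj F (f \<cdot>\<^bsub>F\<^esub> a)"
      using u a by simp_all
    obtain b where b: "b \<in> fib ?x"
      "w = ((e \<cdot>\<^bsub>E\<^esub> inv\<^bsub>fibre A ?x\<^esub> a) \<cdot>\<^bsub>E\<^esub> inv\<^bsub>fibre A ?x\<^esub> b, (f \<cdot>\<^bsub>F\<^esub> a) \<cdot>\<^bsub>F\<^esub> b)"
      using vw baer_rel_iff[OF v] a u(2) by (cases w) auto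
    have x: "?x \<in> rset X" using u by simp
    have "w = (e \<cdot>\<^bsub>E\<^esub> inv\<^bsub>fibre A ?x\<^esub> (a \<otimes>\<^bsub>fibre A ?x\<^esub> b), f \<cdot>\<^bsub>F\<^esub> (a \<otimes>\<^bsub>fibre A ?x\<^esub> b))"
      using b(2) a(1) b(1) u x comm_group.inv_mult[OF fib_comm_group[OF x] a(1) b(1)]
      by (simp add: E.act_act F.act_act)
    then show "(u, w) \<in> baer_rel A E F"
      using u(1) baer_rel_iff[OF u(2-4)] fib_mult_closed[OF x a(1) b(1)] by blast
  qed
qed

lemma cl_move:
  assumes "e \<in> rset E" "f \<in> rset F" "eproj E e = eproj F f" "a \<in> fib (eproj E e)"
  shows "cl (e \<cdot>\<^bsub>E\<^esub> a) f = cl e (f \<cdot>\<^bsub>F\<^esub> a)"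
  unfolding cl_def
  by (rule equiv_class_eq[OF baer_rel_equiv]) (rule baer_relI[OF assms])

lemma cl_eqD:
  assumes "e \<in> rset E" "f \<in> rset F" "eproj E e = eproj F f"
    and "e' \<in> rset E" "f' \<in> rset F" "eproj E e' = eproj F f'"
    and "cl e f = cl e' f'"
  obtains a where "a \<in> fib (eproj E e')" "e = e' \<cdot>\<^bsub>E\<^esub> a" "f' = f \<cdot>\<^bsub>F\<^esub> a" "eproj E e = eproj E e'"
proof -
  have "((e, f), (e', f')) \<in> baer_rel A E F"
    using assms eq_equiv_class_iff[OF baer_rel_equiv, of "(e, f)" "(e', f')"]
    by (simp add: cl_def topspace_fibre_product)
  then show thesis
    using that assms unfolding baer_rel_def by auto
qed

lemma cl_memD:
  assumes "(e', f') \<in> cl e f"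
  shows "e' \<in> rset E" "f' \<in> rset F" "eproj E e' = eproj F f'" "cl e' f' = cl e f"
proof -
  have r: "((e, f), (e', f')) \<in> baer_rel A E F"
    using assms unfolding cl_def by simp
  then have "(e', f') \<in> topspace W"
    using baer_rel_equiv unfolding equiv_def by blast
  then show "e' \<in> rset E" "f' \<in> rset F" "eproj E e' = eproj F f'"
    by (auto simp: topspace_fibre_product)
  show "cl e' f' = cl e f"
    using equiv_class_eq[OF baer_rel_equiv r] unfolding cl_def by simp
qed

lemma cl_self:
  "e \<in> rset E \<Longrightarrow> f \<in> rset F \<Longrightarrow> eproj E e = eproj F f \<Longrightarrow> (e, f) \<in> cl e f"
  unfolding cl_def by (rule equiv_class_self[OF baer_rel_equiv]) (simp add: topspace_fibre_product)

lemma rset_baer: "rset B = topspace W // baer_rel A E F"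
  by (simp add: baer_sum_def topspace_quotient_topology)

lemma cl_closed [simp]:
  "e \<in> rset E \<Longrightarrow> f \<in> rset F \<Longrightarrow> eproj E e = eproj F f \<Longrightarrow> cl e f \<in> rset B"
  unfolding rset_baer cl_def by (rule quotientI) (simp add: topspace_fibre_product)

lemma baer_cases:
  assumes "P \<in> rset B"
  obtains e f where "P = cl e f" "e \<in> rset E" "f \<in> rset F" "eproj E e = eproj F f"
  using assms unfolding rset_baer cl_def by (auto elim!: quotientE simp: topspace_fibre_product)

lemma cl_proj [simp]:
  assumes "e \<in> rset E" "f \<in> rset F" "eproj E e = eproj F f"
  shows "eproj B (cl e f) = eproj E e"
proof -
  have p: "eproj E e' = eproj E e" if m: "(e', f') \<in> cl e f" for e' f'
    using cl_eqD[OF cl_memD(1-3)[OF m] assms cl_memD(4)[OF m]] by metis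
  have "(\<lambda>(e, f). eproj E e) ` cl e f \<subseteq> {eproj E e}"
  proof (rule image_subsetI)
    fix w assume "w \<in> cl e f"
    then show "(case w of (e, f) \<Rightarrow> eproj E e) \<in> {eproj E e}"
      using p by (cases w) simp
  qed
  moreover have "eproj E e \<in> (\<lambda>(e, f). eproj E e) ` cl e f"
    using imageI[OF cl_self[OF assms], of "\<lambda>(e, f). eproj E e"] by simp
  ultimately have "(\<lambda>(e, f). eproj E e) ` cl e f = {eproj E e}"
    by blast
  then show ?thesis by (simp add: baer_sum_def)
qed

lemma UN_cl:
  assumes "e \<in> rset E" "f \<in> rset F" "eproj E e = eproj F f"
    and "\<And>e' f'. (e', f') \<in> cl e f \<Longrightarrow> h e' f' = Q"
  shows "(\<Union>(e', f')\<in>cl e f. h e' f') = Q"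
proof -
  have "(case w of (e', f') \<Rightarrow> h e' f') = Q" if "w \<in> cl e f" for w
    using assms(4) that by (cases w) simp
  then show ?thesis
    using cl_self[OF assms(1-3)] by blast
qed

text \<open>Moving \<open>a\<close> and \<open>b\<close> across the two factors turns into moving \<open>eta a\<close> and \<open>tau b\<close> across the
  products, because \<open>E\<close> and \<open>F\<close> obey the same rules for the action.\<close>

lemma cl_op_cong:
  assumes e: "e \<in> rset E" "f \<in> rset F" "eproj E e = eproj F f"
    and d: "d \<in> rset E" "g \<in> rset F" "eproj E d = eproj F g"
    and e': "e' \<in> rset E" "f' \<in> rset F" "eproj E e' = eproj F f'"
    and d': "d' \<in> rset E" "g' \<in> rset F" "eproj E d' = eproj F g'"
    and eq: "cl e f = cl e' f'" "cl d g = cl d' g'"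
  shows "cl (e \<triangleleft>\<^bsub>E\<^esub> d) (f \<triangleleft>\<^bsub>F\<^esub> g) = cl (e' \<triangleleft>\<^bsub>E\<^esub> d') (f' \<triangleleft>\<^bsub>F\<^esub> g')"
proof -
  obtain a where a: "a \<in> fib (eproj E e')" "e = e' \<cdot>\<^bsub>E\<^esub> a" "f' = f \<cdot>\<^bsub>F\<^esub> a" "eproj E e = eproj E e'"
    using cl_eqD[OF e e' eq(1)] .
  obtain b where b: "b \<in> fib (eproj E d')" "d = d' \<cdot>\<^bsub>E\<^esub> b" "g' = g \<cdot>\<^bsub>F\<^esub> b" "eproj E d = eproj E d'"
    using cl_eqD[OF d d' eq(2)] .
  have p: "eproj F f = eproj E e'" "eproj F g = eproj E d'"
    using e(3) a(4) d(3) b(4) by simp_all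
  have "cl (e \<triangleleft>\<^bsub>E\<^esub> d) (f \<triangleleft>\<^bsub>F\<^esub> g)
      = cl ((e' \<triangleleft>\<^bsub>E\<^esub> d) \<cdot>\<^bsub>E\<^esub> eta A (eproj E e') (eproj E d) a) (f \<triangleleft>\<^bsub>F\<^esub> g)"
    unfolding a(2) using a(1) e' d by (simp add: E.op_act_left)
  also have "\<dots> = cl (e' \<triangleleft>\<^bsub>E\<^esub> d) ((f \<triangleleft>\<^bsub>F\<^esub> g) \<cdot>\<^bsub>F\<^esub> eta A (eproj E e') (eproj E d) a)"
    by (rule cl_move) (use e e' d d' a(1) p b(4) in simp_all)
  also have "\<dots> = cl (e' \<triangleleft>\<^bsub>E\<^esub> d) (f' \<triangleleft>\<^bsub>F\<^esub> g)"
    unfolding a(3) using a(1) e e' d d' p b(4) by (simp add: F.op_act_left)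
  also have "\<dots> = cl ((e' \<triangleleft>\<^bsub>E\<^esub> d') \<cdot>\<^bsub>E\<^esub> tau A (eproj E e') (eproj E d') b) (f' \<triangleleft>\<^bsub>F\<^esub> g)"
    unfolding b(2) using b(1) e' d' by (simp add: E.op_act_right)
  also have "\<dots> = cl (e' \<triangleleft>\<^bsub>E\<^esub> d') ((f' \<triangleleft>\<^bsub>F\<^esub> g) \<cdot>\<^bsub>F\<^esub> tau A (eproj E e') (eproj E d') b)"
    by (rule cl_move) (use e' d d' b(1) p in simp_all)
  also have "\<dots> = cl (e' \<triangleleft>\<^bsub>E\<^esub> d') (f' \<triangleleft>\<^bsub>F\<^esub> g')"
    unfolding b(3) using b(1) e' d p by (simp add: F.op_act_right)
  finally show ?thesis .
qed

lemma cl_op [simp]: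
  assumes e: "e \<in> rset E" "f \<in> rset F" "eproj E e = eproj F f"
    and d: "d \<in> rset E" "g \<in> rset F" "eproj E d = eproj F g"
  shows "cl e f \<triangleleft>\<^bsub>B\<^esub> cl d g = cl (e \<triangleleft>\<^bsub>E\<^esub> d) (f \<triangleleft>\<^bsub>F\<^esub> g)"
proof -
  have "cl e f \<triangleleft>\<^bsub>B\<^esub> cl d g
      = (\<Union>(e', f')\<in>cl e f. \<Union>(d', g')\<in>cl d g. cl (e' \<triangleleft>\<^bsub>E\<^esub> d') (f' \<triangleleft>\<^bsub>F\<^esub> g'))"
    by (simp add: baer_sum_def cl_def)
  also have "\<dots> = cl (e \<triangleleft>\<^bsub>E\<^esub> d) (f \<triangleleft>\<^bsub>F\<^esub> g)"
    by (rule UN_cl[OF e], rule UN_cl[OF d], rule cl_op_cong) (use e d in \<open>auto dest: cl_memD\<close>)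
  finally show ?thesis .
qed

lemma cl_act [simp]:
  assumes e: "e \<in> rset E" "f \<in> rset F" "eproj E e = eproj F f" and a: "a \<in> fib (eproj E e)"
  shows "cl e f \<cdot>\<^bsub>B\<^esub> a = cl (e \<cdot>\<^bsub>E\<^esub> a) f"
proof -
  have "cl e f \<cdot>\<^bsub>B\<^esub> a = (\<Union>(e', f')\<in>cl e f. cl (e' \<cdot>\<^bsub>E\<^esub> a) f')"
    by (simp add: baer_sum_def cl_def)
  also have "\<dots> = cl (e \<cdot>\<^bsub>E\<^esub> a) f"
  proof (rule UN_cl[OF e])
    fix e' f' assume m: "(e', f') \<in> cl e f"
    note m' = cl_memD[OF m]
    obtain b where b: "b \<in> fib (eproj E e)" "e' = e \<cdot>\<^bsub>E\<^esub> b" "f = f' \<cdot>\<^bsub>F\<^esub> b" "eproj E e' = eproj E e"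
      using cl_eqD[OF m'(1-3) e m'(4)] .
    have x: "eproj E e \<in> rset X" using e by simp
    have "cl (e' \<cdot>\<^bsub>E\<^esub> a) f' = cl ((e \<cdot>\<^bsub>E\<^esub> a) \<cdot>\<^bsub>E\<^esub> b) f'"
      using b(2) e(1) a b(1) by (simp add: E.act_act fib_comm[OF x])
    also have "\<dots> = cl (e \<cdot>\<^bsub>E\<^esub> a) f"
      unfolding b(3) by (rule cl_move) (use m'(1-3) b(1,4) e a in simp_all)
    finally show "cl (e' \<cdot>\<^bsub>E\<^esub> a) f' = cl (e \<cdot>\<^bsub>E\<^esub> a) f" .
  qed
  finally show ?thesis .
qed

text \<open>If \<open>[e \<cdot> a, f] = [e \<cdot> b, f]\<close>, then some \<open>c\<close> with \<open>f = f \<cdot> c\<close> takes \<open>e \<cdot> b\<close> to \<open>e \<cdot> a\<close>; the action on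
  \<open>F\<close> being free, \<open>c\<close> is the identity.\<close>

lemma cl_act_cancel:
  assumes e: "e \<in> rset E" "f \<in> rset F" "eproj E e = eproj F f"
    and a: "a \<in> fib (eproj E e)" and b: "b \<in> fib (eproj E e)"
    and eq: "cl (e \<cdot>\<^bsub>E\<^esub> a) f = cl (e \<cdot>\<^bsub>E\<^esub> b) f"
  shows "a = b"
proof -
  obtain c where c: "c \<in> fib (eproj E e)" "e \<cdot>\<^bsub>E\<^esub> a = (e \<cdot>\<^bsub>E\<^esub> b) \<cdot>\<^bsub>E\<^esub> c" "f = f \<cdot>\<^bsub>F\<^esub> c"
    by (rule cl_eqD[OF _ _ _ _ _ _ eq]) (use e a b in simp_all)
  have "c = \<one>\<^bsub>fibre A (eproj E e)\<^esub>"
    by (rule F.act_cancel[OF e(2)]) (use c e in simp_all)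
  then have "e \<cdot>\<^bsub>E\<^esub> a = e \<cdot>\<^bsub>E\<^esub> b"
    using c(2) e(1) b by (simp add: E.act_act)
  then show ?thesis
    using E.act_cancel e a b by blast
qed

lemma cl_act_translations:
  assumes e: "e \<in> rset E" "f \<in> rset F" "eproj E e = eproj F f"
    and e': "e' \<in> rset E" "f' \<in> rset F" "eproj E e' = eproj F f'"
    and p: "eproj E e = eproj E e'"
  shows "cl e f \<cdot>\<^bsub>B\<^esub> (translation A E e e' \<otimes>\<^bsub>fibre A (eproj E e)\<^esub> translation A F f f') = cl e' f'"
proof -
  let ?a = "translation A E e e'" and ?b = "translation A F f f'"
  have pf: "eproj F f = eproj F f'" using e(3) e'(3) p by simp
  have ab: "?a \<in> fib (eproj E e)" "?b \<in> fib (eproj E e)" "e \<cdot>\<^bsub>E\<^esub> ?a = e'" "f \<cdot>\<^bsub>F\<^esub> ?b = f'"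
    using E.translation_closed[OF e(1) e'(1) p] F.translation_closed[OF e(2) e'(2) pf]
      E.act_translation[OF e(1) e'(1) p] F.act_translation[OF e(2) e'(2) pf] e(3) by simp_all
  have "cl e f \<cdot>\<^bsub>B\<^esub> (?a \<otimes>\<^bsub>fibre A (eproj E e)\<^esub> ?b) = cl ((e \<cdot>\<^bsub>E\<^esub> ?a) \<cdot>\<^bsub>E\<^esub> ?b) f"
    using e ab(1,2) by (simp add: E.act_act[OF e(1) ab(1,2)] del: E.act_translation)
  also have "\<dots> = cl e' (f \<cdot>\<^bsub>F\<^esub> ?b)"
    unfolding ab(3) by (rule cl_move) (use e e' p ab(2) in simp_all)
  finally show ?thesis unfolding ab(4) .
qed

lemma translation_cl:
  assumes e: "e \<in> rset E" "f \<in> rset F" "eproj E e = eproj F f"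
    and e': "e' \<in> rset E" "f' \<in> rset F" "eproj E e' = eproj F f'"
    and p: "eproj E e = eproj E e'"
  shows "translation A B (cl e f) (cl e' f')
    = translation A E e e' \<otimes>\<^bsub>fibre A (eproj E e)\<^esub> translation A F f f'" (is "_ = ?c")
  unfolding translation_def[of A B]
proof (rule the_equality)
  have pf: "eproj F f = eproj F f'" using e(3) e'(3) p by simp
  have c: "?c \<in> fib (eproj E e)"
    using E.translation_closed[OF e(1) e'(1) p] F.translation_closed[OF e(2) e'(2) pf] e by simp
  then show "?c \<in> fib (eproj B (cl e f)) \<and> cl e' f' = cl e f \<cdot>\<^bsub>B\<^esub> ?c"
    unfolding cl_act_translations[OF assms] using e by simp
  fix a assume "a \<in> fib (eproj B (cl e f)) \<and> cl e' f' = cl e f \<cdot>\<^bsub>B\<^esub> a"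
  then have a: "a \<in> fib (eproj E e)" "cl e f \<cdot>\<^bsub>B\<^esub> a = cl e f \<cdot>\<^bsub>B\<^esub> ?c"
    unfolding cl_act_translations[OF assms] using e by simp_all
  then show "a = ?c"
    using cl_act_cancel[OF e a(1) c] cl_act[OF e a(1)] cl_act[OF e c] by simp
qed

text \<open>The class map is open: the saturation of an open set is its image under the action of \<open>A\<close>,
  that is, the projection along \<open>A\<close> of an open set, and \<open>bproj A\<close> is open.\<close>

lemma open_map_cl: "open_map W (rtop B) (\<lambda>(e, f). cl e f)"
  unfolding open_map_def
proof (intro allI impI)
  fix V assume V: "openin W V"
  let ?p = "\<lambda>w. eproj E (fst w)"
  let ?Z = "fibre_product W ?p (total A) (bproj A)"
  let ?m = "\<lambda>z. (fst (fst z) \<cdot>\<^bsub>E\<^esub> inv\<^bsub>fibre A (?p (fst z))\<^esub> snd z, snd (fst z) \<cdot>\<^bsub>F\<^esub> snd z)"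
  have VW: "V \<subseteq> topspace W" using V openin_subset by blast
  have Z: "fst (fst z) \<in> rset E" "snd (fst z) \<in> rset F" "?p (fst z) = eproj F (snd (fst z))"
    "snd z \<in> fib (?p (fst z))" "bproj A (snd z) = ?p (fst z)" if "z \<in> topspace ?Z" for z
    using that fib_bproj by (auto simp: topspace_fibre_product)
  have c: "continuous_map ?Z (rtop E) (\<lambda>z. fst (fst z))" "continuous_map ?Z (rtop F) (\<lambda>z. snd (fst z))"
    "continuous_map ?Z (total A) snd"
    using continuous_map_compose[OF continuous_map_from_fibre_product(1) continuous_map_from_fibre_product(1)]
      continuous_map_compose[OF continuous_map_from_fibre_product(1) continuous_map_from_fibre_product(2)]
      continuous_map_from_fibre_product(2) unfolding o_def by blast+
  have m: "continuous_map ?Z W ?m"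
    unfolding continuous_map_into_fibre_product
  proof (intro conjI ballI)
    show "continuous_map ?Z (rtop E) (\<lambda>z. fst (fst z) \<cdot>\<^bsub>E\<^esub> inv\<^bsub>fibre A (?p (fst z))\<^esub> snd z)"
      by (intro E.continuous_act continuous_fib_inv c) (use Z in auto)
    show "continuous_map ?Z (rtop F) (\<lambda>z. snd (fst z) \<cdot>\<^bsub>F\<^esub> snd z)"
      by (intro F.continuous_act c) (use Z in auto)
  qed (use Z in simp)
  have "{w \<in> topspace W. baer_rel A E F `` {w} \<in> (\<lambda>(e, f). cl e f) ` V}
      = fst ` {z \<in> topspace ?Z. ?m z \<in> V}" (is "?L = ?R")
  proof (intro equalityI subsetI)
    fix w assume "w \<in> ?L"
    then obtain e f e' f' where w: "w = (e, f)" "e \<in> rset E" "f \<in> rset F" "eproj E e = eproj F f"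
      and v: "(e', f') \<in> V" "cl e f = cl e' f'"
      by (auto simp: topspace_fibre_product cl_def)
    have v': "e' \<in> rset E" "f' \<in> rset F" "eproj E e' = eproj F f'"
      using v(1) VW by (auto simp: topspace_fibre_product)
    have "(e', f') \<in> cl e f" using cl_self[OF v'] v(2) by simp
    then obtain a where a: "a \<in> fib (eproj E e)" "e' = e \<cdot>\<^bsub>E\<^esub> inv\<^bsub>fibre A (eproj E e)\<^esub> a" "f' = f \<cdot>\<^bsub>F\<^esub> a"
      using baer_rel_iff[OF w(2-4)] unfolding cl_def by auto
    have "(w, a) \<in> topspace ?Z"
      using w a(1) fib_mem[OF E.proj_closed[OF w(2)] a(1)] by (simp add: topspace_fibre_product)
    moreover have "?m (w, a) \<in> V" using v(1) a w(1) by simp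
    ultimately show "w \<in> ?R" by force
  next
    fix w assume "w \<in> ?R"
    then obtain z where z: "z \<in> topspace ?Z" "?m z \<in> V" "w = fst z" by blast
    note zz = Z[OF z(1)]
    have "(fst z, ?m z) \<in> baer_rel A E F"
      using baer_rel_iff[OF zz(1-3)] zz(4) by (metis prod.collapse)
    then have "baer_rel A E F `` {w} = cl (fst (?m z)) (snd (?m z))"
      unfolding cl_def z(3) by (simp only: prod.collapse) (rule equiv_class_eq[OF baer_rel_equiv])
    moreover have "cl (fst (?m z)) (snd (?m z)) \<in> (\<lambda>(e, f). cl e f) ` V"
      using imageI[OF z(2), of "\<lambda>(e, f). cl e f"] by simp
    moreover have "w \<in> topspace W"
      using zz(1-3) z(3) by (simp add: topspace_fibre_product case_prod_unfold)
    ultimately show "w \<in> ?L" by simp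
  qed
  moreover have "openin W ?R"
  proof -
    have p: "continuous_map W (rtop X) ?p"
      using continuous_map_compose[OF continuous_map_from_fibre_product(1) E.continuous_proj]
      by (simp add: o_def)
    show ?thesis
      using open_map_fibre_product_fst[OF open_bproj p] openin_continuous_map_preimage[OF m V]
      unfolding open_map_def by blast
  qed
  moreover have "(\<lambda>(e, f). cl e f) ` V \<subseteq> topspace W // baer_rel A E F"
    using VW unfolding cl_def by (auto intro!: quotientI)
  ultimately show "openin (rtop B) ((\<lambda>(e, f). cl e f) ` V)"
    by (simp add: baer_sum_def openin_quotient_topology)
qed

lemma continuous_map_cl: "continuous_map W (rtop B) (\<lambda>(e, f). cl e f)"
  unfolding continuous_map_def
proof (intro conjI allI impI)
  show "(\<lambda>(e, f). cl e f) \<in> topspace W \<rightarrow> rset B"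
    by (auto simp: topspace_fibre_product)
  fix V assume "openin (rtop B) V"
  then show "openin W {x \<in> topspace W. (case x of (e, f) \<Rightarrow> cl e f) \<in> V}"
    by (simp add: baer_sum_def openin_quotient_topology cl_def case_prod_unfold)
qed

lemma cl_image: "(\<lambda>(e, f). cl e f) ` topspace W = rset B"
  unfolding rset_baer quotient_def cl_def by auto

lemma continuous_cl:
  assumes "continuous_map Z (rtop E) f" "continuous_map Z (rtop F) g"
    and "\<And>z. z \<in> topspace Z \<Longrightarrow> eproj E (f z) = eproj F (g z)"
  shows "continuous_map Z (rtop B) (\<lambda>z. cl (f z) (g z))"
  by (rule continuous_map_compose_fibre_product[OF continuous_map_cl assms])

lemma continuous_pair_coordinates:
  assumes "continuous_map Z W w"
  shows "continuous_map Z (rtop E) (\<lambda>z. fst (w z))" "continuous_map Z (rtop F) (\<lambda>z. snd (w z))"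
  using continuous_map_compose[OF assms continuous_map_from_fibre_product(1)]
    continuous_map_compose[OF assms continuous_map_from_fibre_product(2)] by (simp_all add: o_def)

lemma mem_W: "w \<in> topspace W \<longleftrightarrow> fst w \<in> rset E \<and> snd w \<in> rset F \<and> eproj E (fst w) = eproj F (snd w)"
  by (cases w) (simp add: topspace_fibre_product)

lemma baer_local_section:
  assumes "x \<in> rset X"
  shows "\<exists>U s t. openin (rtop X) U \<and> x \<in> U \<and>
    continuous_map (subtopology (rtop X) U) (rtop E) s \<and>
    continuous_map (subtopology (rtop X) U) (rtop F) t \<and>
    continuous_map (subtopology (rtop X) U) (rtop B) (\<lambda>u. cl (s u) (t u)) \<and>
    (\<forall>u\<in>U. s u \<in> rset E \<and> t u \<in> rset F \<and> eproj E (s u) = u \<and> eproj F (t u) = u)"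
proof -
  obtain U s where U: "openin (rtop X) U" "x \<in> U" "continuous_map (subtopology (rtop X) U) (rtop E) s"
    "\<And>u. u \<in> U \<Longrightarrow> eproj E (s u) = u"
    using E.local_section[OF assms] by blast
  obtain V t where V: "openin (rtop X) V" "x \<in> V" "continuous_map (subtopology (rtop X) V) (rtop F) t"
    "\<And>u. u \<in> V \<Longrightarrow> eproj F (t u) = u"
    using F.local_section[OF assms] by blast
  let ?S = "subtopology (rtop X) (U \<inter> V)"
  have op: "openin (rtop X) (U \<inter> V)" using U(1) V(1) by blast
  have s: "continuous_map ?S (rtop E) s" and t: "continuous_map ?S (rtop F) t"
    using continuous_map_from_subtopology_mono[OF U(3)] continuous_map_from_subtopology_mono[OF V(3)] by auto
  have top: "topspace ?S = U \<inter> V"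
    using op openin_subset by fastforce
  have "continuous_map ?S (rtop B) (\<lambda>u. cl (s u) (t u))"
    by (rule continuous_cl[OF s t]) (use U(4) V(4) top in auto)
  moreover have "s u \<in> rset E" "t u \<in> rset F" if "u \<in> U \<inter> V" for u
    using continuous_map_image_subset_topspace[OF s] continuous_map_image_subset_topspace[OF t] top that by auto
  ultimately show ?thesis
    using op s t U(2,4) V(2,4) by (intro exI[of _ "U \<inter> V"] exI[of _ s] exI[of _ t]) simp
qed

text \<open>Every algebraic identity is checked on representatives, and so is continuity, since the class map
  is open.\<close>

lemma central_baer_sum: "central_extension X A B"
proof (rule central_extensionI[where t = "translation A B"])
  let ?q = "\<lambda>(e, f). cl e f"
  note q = open_map_cl continuous_map_cl cl_image
  show "continuous_map (prod_topology (rtop B) (rtop B)) (rtop B) (\<lambda>(P, Q). P \<triangleleft>\<^bsub>B\<^esub> Q)"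
  proof -
    let ?k = "\<lambda>_. ()"
    have "continuous_map (fibre_product W ?k W ?k) (rtop B)
        (\<lambda>z. cl (fst (fst z) \<triangleleft>\<^bsub>E\<^esub> fst (snd z)) (snd (fst z) \<triangleleft>\<^bsub>F\<^esub> snd (snd z)))"
      by (intro continuous_cl E.continuous_op F.continuous_op
            continuous_pair_coordinates[OF continuous_map_from_fibre_product(1)]
            continuous_pair_coordinates[OF continuous_map_from_fibre_product(2)])
        (auto simp: topspace_fibre_product)
    then have "continuous_map (fibre_product W ?k W ?k) (rtop B) (\<lambda>(v, w). ?q v \<triangleleft>\<^bsub>B\<^esub> ?q w)"
      by (rule continuous_map_eq) (auto simp: topspace_fibre_product)
    then have "continuous_map (fibre_product (rtop B) ?k (rtop B) ?k) (rtop B) (\<lambda>(P, Q). P \<triangleleft>\<^bsub>B\<^esub> Q)"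
      by (intro continuous_map_descend_fibre_product[OF q q]) simp_all
    then show ?thesis by (simp add: fibre_product_def case_prod_unfold)
  qed
  show "(P \<triangleleft>\<^bsub>B\<^esub> Q) \<triangleleft>\<^bsub>B\<^esub> R = (P \<triangleleft>\<^bsub>B\<^esub> R) \<triangleleft>\<^bsub>B\<^esub> (Q \<triangleleft>\<^bsub>B\<^esub> R)"
    if PQR: "P \<in> rset B" "Q \<in> rset B" "R \<in> rset B" for P Q R
  proof -
    obtain e f where P: "P = cl e f" "e \<in> rset E" "f \<in> rset F" "eproj E e = eproj F f"
      using PQR(1) by (rule baer_cases)
    obtain e' f' where Q: "Q = cl e' f'" "e' \<in> rset E" "f' \<in> rset F" "eproj E e' = eproj F f'"
      using PQR(2) by (rule baer_cases)
    obtain d g where R: "R = cl d g" "d \<in> rset E" "g \<in> rset F" "eproj E d = eproj F g"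
      using PQR(3) by (rule baer_cases)
    show ?thesis
      using P Q R E.op_distrib[of e e' d] F.op_distrib[of f f' g] by simp
  qed
  show "eproj B (P \<triangleleft>\<^bsub>B\<^esub> Q) = eproj B P \<triangleleft>\<^bsub>X\<^esub> eproj B Q" if "P \<in> rset B" "Q \<in> rset B" for P Q
    using that by (elim baer_cases) simp
  show "continuous_map (rtop B) (rtop X) (eproj B)"
  proof (rule continuous_compose_quotient_map[OF continuous_open_imp_quotient_map[OF q(2,1,3)]])
    have "continuous_map W (rtop X) (\<lambda>w. eproj E (fst w))"
      using continuous_map_compose[OF continuous_map_from_fibre_product(1) E.continuous_proj]
      by (simp add: o_def)
    then show "continuous_map W (rtop X) (eproj B \<circ> ?q)"
      by (rule continuous_map_eq) (auto simp: topspace_fibre_product)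
  qed
  show "continuous_local_sections (rtop B) (rtop X) (eproj B)"
    unfolding continuous_local_sections_def
  proof
    fix x assume x: "x \<in> rset X"
    obtain U s t where "openin (rtop X) U" "x \<in> U"
      "continuous_map (subtopology (rtop X) U) (rtop B) (\<lambda>u. cl (s u) (t u))"
      "\<forall>u\<in>U. s u \<in> rset E \<and> t u \<in> rset F \<and> eproj E (s u) = u \<and> eproj F (t u) = u"
      using baer_local_section[OF x] by blast
    then show "\<exists>U s. openin (rtop X) U \<and> x \<in> U \<and> continuous_map (subtopology (rtop X) U) (rtop B) s
        \<and> (\<forall>u\<in>U. eproj B (s u) = u)"
      by (intro exI[of _ U] exI[of _ "\<lambda>u. cl (s u) (t u)"]) simp
  qed
  show "continuous_map (fibre_product (rtop B) (eproj B) (total A) (bproj A)) (rtop B) (\<lambda>(P, a). P \<cdot>\<^bsub>B\<^esub> a)"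
  proof -
    let ?p = "\<lambda>w. eproj E (fst w)" and ?id = "\<lambda>a. a"
    have "continuous_map (fibre_product W ?p (total A) (bproj A)) (rtop B)
        (\<lambda>z. cl (fst (fst z) \<cdot>\<^bsub>E\<^esub> snd z) (snd (fst z)))"
      by (intro continuous_cl E.continuous_act continuous_map_from_fibre_product
            continuous_pair_coordinates[OF continuous_map_from_fibre_product(1)])
        (use fib_bproj in \<open>auto simp: topspace_fibre_product\<close>)
    then have "continuous_map (fibre_product W ?p (total A) (bproj A)) (rtop B) (\<lambda>(w, a). ?q w \<cdot>\<^bsub>B\<^esub> ?id a)"
      by (rule continuous_map_eq) (use fib_bproj in \<open>auto simp: topspace_fibre_product\<close>)
    then show ?thesis
      by (intro continuous_map_descend_fibre_product[where ?q2.0 = ?id and r = "bproj A" and p = ?p, OF q])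
        (auto simp: topspace_fibre_product open_map_def)
  qed
  show "P \<cdot>\<^bsub>B\<^esub> \<one>\<^bsub>fibre A (eproj B P)\<^esub> = P" if "P \<in> rset B" for P
    using that
  proof (rule baer_cases)
    fix e f assume ef: "P = cl e f" "e \<in> rset E" "f \<in> rset F" "eproj E e = eproj F f"
    then show ?thesis
      using cl_act[OF ef(2-4), of "\<one>\<^bsub>fibre A (eproj E e)\<^esub>"] by simp
  qed
  show "eproj B (P \<cdot>\<^bsub>B\<^esub> a) = eproj B P" if "P \<in> rset B" "a \<in> fib (eproj B P)" for P a
    using that by (elim baer_cases) simp
  show "P \<cdot>\<^bsub>B\<^esub> (a \<otimes>\<^bsub>fibre A (eproj B P)\<^esub> b) = (P \<cdot>\<^bsub>B\<^esub> a) \<cdot>\<^bsub>B\<^esub> b"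
    if "P \<in> rset B" "a \<in> fib (eproj B P)" "b \<in> fib (eproj B P)" for P a b
    using that by (elim baer_cases) (simp add: E.act_act)
  show "translation A B P Q \<in> fib (eproj B P)" if "P \<in> rset B" "Q \<in> rset B" "eproj B P = eproj B Q" for P Q
    using that by (elim baer_cases) (simp add: translation_cl)
  show "P \<cdot>\<^bsub>B\<^esub> translation A B P Q = Q"
    if PQ: "P \<in> rset B" "Q \<in> rset B" "eproj B P = eproj B Q" for P Q
  proof -
    obtain e f where P: "P = cl e f" "e \<in> rset E" "f \<in> rset F" "eproj E e = eproj F f"
      using PQ(1) by (rule baer_cases)
    obtain e' f' where Q: "Q = cl e' f'" "e' \<in> rset E" "f' \<in> rset F" "eproj E e' = eproj F f'"
      using PQ(2) by (rule baer_cases)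
    have p: "eproj E e = eproj E e'"
      using PQ(3) P Q by simp
    show ?thesis
      unfolding P(1) Q(1) translation_cl[OF P(2-4) Q(2-4) p]
      by (rule cl_act_translations[OF P(2-4) Q(2-4) p])
  qed
  show "translation A B P (P \<cdot>\<^bsub>B\<^esub> a) = a" if "P \<in> rset B" "a \<in> fib (eproj B P)" for P a
    using that by (elim baer_cases) (simp add: translation_cl)
  show "continuous_map (fibre_product (rtop B) (eproj B) (rtop B) (eproj B)) (total A)
      (\<lambda>(P, Q). translation A B P Q)"
  proof -
    let ?p = "\<lambda>w. eproj E (fst w)"
    have "continuous_map (fibre_product W ?p W ?p) (total A)
        (\<lambda>z. translation A E (fst (fst z)) (fst (snd z))
          \<otimes>\<^bsub>fibre A (?p (fst z))\<^esub> translation A F (snd (fst z)) (snd (snd z)))"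
      by (intro continuous_fib_mult E.continuous_translation F.continuous_translation
            continuous_pair_coordinates[OF continuous_map_from_fibre_product(1)]
            continuous_pair_coordinates[OF continuous_map_from_fibre_product(2)])
        (auto simp: topspace_fibre_product)
    then have "continuous_map (fibre_product W ?p W ?p) (total A) (\<lambda>(v, w). translation A B (?q v) (?q w))"
      by (rule continuous_map_eq) (auto simp: topspace_fibre_product translation_cl)
    then show ?thesis
      by (intro continuous_map_descend_fibre_product[where r = ?p and p = ?p, OF q q])
        (auto simp: topspace_fibre_product)
  qed
  show "(P \<cdot>\<^bsub>B\<^esub> a) \<triangleleft>\<^bsub>B\<^esub> Q = (P \<triangleleft>\<^bsub>B\<^esub> Q) \<cdot>\<^bsub>B\<^esub> eta A (eproj B P) (eproj B Q) a"
    if "P \<in> rset B" "Q \<in> rset B" "a \<in> fib (eproj B P)" for P Q a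
    using that by (elim baer_cases) (simp add: E.op_act_left)
  show "P \<triangleleft>\<^bsub>B\<^esub> (Q \<cdot>\<^bsub>B\<^esub> b) = (P \<triangleleft>\<^bsub>B\<^esub> Q) \<cdot>\<^bsub>B\<^esub> tau A (eproj B P) (eproj B Q) b"
    if "P \<in> rset B" "Q \<in> rset B" "b \<in> fib (eproj B Q)" for P Q b
    using that by (elim baer_cases) (simp add: E.op_act_right)
qed

section \<open>Maps out of a Baer sum\<close>

definition lift :: "('e \<Rightarrow> 'f \<Rightarrow> 'g) \<Rightarrow> ('e \<times> 'f) set \<Rightarrow> 'g" where
  "lift \<beta> P = (case SOME w. w \<in> P of (e, f) \<Rightarrow> \<beta> e f)"

text \<open>It is enough that \<open>\<beta>\<close> is balanced at the single point \<open>e\<close>, as any representative of the class is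
  \<open>(e \<cdot> a, f')\<close> with \<open>f = f' \<cdot> a\<close>.\<close>

lemma lift_cl:
  assumes ef: "e \<in> rset E" "f \<in> rset F" "eproj E e = eproj F f"
    and balanced: "\<And>f' a. f' \<in> rset F \<Longrightarrow> eproj E e = eproj F f' \<Longrightarrow> a \<in> fib (eproj E e) \<Longrightarrow>
        \<beta> (e \<cdot>\<^bsub>E\<^esub> a) f' = \<beta> e (f' \<cdot>\<^bsub>F\<^esub> a)"
  shows "lift \<beta> (cl e f) = \<beta> e f"
proof -
  obtain e' f' where w: "(SOME w. w \<in> cl e f) = (e', f')" by fastforce
  have "(SOME w. w \<in> cl e f) \<in> cl e f" using cl_self[OF ef] by (rule someI)
  then have m: "(e', f') \<in> cl e f" unfolding w .
  note m' = cl_memD[OF m]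
  obtain a where a: "a \<in> fib (eproj E e)" "e' = e \<cdot>\<^bsub>E\<^esub> a" "f = f' \<cdot>\<^bsub>F\<^esub> a" "eproj E e' = eproj E e"
    using cl_eqD[OF m'(1-3) ef m'(4)] .
  have p: "eproj E e = eproj F f'" using m'(3) a(4) by simp
  have "lift \<beta> (cl e f) = \<beta> (e \<cdot>\<^bsub>E\<^esub> a) f'"
    unfolding lift_def w using a(2) by simp
  also have "\<dots> = \<beta> e (f' \<cdot>\<^bsub>F\<^esub> a)"
    by (rule balanced[OF m'(2) p a(1)])
  finally show ?thesis using a(3) by simp
qed

text \<open>The universal property of the Baer sum: a map on \<open>E \<times>\<^sub>X F\<close> that is equivariant in each variable and
  compatible with the rack operations identifies the Baer sum with its target.  Continuity is only
  asked along suitable pairs of local sections; this is what allows \<open>E\<close> to be a Baer sum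
  itself, where only sections of the form \<open>[s, t]\<close> are under control.\<close>

lemma baer_equivalentI:
  fixes G :: "('g, 'x, 'a) extension"
  assumes G: "central_extension X A G"
    and closed: "\<And>e f. e \<in> rset E \<Longrightarrow> f \<in> rset F \<Longrightarrow> eproj E e = eproj F f \<Longrightarrow> \<beta> e f \<in> rset G"
    and proj: "\<And>e f. e \<in> rset E \<Longrightarrow> f \<in> rset F \<Longrightarrow> eproj E e = eproj F f \<Longrightarrow> eproj G (\<beta> e f) = eproj E e"
    and left: "\<And>e f a. e \<in> rset E \<Longrightarrow> f \<in> rset F \<Longrightarrow> eproj E e = eproj F f \<Longrightarrow> a \<in> fib (eproj E e) \<Longrightarrow>
        \<beta> (e \<cdot>\<^bsub>E\<^esub> a) f = \<beta> e f \<cdot>\<^bsub>G\<^esub> a"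
    and right: "\<And>e f a. e \<in> rset E \<Longrightarrow> f \<in> rset F \<Longrightarrow> eproj E e = eproj F f \<Longrightarrow> a \<in> fib (eproj E e) \<Longrightarrow>
        \<beta> e (f \<cdot>\<^bsub>F\<^esub> a) = \<beta> e f \<cdot>\<^bsub>G\<^esub> a"
    and op: "\<And>e f d g. e \<in> rset E \<Longrightarrow> f \<in> rset F \<Longrightarrow> eproj E e = eproj F f \<Longrightarrow>
        d \<in> rset E \<Longrightarrow> g \<in> rset F \<Longrightarrow> eproj E d = eproj F g \<Longrightarrow>
        \<beta> (e \<triangleleft>\<^bsub>E\<^esub> d) (f \<triangleleft>\<^bsub>F\<^esub> g) = \<beta> e f \<triangleleft>\<^bsub>G\<^esub> \<beta> d g"
    and sec: "\<And>x. x \<in> rset X \<Longrightarrow> \<exists>U s t. openin (rtop X) U \<and> x \<in> U \<and>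
        continuous_map (subtopology (rtop X) U) (rtop E) s \<and>
        continuous_map (subtopology (rtop X) U) (rtop F) t \<and>
        continuous_map (subtopology (rtop X) U) (rtop G) (\<lambda>u. \<beta> (s u) (t u)) \<and>
        (\<forall>u\<in>U. s u \<in> rset E \<and> t u \<in> rset F \<and> eproj E (s u) = u \<and> eproj F (t u) = u)"
  shows "ext_equivalent A B G"
proof -
  let ?\<phi> = "lift \<beta>"
  have phi: "?\<phi> (cl e f) = \<beta> e f" if ef: "e \<in> rset E" "f \<in> rset F" "eproj E e = eproj F f" for e f
    by (rule lift_cl[OF ef]) (simp add: left right ef(1))
  show ?thesis
  proof (rule ext_equivalentI[where \<phi> = ?\<phi>, OF central_baer_sum G])
    show "?\<phi> P \<in> rset G" if "P \<in> rset B" for P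
      using that by (elim baer_cases) (simp add: phi closed)
    show "eproj G (?\<phi> P) = eproj B P" if "P \<in> rset B" for P
      using that by (elim baer_cases) (simp add: phi proj)
    show "?\<phi> (P \<cdot>\<^bsub>B\<^esub> a) = ?\<phi> P \<cdot>\<^bsub>G\<^esub> a" if "P \<in> rset B" "a \<in> fib (eproj B P)" for P a
      using that by (elim baer_cases) (simp add: phi left)
    show "?\<phi> (P \<triangleleft>\<^bsub>B\<^esub> Q) = ?\<phi> P \<triangleleft>\<^bsub>G\<^esub> ?\<phi> Q" if "P \<in> rset B" "Q \<in> rset B" for P Q
      using that by (elim baer_cases) (simp add: phi op)
    fix x assume x: "x \<in> rset X"
    obtain U s t where U: "openin (rtop X) U" "x \<in> U"
      and s: "continuous_map (subtopology (rtop X) U) (rtop E) s"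
      and t: "continuous_map (subtopology (rtop X) U) (rtop F) t"
      and st: "continuous_map (subtopology (rtop X) U) (rtop G) (\<lambda>u. \<beta> (s u) (t u))"
        "\<forall>u\<in>U. s u \<in> rset E \<and> t u \<in> rset F \<and> eproj E (s u) = u \<and> eproj F (t u) = u"
      using sec[OF x] by blast
    have "continuous_map (subtopology (rtop X) U) (rtop B) (\<lambda>u. cl (s u) (t u))"
      by (rule continuous_cl[OF s t]) (use st(2) in auto)
    moreover have "continuous_map (subtopology (rtop X) U) (rtop G) (\<lambda>u. ?\<phi> (cl (s u) (t u)))"
      by (rule continuous_map_eq[OF st(1)]) (use st(2) phi in auto)
    ultimately show "\<exists>U s. openin (rtop X) U \<and> x \<in> U \<and> continuous_map (subtopology (rtop X) U) (rtop B) s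
        \<and> (\<forall>u\<in>U. eproj B (s u) = u) \<and> continuous_map (subtopology (rtop X) U) (rtop G) (\<lambda>u. ?\<phi> (s u))"
      using U st(2) by (intro exI[of _ U] exI[of _ "\<lambda>u. cl (s u) (t u)"]) simp
  qed
qed

lemma baer_sections_of_continuous:
  assumes \<beta>: "continuous_map W (rtop G) (\<lambda>(e, f). \<beta> e f)" and x: "x \<in> rset X"
  shows "\<exists>U s t. openin (rtop X) U \<and> x \<in> U \<and>
    continuous_map (subtopology (rtop X) U) (rtop E) s \<and>
    continuous_map (subtopology (rtop X) U) (rtop F) t \<and>
    continuous_map (subtopology (rtop X) U) (rtop G) (\<lambda>u. \<beta> (s u) (t u)) \<and>
    (\<forall>u\<in>U. s u \<in> rset E \<and> t u \<in> rset F \<and> eproj E (s u) = u \<and> eproj F (t u) = u)"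
proof -
  obtain U s t where U: "openin (rtop X) U" "x \<in> U"
    and s: "continuous_map (subtopology (rtop X) U) (rtop E) s"
    and t: "continuous_map (subtopology (rtop X) U) (rtop F) t"
    and st: "\<forall>u\<in>U. s u \<in> rset E \<and> t u \<in> rset F \<and> eproj E (s u) = u \<and> eproj F (t u) = u"
    using baer_local_section[OF x] by blast
  have "continuous_map (subtopology (rtop X) U) (rtop G) (\<lambda>u. \<beta> (s u) (t u))"
    by (rule continuous_map_compose_fibre_product[OF \<beta> s t]) (use st in auto)
  then show ?thesis using U s t st by blast
qed

end

section \<open>The trivial and the opposite extension\<close>

context module_over_rack
begin

abbreviation T :: "('a \<times> 'x, 'x, 'a) extension" where
  "T \<equiv> trivial_ext X A"

lemma rset_trivial: "(a, x) \<in> rset T \<longleftrightarrow> x \<in> rset X \<and> a \<in> fib x"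
  unfolding trivial_ext_def using fib_mem(1) by auto

lemma trivial_simps [simp]:
  "(a, x) \<triangleleft>\<^bsub>T\<^esub> (b, y) = (eta A x y a \<otimes>\<^bsub>fibre A (x \<triangleleft>\<^bsub>X\<^esub> y)\<^esub> tau A x y b, x \<triangleleft>\<^bsub>X\<^esub> y)"
  "eproj T (a, x) = x"
  "(a, x) \<cdot>\<^bsub>T\<^esub> b = (a \<otimes>\<^bsub>fibre A x\<^esub> b, x)"
  by (simp_all add: trivial_ext_def)

lemma continuous_map_into_trivial:
  assumes "continuous_map Z (total A) f" "continuous_map Z (rtop X) g"
    and "\<And>z. z \<in> topspace Z \<Longrightarrow> f z \<in> fib (g z)"
  shows "continuous_map Z (rtop T) (\<lambda>z. (f z, g z))"
  unfolding trivial_ext_def using assms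
  by (auto simp: continuous_map_in_subtopology continuous_map_paired)

lemma continuous_trivial_coordinates:
  assumes "continuous_map Z (rtop T) h"
  shows "continuous_map Z (total A) (\<lambda>z. fst (h z))" "continuous_map Z (rtop X) (\<lambda>z. snd (h z))"
proof -
  have "continuous_map Z (prod_topology (total A) (rtop X)) h"
    using assms by (simp add: trivial_ext_def continuous_map_in_subtopology)
  then show "continuous_map Z (total A) (\<lambda>z. fst (h z))" "continuous_map Z (rtop X) (\<lambda>z. snd (h z))"
    using continuous_map_compose[OF _ continuous_map_fst] continuous_map_compose[OF _ continuous_map_snd]
    unfolding o_def by blast+
qed

text \<open>Expanding both sides gives terms in \<open>a\<close>, in \<open>b\<close> and in \<open>c\<close>.  They agree by the compatibility of
  \<open>eta\<close> with itself, by that of \<open>eta\<close> with \<open>tau\<close>, and by the formula for \<open>tau\<close> at a product.\<close>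

lemma trivial_distrib:
  assumes x: "x \<in> rset X" "a \<in> fib x" and y: "y \<in> rset X" "b \<in> fib y" and z: "z \<in> rset X" "c \<in> fib z"
  shows "((a, x) \<triangleleft>\<^bsub>T\<^esub> (b, y)) \<triangleleft>\<^bsub>T\<^esub> (c, z) = ((a, x) \<triangleleft>\<^bsub>T\<^esub> (c, z)) \<triangleleft>\<^bsub>T\<^esub> ((b, y) \<triangleleft>\<^bsub>T\<^esub> (c, z))"
proof -
  let ?u = "x \<triangleleft>\<^bsub>X\<^esub> z" and ?v = "y \<triangleleft>\<^bsub>X\<^esub> z"
  let ?w = "?u \<triangleleft>\<^bsub>X\<^esub> ?v"
  let ?H = "fibre A ?w"
  have w: "(x \<triangleleft>\<^bsub>X\<^esub> y) \<triangleleft>\<^bsub>X\<^esub> z = ?w" by (rule base_distrib[OF x(1) y(1) z(1)])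
  have u: "?u \<in> rset X" "?v \<in> rset X" "x \<triangleleft>\<^bsub>X\<^esub> y \<in> rset X" "?w \<in> rset X" using x y z by simp_all
  let ?a = "eta A ?u ?v (eta A x z a)" and ?b = "tau A ?u ?v (eta A y z b)"
    and ?c = "eta A ?u ?v (tau A x z c)" and ?d = "tau A ?u ?v (tau A y z c)"
  have cl: "?a \<in> fib ?w" "?b \<in> fib ?w" "?c \<in> fib ?w" "?d \<in> fib ?w"
    using u x y z by simp_all
  have "eta A (x \<triangleleft>\<^bsub>X\<^esub> y) z (eta A x y a \<otimes>\<^bsub>fibre A (x \<triangleleft>\<^bsub>X\<^esub> y)\<^esub> tau A x y b) \<otimes>\<^bsub>?H\<^esub> tau A (x \<triangleleft>\<^bsub>X\<^esub> y) z c
      = (?a \<otimes>\<^bsub>?H\<^esub> ?b) \<otimes>\<^bsub>?H\<^esub> (?c \<otimes>\<^bsub>?H\<^esub> ?d)"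
    using eta_mult[OF u(3) z(1), of "eta A x y a" "tau A x y b"] x y z w eta_eta[of x y z a] eta_tau[of x y z b]
      tau_tau[of x y z c] by simp
  also have "\<dots> = (?a \<otimes>\<^bsub>?H\<^esub> ?c) \<otimes>\<^bsub>?H\<^esub> (?b \<otimes>\<^bsub>?H\<^esub> ?d)"
    using u(4) cl by (simp add: fib_ac)
  also have "\<dots> = eta A ?u ?v (eta A x z a \<otimes>\<^bsub>fibre A ?u\<^esub> tau A x z c)
      \<otimes>\<^bsub>?H\<^esub> tau A ?u ?v (eta A y z b \<otimes>\<^bsub>fibre A ?v\<^esub> tau A y z c)"
    using eta_mult[OF u(1,2)] tau_mult[OF u(1,2)] x y z by simp
  finally show ?thesis using w by simp
qed

lemma central_trivial: "central_extension X A T"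
proof (rule central_extensionI[where t = "\<lambda>(a, x) (b, y). inv\<^bsub>fibre A x\<^esub> a \<otimes>\<^bsub>fibre A x\<^esub> b"])
  note c = continuous_trivial_coordinates
  have id: "continuous_map (rtop T) (rtop T) (\<lambda>z. z)" by simp
  have fst_T: "continuous_map (prod_topology (rtop T) (rtop T)) (rtop T) fst"
    and snd_T: "continuous_map (prod_topology (rtop T) (rtop T)) (rtop T) snd"
    by (rule continuous_map_fst continuous_map_snd)+
  have "continuous_map (prod_topology (rtop T) (rtop T)) (rtop T)
     (\<lambda>z. (eta A (snd (fst z)) (snd (snd z)) (fst (fst z))
          \<otimes>\<^bsub>fibre A (snd (fst z) \<triangleleft>\<^bsub>X\<^esub> snd (snd z))\<^esub> tau A (snd (fst z)) (snd (snd z)) (fst (snd z)),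
        snd (fst z) \<triangleleft>\<^bsub>X\<^esub> snd (snd z)))"
    by (intro continuous_map_into_trivial continuous_fib_mult continuous_eta continuous_tau
          continuous_map_compose_prod[OF continuous_base_op] c fst_T snd_T)
      (auto simp: rset_trivial fib_mem)
  then show "continuous_map (prod_topology (rtop T) (rtop T)) (rtop T) (\<lambda>(e, f). e \<triangleleft>\<^bsub>T\<^esub> f)"
    by (rule continuous_map_eq) auto
  show "(e \<triangleleft>\<^bsub>T\<^esub> f) \<triangleleft>\<^bsub>T\<^esub> g = (e \<triangleleft>\<^bsub>T\<^esub> g) \<triangleleft>\<^bsub>T\<^esub> (f \<triangleleft>\<^bsub>T\<^esub> g)"
    if "e \<in> rset T" "f \<in> rset T" "g \<in> rset T" for e f g
    using that trivial_distrib by (cases e; cases f; cases g) (simp only: rset_trivial)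
  show "continuous_map (rtop T) (rtop X) (eproj T)"
    by (rule continuous_map_eq[OF c(2)[OF id]]) (auto simp: trivial_ext_def)
  show "eproj T (e \<triangleleft>\<^bsub>T\<^esub> f) = eproj T e \<triangleleft>\<^bsub>X\<^esub> eproj T f" for e f
    by (cases e; cases f) simp
  show "continuous_local_sections (rtop T) (rtop X) (eproj T)"
    unfolding continuous_local_sections_def
  proof
    fix x assume x: "x \<in> rset X"
    have "continuous_map (rtop X) (rtop T) (\<lambda>x. (\<one>\<^bsub>fibre A x\<^esub>, x))"
      by (rule continuous_map_into_trivial[OF continuous_zero_section]) simp_all
    then show "\<exists>U s. openin (rtop X) U \<and> x \<in> U \<and> continuous_map (subtopology (rtop X) U) (rtop T) s
        \<and> (\<forall>u\<in>U. eproj T (s u) = u)"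
      using x by (intro exI[of _ "rset X"] exI[of _ "\<lambda>x. (\<one>\<^bsub>fibre A x\<^esub>, x)"]) simp
  qed
  let ?Z = "fibre_product (rtop T) (eproj T) (total A) (bproj A)"
  have "continuous_map ?Z (rtop T)
      (\<lambda>z. (fst (fst z) \<otimes>\<^bsub>fibre A (snd (fst z))\<^esub> snd z, snd (fst z)))"
    by (intro continuous_map_into_trivial continuous_fib_mult c continuous_map_from_fibre_product)
      (auto simp: topspace_fibre_product rset_trivial fib_mem fib_bproj)
  then show "continuous_map ?Z (rtop T) (\<lambda>(e, a). e \<cdot>\<^bsub>T\<^esub> a)"
    by (rule continuous_map_eq) auto
  let ?Y = "fibre_product (rtop T) (eproj T) (rtop T) (eproj T)"
  have "continuous_map ?Y (total A)
      (\<lambda>z. inv\<^bsub>fibre A (snd (fst z))\<^esub> fst (fst z) \<otimes>\<^bsub>fibre A (snd (fst z))\<^esub> fst (snd z))"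
    by (intro continuous_fib_mult continuous_fib_inv c continuous_map_from_fibre_product)
      (auto simp: topspace_fibre_product rset_trivial fib_mem)
  then show "continuous_map ?Y (total A)
      (\<lambda>(e, e'). (\<lambda>(a, x) (b, y). inv\<^bsub>fibre A x\<^esub> a \<otimes>\<^bsub>fibre A x\<^esub> b) e e')"
    by (rule continuous_map_eq) auto
  show "e \<cdot>\<^bsub>T\<^esub> \<one>\<^bsub>fibre A (eproj T e)\<^esub> = e" if "e \<in> rset T" for e
    using that by (cases e) (simp add: rset_trivial)
  show "eproj T (e \<cdot>\<^bsub>T\<^esub> a) = eproj T e" for e a
    by (cases e) simp
  show "e \<cdot>\<^bsub>T\<^esub> (a \<otimes>\<^bsub>fibre A (eproj T e)\<^esub> b) = e \<cdot>\<^bsub>T\<^esub> a \<cdot>\<^bsub>T\<^esub> b"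
    if "e \<in> rset T" "a \<in> fib (eproj T e)" "b \<in> fib (eproj T e)" for e a b
    using that by (cases e) (simp add: rset_trivial fib_assoc)
  show "(\<lambda>(a, x) (b, y). inv\<^bsub>fibre A x\<^esub> a \<otimes>\<^bsub>fibre A x\<^esub> b) e e' \<in> fib (eproj T e)"
    "e \<cdot>\<^bsub>T\<^esub> (\<lambda>(a, x) (b, y). inv\<^bsub>fibre A x\<^esub> a \<otimes>\<^bsub>fibre A x\<^esub> b) e e' = e'"
    if "e \<in> rset T" "e' \<in> rset T" "eproj T e = eproj T e'" for e e'
    using that by (cases e; cases e'; simp add: rset_trivial)+
  show "(\<lambda>(a, x) (b, y). inv\<^bsub>fibre A x\<^esub> a \<otimes>\<^bsub>fibre A x\<^esub> b) e (e \<cdot>\<^bsub>T\<^esub> a) = a"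
    if "e \<in> rset T" "a \<in> fib (eproj T e)" for e a
    using that by (cases e) (simp add: rset_trivial)
  show "(e \<cdot>\<^bsub>T\<^esub> a) \<triangleleft>\<^bsub>T\<^esub> f = (e \<triangleleft>\<^bsub>T\<^esub> f) \<cdot>\<^bsub>T\<^esub> eta A (eproj T e) (eproj T f) a"
    if "e \<in> rset T" "f \<in> rset T" "a \<in> fib (eproj T e)" for e f a
    using that by (cases e; cases f) (simp add: rset_trivial eta_mult fib_ac)
  show "e \<triangleleft>\<^bsub>T\<^esub> (f \<cdot>\<^bsub>T\<^esub> b) = (e \<triangleleft>\<^bsub>T\<^esub> f) \<cdot>\<^bsub>T\<^esub> tau A (eproj T e) (eproj T f) b"
    if "e \<in> rset T" "f \<in> rset T" "b \<in> fib (eproj T f)" for e f b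
    using that by (cases e; cases f) (simp add: rset_trivial tau_mult fib_ac)
qed

end

context central_ext
begin

lemma opposite_simps [simp]:
  "rtop (opposite A E) = rtop E" "rop (opposite A E) = rop E" "eproj (opposite A E) = eproj E"
  "act (opposite A E) e a = e \<cdot>\<^bsub>E\<^esub> inv\<^bsub>fibre A (eproj E e)\<^esub> a"
  by (simp_all add: opposite_def)

text \<open>Inversion is an automorphism of the abelian groups \<open>fib x\<close> that commutes with \<open>eta\<close> and \<open>tau\<close>, so
  the action may be twisted by it.\<close>

lemma central_opposite: "central_extension X A (opposite A E)"
proof (rule central_extensionI[where t = "\<lambda>e e'. inv\<^bsub>fibre A (eproj E e)\<^esub> translation A E e e'"],
    unfold opposite_simps)
  show "continuous_map (prod_topology (rtop E) (rtop E)) (rtop E) (\<lambda>(e, f). e \<triangleleft>\<^bsub>E\<^esub> f)"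
    using topological_rack_ext by (simp add: topological_rack_def)
  let ?Z = "fibre_product (rtop E) (eproj E) (total A) (bproj A)"
  have "continuous_map ?Z (rtop E) (\<lambda>z. fst z \<cdot>\<^bsub>E\<^esub> inv\<^bsub>fibre A (eproj E (fst z))\<^esub> snd z)"
    by (intro continuous_act continuous_fib_inv continuous_map_from_fibre_product)
      (auto simp: topspace_fibre_product fib_bproj bproj_closed)
  then show "continuous_map ?Z (rtop E) (\<lambda>(e, a). e \<cdot>\<^bsub>E\<^esub> inv\<^bsub>fibre A (eproj E e)\<^esub> a)"
    by (simp add: case_prod_unfold)
  let ?Y = "fibre_product (rtop E) (eproj E) (rtop E) (eproj E)"
  have "continuous_map ?Y (total A) (\<lambda>z. inv\<^bsub>fibre A (eproj E (fst z))\<^esub> translation A E (fst z) (snd z))"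
    by (intro continuous_translation continuous_fib_inv continuous_map_from_fibre_product)
      (auto simp: topspace_fibre_product)
  then show "continuous_map ?Y (total A) (\<lambda>(e, e'). inv\<^bsub>fibre A (eproj E e)\<^esub> translation A E e e')"
    by (simp add: case_prod_unfold)
  show "e \<cdot>\<^bsub>E\<^esub> inv\<^bsub>fibre A (eproj E e)\<^esub> \<one>\<^bsub>fibre A (eproj E e)\<^esub> = e" if "e \<in> rset E" for e
    using that group.is_monoid[OF fib_group[OF proj_closed[OF that]]] by (simp add: monoid.inv_one)
  show "e \<cdot>\<^bsub>E\<^esub> inv\<^bsub>fibre A (eproj E e)\<^esub> (a \<otimes>\<^bsub>fibre A (eproj E e)\<^esub> b) =
      (e \<cdot>\<^bsub>E\<^esub> inv\<^bsub>fibre A (eproj E e)\<^esub> a) \<cdot>\<^bsub>E\<^esub>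
        inv\<^bsub>fibre A (eproj E (e \<cdot>\<^bsub>E\<^esub> inv\<^bsub>fibre A (eproj E e)\<^esub> a))\<^esub> b"
    if "e \<in> rset E" "a \<in> fib (eproj E e)" "b \<in> fib (eproj E e)" for e a b
    using that comm_group.inv_mult[OF fib_comm_group[OF proj_closed[OF that(1)]] that(2,3)]
    by (simp add: act_act)
qed (use local_sections continuous_proj fib_group group.inv_inv in
    \<open>auto simp: op_act_left op_act_right eta_inv tau_inv intro: op_distrib\<close>)

end

section \<open>The group laws up to equivalence\<close>

context module_over_rack
begin

lemma central_ext_pairI:
  "central_extension X A E \<Longrightarrow> central_extension X A F \<Longrightarrow> central_ext_pair X A E F"
  by unfold_locales

lemma central_baer:
  "central_extension X A E \<Longrightarrow> central_extension X A F \<Longrightarrow> central_extension X A (baer_sum A E F)"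
  by (rule central_ext_pair.central_baer_sum[OF central_ext_pairI])

lemma baer_sum_cong:
  fixes E :: "('e, 'x, 'a) extension" and F :: "('f, 'x, 'a) extension"
    and E' :: "('e2, 'x, 'a) extension" and F' :: "('f2, 'x, 'a) extension"
  assumes central: "central_extension X A E" "central_extension X A F"
      "central_extension X A E'" "central_extension X A F'"
    and eq: "ext_equivalent A E E'" "ext_equivalent A F F'"
  shows "ext_equivalent A (baer_sum A E F) (baer_sum A E' F')"
proof -
  interpret P: central_ext_pair X A E F by (rule central_ext_pairI) (rule central)+
  interpret P': central_ext_pair X A E' F' by (rule central_ext_pairI) (rule central)+
  obtain \<phi> \<psi> where "ext_morphism A E E' \<phi>" "ext_morphism A F F' \<psi>"
    using eq unfolding ext_equivalent_def by blast
  then have cont: "continuous_map (rtop E) (rtop E') \<phi>" "continuous_map (rtop F) (rtop F') \<psi>"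
    and op: "\<And>e e'. e \<in> rset E \<Longrightarrow> e' \<in> rset E \<Longrightarrow> \<phi> (e \<triangleleft>\<^bsub>E\<^esub> e') = \<phi> e \<triangleleft>\<^bsub>E'\<^esub> \<phi> e'"
      "\<And>f f'. f \<in> rset F \<Longrightarrow> f' \<in> rset F \<Longrightarrow> \<psi> (f \<triangleleft>\<^bsub>F\<^esub> f') = \<psi> f \<triangleleft>\<^bsub>F'\<^esub> \<psi> f'"
    and proj: "\<And>e. e \<in> rset E \<Longrightarrow> eproj E' (\<phi> e) = eproj E e"
      "\<And>f. f \<in> rset F \<Longrightarrow> eproj F' (\<psi> f) = eproj F f"
    and act: "\<And>e a. e \<in> rset E \<Longrightarrow> a \<in> fib (eproj E e) \<Longrightarrow> \<phi> (e \<cdot>\<^bsub>E\<^esub> a) = \<phi> e \<cdot>\<^bsub>E'\<^esub> a"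
      "\<And>f a. f \<in> rset F \<Longrightarrow> a \<in> fib (eproj F f) \<Longrightarrow> \<psi> (f \<cdot>\<^bsub>F\<^esub> a) = \<psi> f \<cdot>\<^bsub>F'\<^esub> a"
    unfolding ext_morphism_def rack_hom_def by blast+
  have closed: "\<phi> e \<in> rset E'" if "e \<in> rset E" for e
    using continuous_map_image_subset_topspace[OF cont(1)] that by blast
  have closed': "\<psi> f \<in> rset F'" if "f \<in> rset F" for f
    using continuous_map_image_subset_topspace[OF cont(2)] that by blast
  note simps = closed closed' op proj act
  have c: "continuous_map P.W (rtop P'.B) (\<lambda>w. P'.cl (\<phi> (fst w)) (\<psi> (snd w)))"
    by (intro P'.continuous_cl)
      (use continuous_map_compose[OF continuous_map_from_fibre_product(1) cont(1)]
        continuous_map_compose[OF continuous_map_from_fibre_product(2) cont(2)]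
       in \<open>simp_all add: o_def P.mem_W proj\<close>)
  show ?thesis
  proof (rule P.baer_equivalentI[where \<beta> = "\<lambda>e f. P'.cl (\<phi> e) (\<psi> f)", OF P'.central_baer_sum])
    fix e f a assume ef: "e \<in> rset E" "f \<in> rset F" "eproj E e = eproj F f" "a \<in> fib (eproj E e)"
    have "P'.cl (\<phi> e \<cdot>\<^bsub>E'\<^esub> a) (\<psi> f) = P'.cl (\<phi> e) (\<psi> f \<cdot>\<^bsub>F'\<^esub> a)"
      by (rule P'.cl_move) (use ef simps in simp_all)
    then show "P'.cl (\<phi> e) (\<psi> (f \<cdot>\<^bsub>F\<^esub> a)) = P'.cl (\<phi> e) (\<psi> f) \<cdot>\<^bsub>P'.B\<^esub> a"
      using ef by (simp add: simps)
  next
    fix x assume "x \<in> rset X"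
    with c show "\<exists>U s t. openin (rtop X) U \<and> x \<in> U \<and>
        continuous_map (subtopology (rtop X) U) (rtop E) s \<and>
        continuous_map (subtopology (rtop X) U) (rtop F) t \<and>
        continuous_map (subtopology (rtop X) U) (rtop P'.B) (\<lambda>u. P'.cl (\<phi> (s u)) (\<psi> (t u))) \<and>
        (\<forall>u\<in>U. s u \<in> rset E \<and> t u \<in> rset F \<and> eproj E (s u) = u \<and> eproj F (t u) = u)"
      by (intro P.baer_sections_of_continuous) (simp add: case_prod_unfold)
  qed (simp_all add: simps)
qed

lemma baer_sum_commute:
  fixes E :: "('e, 'x, 'a) extension" and F :: "('f, 'x, 'a) extension"
  assumes central: "central_extension X A E" "central_extension X A F"
  shows "ext_equivalent A (baer_sum A E F) (baer_sum A F E)"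
proof -
  interpret P: central_ext_pair X A E F by (rule central_ext_pairI) (rule central)+
  interpret P': central_ext_pair X A F E by (rule central_ext_pairI) (rule central)+
  have c: "continuous_map P.W (rtop P'.B) (\<lambda>w. P'.cl (snd w) (fst w))"
    by (intro P'.continuous_cl continuous_map_from_fibre_product) (simp add: P.mem_W)
  show ?thesis
  proof (rule P.baer_equivalentI[where \<beta> = "\<lambda>e f. P'.cl f e", OF P'.central_baer_sum])
    fix e f a assume ef: "e \<in> rset E" "f \<in> rset F" "eproj E e = eproj F f" "a \<in> fib (eproj E e)"
    have "P'.cl (f \<cdot>\<^bsub>F\<^esub> a) e = P'.cl f (e \<cdot>\<^bsub>E\<^esub> a)"
      by (rule P'.cl_move) (use ef in simp_all)
    then show "P'.cl f (e \<cdot>\<^bsub>E\<^esub> a) = P'.cl f e \<cdot>\<^bsub>P'.B\<^esub> a"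
      using ef by simp
  next
    fix x assume "x \<in> rset X"
    with c show "\<exists>U s t. openin (rtop X) U \<and> x \<in> U \<and>
        continuous_map (subtopology (rtop X) U) (rtop E) s \<and>
        continuous_map (subtopology (rtop X) U) (rtop F) t \<and>
        continuous_map (subtopology (rtop X) U) (rtop P'.B) (\<lambda>u. P'.cl (t u) (s u)) \<and>
        (\<forall>u\<in>U. s u \<in> rset E \<and> t u \<in> rset F \<and> eproj E (s u) = u \<and> eproj F (t u) = u)"
      by (intro P.baer_sections_of_continuous) (simp add: case_prod_unfold)
  qed simp_all
qed

text \<open>The map \<open>[[e, f], g] \<mapsto> [e, [f, g]]\<close> is bi-equivariant as a function of \<open>[e, f]\<close> and \<open>g\<close>, and it is
  continuous along the section \<open>[s, t]\<close> made of local sections of \<open>E\<close> and \<open>F\<close>.\<close>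

lemma baer_sum_assoc:
  fixes E :: "('e, 'x, 'a) extension" and F :: "('f, 'x, 'a) extension" and G :: "('g, 'x, 'a) extension"
  assumes central: "central_extension X A E" "central_extension X A F" "central_extension X A G"
  shows "ext_equivalent A (baer_sum A (baer_sum A E F) G) (baer_sum A E (baer_sum A F G))"
proof -
  interpret P: central_ext_pair X A E F by (rule central_ext_pairI) (rule central)+
  interpret Q: central_ext_pair X A F G by (rule central_ext_pairI) (rule central)+
  interpret PG: central_ext_pair X A P.B G by (rule central_ext_pairI) (rule P.central_baer_sum central)+
  interpret EQ: central_ext_pair X A E Q.B by (rule central_ext_pairI) (rule Q.central_baer_sum central)+
  define \<beta> where "\<beta> p g = P.lift (\<lambda>e f. EQ.cl e (Q.cl f g)) p" for p g
  have beta: "\<beta> (P.cl e f) g = EQ.cl e (Q.cl f g)"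
    if "e \<in> rset E" "f \<in> rset F" "eproj E e = eproj F f" "g \<in> rset G" "eproj F f = eproj G g" for e f g
    unfolding \<beta>_def
  proof (rule P.lift_cl[OF that(1-3)])
    fix f' a assume f': "f' \<in> rset F" "eproj E e = eproj F f'" "a \<in> fib (eproj E e)"
    have "EQ.cl (e \<cdot>\<^bsub>E\<^esub> a) (Q.cl f' g) = EQ.cl e (Q.cl f' g \<cdot>\<^bsub>Q.B\<^esub> a)"
      by (rule EQ.cl_move) (use that f' in simp_all)
    then show "EQ.cl (e \<cdot>\<^bsub>E\<^esub> a) (Q.cl f' g) = EQ.cl e (Q.cl (f' \<cdot>\<^bsub>F\<^esub> a) g)"
      using that f' by simp
  qed
  show ?thesis
  proof (rule PG.baer_equivalentI[where \<beta> = \<beta>, OF EQ.central_baer_sum])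
    fix p g assume pg: "p \<in> rset P.B" "g \<in> rset G" "eproj P.B p = eproj G g"
    obtain e f where p: "p = P.cl e f" "e \<in> rset E" "f \<in> rset F" "eproj E e = eproj F f"
      using pg(1) by (rule P.baer_cases)
    have g: "eproj F f = eproj G g" using pg(3) p by simp
    show "\<beta> p g \<in> rset EQ.B" "eproj EQ.B (\<beta> p g) = eproj P.B p"
      using p g pg(2) by (simp_all add: beta)
    fix a assume a: "a \<in> fib (eproj P.B p)"
    then show "\<beta> (p \<cdot>\<^bsub>P.B\<^esub> a) g = \<beta> p g \<cdot>\<^bsub>EQ.B\<^esub> a"
      using p g pg(2) by (simp add: beta)
    have a': "a \<in> fib (eproj E e)" using a p by simp
    have "EQ.cl (e \<cdot>\<^bsub>E\<^esub> a) (Q.cl f g) = EQ.cl e (Q.cl f g \<cdot>\<^bsub>Q.B\<^esub> a)"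
      by (rule EQ.cl_move) (use p g pg(2) a' in simp_all)
    moreover have "Q.cl (f \<cdot>\<^bsub>F\<^esub> a) g = Q.cl f (g \<cdot>\<^bsub>G\<^esub> a)"
      by (rule Q.cl_move) (use p g pg(2) a' in simp_all)
    ultimately show "\<beta> p (g \<cdot>\<^bsub>G\<^esub> a) = \<beta> p g \<cdot>\<^bsub>EQ.B\<^esub> a"
      using p g pg(2) a' by (simp add: beta)
  next
    fix p g q h assume pg: "p \<in> rset P.B" "g \<in> rset G" "eproj P.B p = eproj G g"
      and qh: "q \<in> rset P.B" "h \<in> rset G" "eproj P.B q = eproj G h"
    obtain e f where p: "p = P.cl e f" "e \<in> rset E" "f \<in> rset F" "eproj E e = eproj F f"
      using pg(1) by (rule P.baer_cases)
    obtain e' f' where q: "q = P.cl e' f'" "e' \<in> rset E" "f' \<in> rset F" "eproj E e' = eproj F f'"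
      using qh(1) by (rule P.baer_cases)
    have "eproj F f = eproj G g" "eproj F f' = eproj G h"
      using pg(3) qh(3) p q by simp_all
    then show "\<beta> (p \<triangleleft>\<^bsub>P.B\<^esub> q) (g \<triangleleft>\<^bsub>G\<^esub> h) = \<beta> p g \<triangleleft>\<^bsub>EQ.B\<^esub> \<beta> q h"
      using p q pg(2) qh(2) by (simp add: beta)
  next
    fix x assume x: "x \<in> rset X"
    obtain U s t where U: "openin (rtop X) U" "x \<in> U"
      and s: "continuous_map (subtopology (rtop X) U) (rtop E) s"
      and t: "continuous_map (subtopology (rtop X) U) (rtop F) t"
      and st: "\<forall>u\<in>U. s u \<in> rset E \<and> t u \<in> rset F \<and> eproj E (s u) = u \<and> eproj F (t u) = u"
      using P.baer_local_section[OF x] by blast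
    obtain V r where V: "openin (rtop X) V" "x \<in> V"
      and r: "continuous_map (subtopology (rtop X) V) (rtop G) r" "\<And>u. u \<in> V \<Longrightarrow> eproj G (r u) = u"
      using Q.F.local_section[OF x] by blast
    let ?S = "subtopology (rtop X) (U \<inter> V)"
    have UV: "openin (rtop X) (U \<inter> V)" using U(1) V(1) by blast
    have s': "continuous_map ?S (rtop E) s" and t': "continuous_map ?S (rtop F) t"
      and r': "continuous_map ?S (rtop G) r"
      using continuous_map_from_subtopology_mono[OF s] continuous_map_from_subtopology_mono[OF t]
        continuous_map_from_subtopology_mono[OF r(1)] by auto
    have top: "topspace ?S = U \<inter> V"
      using UV openin_subset by fastforce
    have rG: "r u \<in> rset G" if "u \<in> U \<inter> V" for u
      using continuous_map_image_subset_topspace[OF r'] top that by auto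
    have "continuous_map ?S (rtop EQ.B) (\<lambda>u. EQ.cl (s u) (Q.cl (t u) (r u)))"
      by (intro EQ.continuous_cl Q.continuous_cl s' t' r') (use st r(2) rG top in auto)
    then have "continuous_map ?S (rtop EQ.B) (\<lambda>u. \<beta> (P.cl (s u) (t u)) (r u))"
      by (rule continuous_map_eq) (use beta st r(2) rG top in auto)
    moreover have "continuous_map ?S (rtop P.B) (\<lambda>u. P.cl (s u) (t u))"
      by (intro P.continuous_cl s' t') (use st top in auto)
    ultimately show "\<exists>U s t. openin (rtop X) U \<and> x \<in> U \<and>
        continuous_map (subtopology (rtop X) U) (rtop P.B) s \<and>
        continuous_map (subtopology (rtop X) U) (rtop G) t \<and>
        continuous_map (subtopology (rtop X) U) (rtop EQ.B) (\<lambda>u. \<beta> (s u) (t u)) \<and>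
        (\<forall>u\<in>U. s u \<in> rset P.B \<and> t u \<in> rset G \<and> eproj P.B (s u) = u \<and> eproj G (t u) = u)"
      using UV U(2) V(2) r' st r(2) rG
      by (intro exI[of _ "U \<inter> V"] exI[of _ "\<lambda>u. P.cl (s u) (t u)"] exI[of _ r]) simp
  qed
qed

text \<open>The isomorphism is \<open>[(a, x), e] \<mapsto> e \<cdot> a\<close>.\<close>

lemma baer_sum_trivial:
  fixes E :: "('e, 'x, 'a) extension"
  assumes E: "central_extension X A E"
  shows "ext_equivalent A (baer_sum A T E) E"
proof -
  interpret P: central_ext_pair X A T E by (rule central_ext_pairI) (rule central_trivial E)+
  have c: "continuous_map P.W (rtop E) (\<lambda>w. snd w \<cdot>\<^bsub>E\<^esub> fst (fst w))"
    by (intro P.F.continuous_act continuous_trivial_coordinates continuous_map_from_fibre_product)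
      (auto simp: P.mem_W rset_trivial fib_mem(2)[OF P.F.proj_closed])
  show ?thesis
  proof (rule P.baer_equivalentI[where \<beta> = "\<lambda>w e. e \<cdot>\<^bsub>E\<^esub> fst w", OF E])
    fix v e w f assume v: "v \<in> rset T" "e \<in> rset E" "eproj T v = eproj E e"
      and w: "w \<in> rset T" "f \<in> rset E" "eproj T w = eproj E f"
    obtain a b where ab: "v = (a, eproj E e)" "w = (b, eproj E f)"
      "a \<in> fib (eproj E e)" "b \<in> fib (eproj E f)"
      using v w by (cases v; cases w) (auto simp: rset_trivial)
    let ?x = "eproj E e" and ?y = "eproj E f"
    have "(e \<cdot>\<^bsub>E\<^esub> a) \<triangleleft>\<^bsub>E\<^esub> (f \<cdot>\<^bsub>E\<^esub> b)
        = (e \<triangleleft>\<^bsub>E\<^esub> f) \<cdot>\<^bsub>E\<^esub> (eta A ?x ?y a \<otimes>\<^bsub>fibre A (?x \<triangleleft>\<^bsub>X\<^esub> ?y)\<^esub> tau A ?x ?y b)"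
      using v(2) w(2) ab(3,4) by (simp add: P.F.op_act_left P.F.op_act_right P.F.act_act fib_comm)
    then show "(e \<triangleleft>\<^bsub>E\<^esub> f) \<cdot>\<^bsub>E\<^esub> fst (v \<triangleleft>\<^bsub>T\<^esub> w) = (e \<cdot>\<^bsub>E\<^esub> fst v) \<triangleleft>\<^bsub>E\<^esub> (f \<cdot>\<^bsub>E\<^esub> fst w)"
      using ab(1,2) by simp
  next
    fix x assume "x \<in> rset X"
    with c show "\<exists>U s t. openin (rtop X) U \<and> x \<in> U \<and>
        continuous_map (subtopology (rtop X) U) (rtop T) s \<and>
        continuous_map (subtopology (rtop X) U) (rtop E) t \<and>
        continuous_map (subtopology (rtop X) U) (rtop E) (\<lambda>u. t u \<cdot>\<^bsub>E\<^esub> fst (s u)) \<and>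
        (\<forall>u\<in>U. s u \<in> rset T \<and> t u \<in> rset E \<and> eproj T (s u) = u \<and> eproj E (t u) = u)"
      by (intro P.baer_sections_of_continuous) (simp add: case_prod_unfold)
  qed (auto simp: rset_trivial P.F.act_act fib_comm)
qed

text \<open>The isomorphism sends \<open>[e\<degree>, f]\<close> to the translation from \<open>e\<close> to \<open>f\<close>.  Replacing \<open>e\<close> by \<open>e \<cdot> a\<^sup>-\<^sup>1\<close> or
  \<open>f\<close> by \<open>f \<cdot> a\<close> multiplies this translation by \<open>a\<close>, and the two rules for the action say that
  the translation of a product is the product in the trivial extension.\<close>

lemma baer_sum_opposite:
  fixes E :: "('e, 'x, 'a) extension"
  assumes E: "central_extension X A E"
  shows "ext_equivalent A (baer_sum A (opposite A E) E) T"
proof -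
  interpret E: central_ext X A E by unfold_locales (rule E)
  interpret P: central_ext_pair X A "opposite A E" E by (rule central_ext_pairI) (rule E.central_opposite E)+
  have c: "continuous_map P.W (rtop T) (\<lambda>w. (translation A E (fst w) (snd w), eproj E (fst w)))"
  proof (intro continuous_map_into_trivial E.continuous_translation)
    show 1: "continuous_map P.W (rtop E) fst" "continuous_map P.W (rtop E) snd"
      using continuous_map_from_fibre_product[of "rtop E" "eproj E" "rtop E" "eproj E"] by simp_all
    show "continuous_map P.W (rtop X) (\<lambda>w. eproj E (fst w))"
      using continuous_map_compose[OF 1(1) E.continuous_proj] by (simp add: o_def)
  qed (auto simp: topspace_fibre_product)
  show ?thesis
  proof (rule P.baer_equivalentI[where \<beta> = "\<lambda>e f. (translation A E e f, eproj E e)", OF central_trivial];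
      (unfold E.opposite_simps)?)
    fix e f assume ef: "e \<in> rset E" "f \<in> rset E" "eproj E e = eproj E f"
    then show "(translation A E e f, eproj E e) \<in> rset T"
      "eproj T (translation A E e f, eproj E e) = eproj E e"
      by (simp_all add: rset_trivial)
    fix a assume a: "a \<in> fib (eproj E e)"
    let ?x = "eproj E e" and ?t = "translation A E e f"
    have x: "?x \<in> rset X" using ef by simp
    have t: "?t \<in> fib ?x" "e \<cdot>\<^bsub>E\<^esub> ?t = f"
      using E.translation_closed[OF ef] E.act_translation[OF ef] by simp_all
    have e': "e \<cdot>\<^bsub>E\<^esub> inv\<^bsub>fibre A ?x\<^esub> a \<in> rset E" "eproj E (e \<cdot>\<^bsub>E\<^esub> inv\<^bsub>fibre A ?x\<^esub> a) = ?x"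
      using ef a x by simp_all
    have ta: "?t \<otimes>\<^bsub>fibre A ?x\<^esub> a \<in> fib ?x" using x t a by simp
    have "(e \<cdot>\<^bsub>E\<^esub> inv\<^bsub>fibre A ?x\<^esub> a) \<cdot>\<^bsub>E\<^esub> (?t \<otimes>\<^bsub>fibre A ?x\<^esub> a) = e \<cdot>\<^bsub>E\<^esub> ?t"
      using E.act_act[OF ef(1), of "inv\<^bsub>fibre A ?x\<^esub> a" "?t \<otimes>\<^bsub>fibre A ?x\<^esub> a"] x a ta
        fib_comm[OF x t(1) a] t(1) by simp
    then have "translation A E (e \<cdot>\<^bsub>E\<^esub> inv\<^bsub>fibre A ?x\<^esub> a) f = ?t \<otimes>\<^bsub>fibre A ?x\<^esub> a"
      using E.translation_act[OF e'(1), of "?t \<otimes>\<^bsub>fibre A ?x\<^esub> a"] ta e'(2) t(2) by simp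
    then show "(translation A E (e \<cdot>\<^bsub>E\<^esub> inv\<^bsub>fibre A ?x\<^esub> a) f, eproj E (e \<cdot>\<^bsub>E\<^esub> inv\<^bsub>fibre A ?x\<^esub> a))
        = (?t, ?x) \<cdot>\<^bsub>T\<^esub> a"
      using e'(2) by simp
    have "e \<cdot>\<^bsub>E\<^esub> (?t \<otimes>\<^bsub>fibre A ?x\<^esub> a) = f \<cdot>\<^bsub>E\<^esub> a"
      using E.act_act[OF ef(1) t(1) a] t(2) by simp
    then have "translation A E e (f \<cdot>\<^bsub>E\<^esub> a) = ?t \<otimes>\<^bsub>fibre A ?x\<^esub> a"
      using E.translation_act[OF ef(1) ta] by simp
    then show "(translation A E e (f \<cdot>\<^bsub>E\<^esub> a), ?x) = (?t, ?x) \<cdot>\<^bsub>T\<^esub> a"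
      by simp
  next
    fix e f d g assume ef: "e \<in> rset E" "f \<in> rset E" "eproj E e = eproj E f"
      and dg: "d \<in> rset E" "g \<in> rset E" "eproj E d = eproj E g"
    let ?x = "eproj E e" and ?y = "eproj E d"
    let ?s = "translation A E e f" and ?t = "translation A E d g"
    have s: "?s \<in> fib ?x" "e \<cdot>\<^bsub>E\<^esub> ?s = f" and t: "?t \<in> fib ?y" "d \<cdot>\<^bsub>E\<^esub> ?t = g"
      using E.translation_closed[OF ef] E.act_translation[OF ef]
        E.translation_closed[OF dg] E.act_translation[OF dg] by simp_all
    have xy: "?x \<in> rset X" "?y \<in> rset X" "?x \<triangleleft>\<^bsub>X\<^esub> ?y \<in> rset X" using ef dg by simp_all
    let ?u = "eta A ?x ?y ?s \<otimes>\<^bsub>fibre A (?x \<triangleleft>\<^bsub>X\<^esub> ?y)\<^esub> tau A ?x ?y ?t"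
    have "f \<triangleleft>\<^bsub>E\<^esub> g = (e \<cdot>\<^bsub>E\<^esub> ?s) \<triangleleft>\<^bsub>E\<^esub> (d \<cdot>\<^bsub>E\<^esub> ?t)"
      using s(2) t(2) by simp
    also have "\<dots> = ((e \<triangleleft>\<^bsub>E\<^esub> d) \<cdot>\<^bsub>E\<^esub> tau A ?x ?y ?t) \<cdot>\<^bsub>E\<^esub> eta A ?x ?y ?s"
      using E.op_act_left[OF ef(1) _ s(1), of "d \<cdot>\<^bsub>E\<^esub> ?t"] E.op_act_right[OF ef(1) dg(1) t(1)]
        E.act_closed[OF dg(1) t(1)] E.act_proj[OF dg(1) t(1)] by simp
    also have "\<dots> = (e \<triangleleft>\<^bsub>E\<^esub> d) \<cdot>\<^bsub>E\<^esub> ?u"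
      using E.act_act[of "e \<triangleleft>\<^bsub>E\<^esub> d" "tau A ?x ?y ?t" "eta A ?x ?y ?s"] ef(1) dg(1) xy s(1) t(1)
        fib_comm[OF xy(3), of "tau A ?x ?y ?t" "eta A ?x ?y ?s"] by simp
    finally have fg: "(e \<triangleleft>\<^bsub>E\<^esub> d) \<cdot>\<^bsub>E\<^esub> ?u = f \<triangleleft>\<^bsub>E\<^esub> g" by simp
    have "translation A E (e \<triangleleft>\<^bsub>E\<^esub> d) ((e \<triangleleft>\<^bsub>E\<^esub> d) \<cdot>\<^bsub>E\<^esub> ?u) = ?u"
      by (rule E.translation_act) (use ef(1) dg(1) xy s(1) t(1) in simp_all)
    then show "(translation A E (e \<triangleleft>\<^bsub>E\<^esub> d) (f \<triangleleft>\<^bsub>E\<^esub> g), eproj E (e \<triangleleft>\<^bsub>E\<^esub> d)) = (?s, ?x) \<triangleleft>\<^bsub>T\<^esub> (?t, ?y)"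
      using fg ef(1) dg(1) by simp
  next
    fix x assume "x \<in> rset X"
    with c show "\<exists>U s t. openin (rtop X) U \<and> x \<in> U \<and>
        continuous_map (subtopology (rtop X) U) (rtop E) s \<and>
        continuous_map (subtopology (rtop X) U) (rtop E) t \<and>
        continuous_map (subtopology (rtop X) U) (rtop T) (\<lambda>u. (translation A E (s u) (t u), eproj E (s u))) \<and>
        (\<forall>u\<in>U. s u \<in> rset E \<and> t u \<in> rset E \<and> eproj E (s u) = u \<and> eproj E (t u) = u)"
      using P.baer_sections_of_continuous[of T "\<lambda>e f. (translation A E e f, eproj E e)" x]
      by (simp add: case_prod_unfold)
  qed
qed

end

section \<open>Extensions on other carrier types\<close>

context central_ext
begin

lemma transport:
  fixes j :: "'e \<Rightarrow> 'u"
  assumes inj: "inj_on j (rset E)"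
  shows "\<exists>G :: ('u, 'x, 'a) extension. central_extension X A G \<and> ext_equivalent A E G"
proof -
  define g where "g = inv_into (rset E) j"
  define G :: "('u, 'x, 'a) extension" where
    "G = \<lparr>rtop = pullback_topology (j ` rset E) g (rtop E), rop = (\<lambda>u v. j (g u \<triangleleft>\<^bsub>E\<^esub> g v)),
      eproj = (\<lambda>u. eproj E (g u)), act = (\<lambda>u a. j (g u \<cdot>\<^bsub>E\<^esub> a))\<rparr>"
  have gj [simp]: "g (j e) = e" if "e \<in> rset E" for e
    unfolding g_def using inj that by simp
  have rset_G: "rset G = j ` rset E"
    by (auto simp: G_def topspace_pullback_topology)
  have G_simps [simp]: "u \<triangleleft>\<^bsub>G\<^esub> v = j (g u \<triangleleft>\<^bsub>E\<^esub> g v)" "eproj G u = eproj E (g u)"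
    "u \<cdot>\<^bsub>G\<^esub> a = j (g u \<cdot>\<^bsub>E\<^esub> a)" for u v a
    by (simp_all add: G_def)
  have g: "continuous_map (rtop G) (rtop E) g"
    using continuous_map_pullback[OF continuous_map_id, where f = g and A = "j ` rset E"]
    by (simp add: G_def)
  have j: "continuous_map Z (rtop G) (\<lambda>z. j (h z))" if h: "continuous_map Z (rtop E) h" for Z :: "'z topology" and h
  proof -
    have hE: "h z \<in> rset E" if "z \<in> topspace Z" for z
      using continuous_map_image_subset_topspace[OF h] that by blast
    have "continuous_map Z (rtop E) (g \<circ> (\<lambda>z. j (h z)))"
      by (rule continuous_map_eq[OF h]) (simp add: hE)
    moreover have "topspace Z \<subseteq> (\<lambda>z. j (h z)) -` (j ` rset E)"
      using hE by blast
    ultimately show ?thesis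
      unfolding G_def by (simp add: continuous_map_pullback')
  qed
  have fst_g: "continuous_map (fibre_product (rtop G) p S q) (rtop E) (\<lambda>z. g (fst z))" for p q and S :: "'s topology"
    using continuous_map_compose[OF continuous_map_from_fibre_product(1) g] by (simp add: o_def)
  have snd_g: "continuous_map (fibre_product S p (rtop G) q) (rtop E) (\<lambda>z. g (snd z))" for p q and S :: "'s topology"
    using continuous_map_compose[OF continuous_map_from_fibre_product(2) g] by (simp add: o_def)
  have "central_extension X A G"
  proof (rule central_extensionI[where t = "\<lambda>u v. translation A E (g u) (g v)"])
    have "continuous_map (prod_topology (rtop G) (rtop G)) (rtop G) (\<lambda>z. j (g (fst z) \<triangleleft>\<^bsub>E\<^esub> g (snd z)))"
      using continuous_map_compose[OF continuous_map_fst g] continuous_map_compose[OF continuous_map_snd g]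
      by (intro j continuous_op) (simp_all add: o_def)
    then show "continuous_map (prod_topology (rtop G) (rtop G)) (rtop G) (\<lambda>(u, v). u \<triangleleft>\<^bsub>G\<^esub> v)"
      by (simp add: case_prod_unfold)
    show "(u \<triangleleft>\<^bsub>G\<^esub> v) \<triangleleft>\<^bsub>G\<^esub> w = (u \<triangleleft>\<^bsub>G\<^esub> w) \<triangleleft>\<^bsub>G\<^esub> (v \<triangleleft>\<^bsub>G\<^esub> w)"
      if "u \<in> rset G" "v \<in> rset G" "w \<in> rset G" for u v w
      using that op_distrib[of "g u" "g v" "g w"] unfolding rset_G by (elim imageE) simp
    show "continuous_map (rtop G) (rtop X) (eproj G)"
      by (rule continuous_map_eq[OF continuous_map_compose[OF g continuous_proj]]) simp
    show "continuous_local_sections (rtop G) (rtop X) (eproj G)"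
      unfolding continuous_local_sections_def
    proof
      fix x assume x: "x \<in> rset X"
      obtain U s where U: "openin (rtop X) U" "x \<in> U" and s: "continuous_map (subtopology (rtop X) U) (rtop E) s"
        and ps: "\<And>u. u \<in> U \<Longrightarrow> eproj E (s u) = u"
        using local_section[OF x] by blast
      have "s u \<in> rset E" if "u \<in> U" for u
        using continuous_map_image_subset_topspace[OF s] U(1) openin_subset that by fastforce
      then show "\<exists>U s. openin (rtop X) U \<and> x \<in> U \<and> continuous_map (subtopology (rtop X) U) (rtop G) s
          \<and> (\<forall>u\<in>U. eproj G (s u) = u)"
        using U j[OF s] ps by (intro exI[of _ U] exI[of _ "\<lambda>u. j (s u)"]) simp
    qed
    let ?Z = "fibre_product (rtop G) (eproj G) (total A) (bproj A)"
    have "continuous_map ?Z (rtop G) (\<lambda>z. j (g (fst z) \<cdot>\<^bsub>E\<^esub> snd z))"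
      by (intro j continuous_act fst_g continuous_map_from_fibre_product)
        (auto simp: topspace_fibre_product)
    then show "continuous_map ?Z (rtop G) (\<lambda>(u, a). u \<cdot>\<^bsub>G\<^esub> a)"
      by (simp add: case_prod_unfold)
    have "continuous_map (fibre_product (rtop G) (eproj G) (rtop G) (eproj G)) (total A)
        (\<lambda>z. translation A E (g (fst z)) (g (snd z)))"
      by (intro continuous_translation fst_g snd_g) (auto simp: topspace_fibre_product)
    then show "continuous_map (fibre_product (rtop G) (eproj G) (rtop G) (eproj G)) (total A)
        (\<lambda>(u, v). translation A E (g u) (g v))"
      by (simp add: case_prod_unfold)
  qed (auto simp: rset_G act_act op_act_left op_act_right)
  moreover have "ext_equivalent A E G"
    unfolding ext_equivalent_def
  proof (intro exI conjI)
    have jc: "continuous_map (rtop E) (rtop G) j"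
      using j[OF continuous_map_id] by (simp add: id_def)
    show "ext_morphism A E G j" "ext_morphism A G E g"
      unfolding ext_morphism_def rack_hom_def using jc g by (auto simp: rset_G)
    show "homeomorphic_maps (rtop E) (rtop G) j g"
      unfolding homeomorphic_maps_def using jc g by (auto simp: rset_G)
  qed
  ultimately show ?thesis by blast
qed

text \<open>Relative to one chosen point \<open>s x\<close> in each fibre, a point \<open>e\<close> is determined by its translation
  from \<open>s x\<close>, an element of \<open>A\<close> that also remembers the base point \<open>x\<close>.\<close>

lemma embeds_if_module_embeds:
  fixes \<iota> :: "'a \<Rightarrow> 'u"
  assumes \<iota>: "inj_on \<iota> (topspace (total A))"
  shows "\<exists>j :: 'e \<Rightarrow> 'u. inj_on j (rset E)"
proof -
  define s where "s x = (SOME e. e \<in> rset E \<and> eproj E e = x)" for x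
  have s: "s x \<in> rset E" "eproj E (s x) = x" if "x \<in> rset X" for x
  proof -
    have "\<exists>e. e \<in> rset E \<and> eproj E e = x"
      using proj_image that by (metis imageE)
    then show "s x \<in> rset E" "eproj E (s x) = x"
      unfolding s_def by (metis (mono_tags, lifting) someI_ex)+
  qed
  let ?t = "\<lambda>e. translation A E (s (eproj E e)) e"
  have t: "?t e \<in> topspace (total A)" "bproj A (?t e) = eproj E e" "s (eproj E e) \<cdot>\<^bsub>E\<^esub> ?t e = e"
    if e: "e \<in> rset E" for e
    using translation_closed[OF s(1)[OF proj_closed[OF e]] e s(2)[OF proj_closed[OF e]]]
      act_translation[OF s(1)[OF proj_closed[OF e]] e s(2)[OF proj_closed[OF e]]]
      fib_mem[OF proj_closed[OF e]] s(2)[OF proj_closed[OF e]] by simp_all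
  have "inj_on (\<lambda>e. \<iota> (?t e)) (rset E)"
  proof (rule inj_onI)
    fix e e' assume e: "e \<in> rset E" "e' \<in> rset E" and eq: "\<iota> (?t e) = \<iota> (?t e')"
    have "?t e = ?t e'"
      using inj_onD[OF \<iota> eq] t(1) e by blast
    then show "e = e'"
      using t(2,3)[OF e(1)] t(2,3)[OF e(2)] by metis
  qed
  then show ?thesis by (rule exI[where x = "\<lambda>e. \<iota> (?t e)"])
qed

end

section \<open>The group of extension classes\<close>

locale module_over_rack_embedded = module_over_rack X A
  for X :: "'x top_rack" and A :: "('x, 'a) rack_module" +
  fixes \<iota> :: "'a \<Rightarrow> 'u"
  assumes inj: "inj_on \<iota> (topspace (total A))"
begin

abbreviation cls :: "('e, 'x, 'a) extension \<Rightarrow> ('u, 'x, 'a) extension set" where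
  "cls E \<equiv> ext_class X A E"

abbreviation \<G> :: "('u, 'x, 'a) extension set monoid" where
  "\<G> \<equiv> Ext_group X A"

lemma representative:
  fixes E :: "('e, 'x, 'a) extension"
  assumes "central_extension X A E"
  shows "\<exists>G :: ('u, 'x, 'a) extension. central_extension X A G \<and> ext_equivalent A E G"
proof -
  interpret E: central_ext X A E by unfold_locales (rule assms)
  show ?thesis
    using E.transport E.embeds_if_module_embeds[OF inj] by blast
qed

lemma cls_eq_iff:
  assumes "central_extension X A E" "central_extension X A F"
  shows "cls E = cls F \<longleftrightarrow> ext_equivalent A E F"
proof
  assume eq: "cls E = cls F"
  obtain G :: "('u, 'x, 'a) extension" where "central_extension X A G" "ext_equivalent A E G"
    using representative[OF assms(1)] by blast
  then have "G \<in> cls F"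
    using eq by (auto simp: ext_class_def)
  then show "ext_equivalent A E F"
    using \<open>ext_equivalent A E G\<close> by (auto simp: ext_class_def intro: ext_equivalent_trans ext_equivalent_sym)
next
  assume "ext_equivalent A E F"
  then show "cls E = cls F"
    by (auto simp: ext_class_def intro: ext_equivalent_trans ext_equivalent_sym)
qed

lemma cls_same_type:
  fixes G :: "('u, 'x, 'a) extension"
  assumes "central_extension X A G"
  shows "cls G = ext_rel X A `` {G}"
  using assms by (auto simp: ext_class_def ext_rel_def)

lemma cls_closed:
  assumes "central_extension X A E"
  shows "cls E \<in> carrier \<G>"
proof -
  obtain G :: "('u, 'x, 'a) extension" where G: "central_extension X A G" "ext_equivalent A E G"
    using representative[OF assms] by blast
  then have "cls E = ext_rel X A `` {G}"
    using cls_eq_iff[OF assms G(1)] cls_same_type[OF G(1)] by simp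
  then show ?thesis
    using G(1) by (simp add: Ext_group_def Ext_def quotientI)
qed

lemma carrier_cases:
  assumes "C \<in> carrier \<G>"
  obtains G :: "('u, 'x, 'a) extension" where "central_extension X A G" "C = cls G"
  using assms cls_same_type unfolding Ext_group_def Ext_def by (auto elim!: quotientE)

text \<open>The product of two classes is a union over representatives on \<open>'u\<close>.  It is a union of equal sets
  because the Baer sum respects equivalence, also between extensions on different types.\<close>

lemma mult_cls:
  fixes E :: "('e, 'x, 'a) extension" and F :: "('f, 'x, 'a) extension"
  assumes E: "central_extension X A E" and F: "central_extension X A F"
  shows "cls E \<otimes>\<^bsub>\<G>\<^esub> cls F = cls (baer_sum A E F)"
proof -
  have eq: "cls (baer_sum A E' F') = cls (baer_sum A E F)"
    if "E' \<in> cls E" "F' \<in> cls F" for E' F' :: "('u, 'x, 'a) extension"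
  proof -
    have E': "central_extension X A E'" "ext_equivalent A E' E"
      and F': "central_extension X A F'" "ext_equivalent A F' F"
      using that ext_equivalent_sym by (auto simp: ext_class_def)
    show ?thesis
      using cls_eq_iff[OF central_baer[OF E'(1) F'(1)] central_baer[OF E F]]
        baer_sum_cong[OF E'(1) F'(1) E F E'(2) F'(2)] by simp
  qed
  have "cls E \<noteq> {}" "cls F \<noteq> {}"
    using representative[OF E] representative[OF F] unfolding ext_class_def by blast+
  moreover have "(\<Union>E'\<in>cls E. \<Union>F'\<in>cls F. cls (baer_sum A E' F'))
      = (\<Union>E'\<in>cls E. \<Union>F'\<in>cls F. cls (baer_sum A E F))"
    using eq by (intro SUP_cong refl)
  ultimately show ?thesis by (simp add: Ext_group_def)
qed

lemma one_cls: "\<one>\<^bsub>\<G>\<^esub> = cls T"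
  by (simp add: Ext_group_def)

lemma comm_group_Ext: "comm_group \<G>"
proof (rule comm_groupI)
  show "\<one>\<^bsub>\<G>\<^esub> \<in> carrier \<G>"
    unfolding one_cls by (rule cls_closed[OF central_trivial])
  fix C assume "C \<in> carrier \<G>"
  then obtain E :: "('u, 'x, 'a) extension" where E: "central_extension X A E" "C = cls E"
    by (rule carrier_cases)
  have E': "central_extension X A (opposite A E)"
    using E(1) by (simp add: central_ext.central_opposite central_ext_def central_ext_axioms_def module_over_rack_axioms)
  show "\<one>\<^bsub>\<G>\<^esub> \<otimes>\<^bsub>\<G>\<^esub> C = C"
    unfolding one_cls E(2) mult_cls[OF central_trivial E(1)]
    using cls_eq_iff[OF central_baer[OF central_trivial E(1)] E(1)] baer_sum_trivial[OF E(1)] by simp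
  have "cls (opposite A E) \<otimes>\<^bsub>\<G>\<^esub> C = \<one>\<^bsub>\<G>\<^esub>"
    unfolding one_cls E(2) mult_cls[OF E' E(1)]
    using cls_eq_iff[OF central_baer[OF E' E(1)] central_trivial] baer_sum_opposite[OF E(1)] by simp
  then show "\<exists>D\<in>carrier \<G>. D \<otimes>\<^bsub>\<G>\<^esub> C = \<one>\<^bsub>\<G>\<^esub>"
    using cls_closed[OF E'] by blast
  fix D assume "D \<in> carrier \<G>"
  then obtain F :: "('u, 'x, 'a) extension" where F: "central_extension X A F" "D = cls F"
    by (rule carrier_cases)
  show "C \<otimes>\<^bsub>\<G>\<^esub> D \<in> carrier \<G>"
    unfolding E(2) F(2) mult_cls[OF E(1) F(1)] by (rule cls_closed[OF central_baer[OF E(1) F(1)]])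
  show "C \<otimes>\<^bsub>\<G>\<^esub> D = D \<otimes>\<^bsub>\<G>\<^esub> C"
    unfolding E(2) F(2) mult_cls[OF E(1) F(1)] mult_cls[OF F(1) E(1)]
    using cls_eq_iff[OF central_baer[OF E(1) F(1)] central_baer[OF F(1) E(1)]]
      baer_sum_commute[OF E(1) F(1)] by simp
  fix K assume "K \<in> carrier \<G>"
  then obtain G :: "('u, 'x, 'a) extension" where G: "central_extension X A G" "K = cls G"
    by (rule carrier_cases)
  note EF = central_baer[OF E(1) F(1)] and FG = central_baer[OF F(1) G(1)]
  show "C \<otimes>\<^bsub>\<G>\<^esub> D \<otimes>\<^bsub>\<G>\<^esub> K = C \<otimes>\<^bsub>\<G>\<^esub> (D \<otimes>\<^bsub>\<G>\<^esub> K)"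
    unfolding E(2) F(2) G(2) mult_cls[OF E(1) F(1)] mult_cls[OF F(1) G(1)] mult_cls[OF EF G(1)] mult_cls[OF E(1) FG]
    using cls_eq_iff[OF central_baer[OF EF G(1)] central_baer[OF E(1) FG]]
      baer_sum_assoc[OF E(1) F(1) G(1)] by simp
qed

lemma inv_cls:
  assumes E: "central_extension X A E"
  shows "central_extension X A (opposite A E)" "inv\<^bsub>\<G>\<^esub> (cls E) = cls (opposite A E)"
proof -
  interpret E: central_ext X A E by unfold_locales (rule E)
  show E': "central_extension X A (opposite A E)" by (rule E.central_opposite)
  have "cls (opposite A E) \<otimes>\<^bsub>\<G>\<^esub> cls E = \<one>\<^bsub>\<G>\<^esub>"
    unfolding one_cls mult_cls[OF E' E]
    using cls_eq_iff[OF central_baer[OF E' E] central_trivial] baer_sum_opposite[OF E] by simp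
  then show "inv\<^bsub>\<G>\<^esub> (cls E) = cls (opposite A E)"
    using group.inv_equality[OF comm_group.axioms(2)[OF comm_group_Ext]] cls_closed[OF E] cls_closed[OF E'] by blast
qed

end

theorem corollary6p11:
  fixes X :: "'x top_rack"
    and A :: "('x, 'a) rack_module"
    and \<G> :: "('u, 'x, 'a) extension set monoid"
  assumes "topological_rack X"
    and "rack_module X A"
    and "\<exists>\<iota> :: 'a \<Rightarrow> 'u. inj_on \<iota> (topspace (total A))"
  defines "\<G> \<equiv> Ext_group X A"
  shows "comm_group \<G>
    \<and> central_extension X A (trivial_ext X A)
    \<and> \<one>\<^bsub>\<G>\<^esub> = ext_class X A (trivial_ext X A)
    \<and> (\<forall>E :: ('e, 'x, 'a) extension. central_extension X A E \<longrightarrow>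
         ext_class X A E \<in> carrier \<G>
         \<and> central_extension X A (opposite A E)
         \<and> inv\<^bsub>\<G>\<^esub> (ext_class X A E) = ext_class X A (opposite A E))
    \<and> (\<forall>(E :: ('e, 'x, 'a) extension) (F :: ('f, 'x, 'a) extension).
         central_extension X A E \<longrightarrow> central_extension X A F \<longrightarrow>
         central_extension X A (baer_sum A E F)
         \<and> ext_class X A E \<otimes>\<^bsub>\<G>\<^esub> ext_class X A F = ext_class X A (baer_sum A E F))"
proof -
  obtain \<iota> :: "'a \<Rightarrow> 'u" where "inj_on \<iota> (topspace (total A))"
    using assms(3) by blast
  then interpret module_over_rack_embedded X A \<iota>
    using assms(1,2) by unfold_locales
  show ?thesis
    unfolding \<G>_def
    by (intro conjI allI impI comm_group_Ext central_trivial one_cls cls_closed inv_cls central_baer mult_cls)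
qed

end
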